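(* (Provably in ZF, i.e. without the axiom of choice.) The box game $G(\mathbb{N}, \mathcal{P}(\mathbb{R}), \mathbb{R})$ is winnable: there is an explicit team strategy for countably many players, with the set of boxes equal to the power set $\mathcal{P}(\mathbb{R})$ of the reals and box values real numbers, which guarantees that for every assignment of real numbers to the boxes at most one player fails.
   Context: Box games. For sets $P$ (players), $B$ (boxes) and $V$ (possible values), the box game $G(P,B,V)$ is played as follows. An unknown function $v: B \to V$ assigns a value to each box. Each player $p \in P$, separately and with no communication with the other players once the game begins, faces the same configuration $v$ (all boxes closed): the player makes a (possibly transfinite) sequence of moves, each of which is either (i) opening a subset of the boxes (thereby seeing the values in them), or (ii) a final move consisting of a pair $(b, x) \in B \times V$ with $b$ a box not yet opened by that player, meaning the player guesses that box $b$ contains the value $x$. A strategy $\sigma_p$ for player $p$ is a function whose input is the history of moves the player has made together with the values in the boxes they have seen, and whose output is the player's next move; a team strategy $\sigma$ is a family $(\sigma_p)_{p \in P}$. Player $p$ fails on $v$ if either they guess $(b,x)$ with $v(b) \neq x$, or they open all boxes without ever making a guess. $G(P,B,V)$ is winnable if there is a team strategy $\sigma$ such that for every $v : B \to V$, at most one player fails. *)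

theory Defs
  imports Main
begin

section \<open>First-order formulas of set theory and their satisfaction\<close>

text \<open>
  HOL has a built-in choice operator, so a statement about HOL sets cannot express provability in
  ZF without choice. We therefore speak about an arbitrary first-order structure
  \<open>('m, \<in>\<^sub>M)\<close> satisfying the axioms of ZF. By the completeness theorem, a first-order sentence
  is provable in ZF if and only if it holds in all such structures; by the downward
  Loewenheim-Skolem theorem the instance \<^typ>\<open>nat\<close> of the type variable already covers this.
  Accordingly, every notion below is first-order over the structure: its quantifiers range over
  \<open>'m\<close> only. The exception are the two axiom schemas, which quantify over formulas, represented as
  a datatype, and over assignments of parameters. With arbitrary HOL predicates in place of
  formulas, the axiom of choice would hold in the structure.
\<close>

datatype fm =
    Mem nat nat
  | Eq nat nat
  | Neg fm
  | Conj fm fm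
  | Ex nat fm

primrec sat :: "('m \<Rightarrow> 'm \<Rightarrow> bool) \<Rightarrow> (nat \<Rightarrow> 'm) \<Rightarrow> fm \<Rightarrow> bool" where
  "sat mem e (Mem i j) = mem (e i) (e j)"
| "sat mem e (Eq i j) = (e i = e j)"
| "sat mem e (Neg p) = (\<not> sat mem e p)"
| "sat mem e (Conj p q) = (sat mem e p \<and> sat mem e q)"
| "sat mem e (Ex i p) = (\<exists>a. sat mem (e(i := a)) p)"


section \<open>Set-theoretic notions inside a structure\<close>

locale set_structure =
  fixes mem :: "'m \<Rightarrow> 'm \<Rightarrow> bool"  (infix "\<in>\<^sub>M" 50)
begin

definition subset :: "'m \<Rightarrow> 'm \<Rightarrow> bool"  (infix "\<subseteq>\<^sub>M" 50) where
  "a \<subseteq>\<^sub>M b \<longleftrightarrow> (\<forall>z. z \<in>\<^sub>M a \<longrightarrow> z \<in>\<^sub>M b)"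

definition is_empty :: "'m \<Rightarrow> bool" where
  "is_empty a \<longleftrightarrow> (\<forall>z. \<not> z \<in>\<^sub>M a)"

definition is_succ :: "'m \<Rightarrow> 'm \<Rightarrow> bool" where
  "is_succ a b \<longleftrightarrow> (\<forall>z. z \<in>\<^sub>M b \<longleftrightarrow> z \<in>\<^sub>M a \<or> z = a)"

definition is_Pow :: "'m \<Rightarrow> 'm \<Rightarrow> bool" where
  "is_Pow a b \<longleftrightarrow> (\<forall>z. z \<in>\<^sub>M b \<longleftrightarrow> z \<subseteq>\<^sub>M a)"

definition is_upair :: "'m \<Rightarrow> 'm \<Rightarrow> 'm \<Rightarrow> bool" where
  "is_upair a b c \<longleftrightarrow> (\<forall>z. z \<in>\<^sub>M c \<longleftrightarrow> z = a \<or> z = b)"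

text \<open>Kuratowski pairs.\<close>

definition is_pair :: "'m \<Rightarrow> 'm \<Rightarrow> 'm \<Rightarrow> bool" where
  "is_pair a b p \<longleftrightarrow> (\<exists>c d. is_upair a a c \<and> is_upair a b d \<and> is_upair c d p)"

text \<open>\<open>maps f x y\<close> says that the pair of \<open>x\<close> and \<open>y\<close> is an element of \<open>f\<close>.\<close>

definition maps :: "'m \<Rightarrow> 'm \<Rightarrow> 'm \<Rightarrow> bool" where
  "maps f x y \<longleftrightarrow> (\<exists>p. is_pair x y p \<and> p \<in>\<^sub>M f)"

definition is_function :: "'m \<Rightarrow> 'm \<Rightarrow> 'm \<Rightarrow> bool" where
  "is_function f A B \<longleftrightarrow>
     (\<forall>p. p \<in>\<^sub>M f \<longrightarrow> (\<exists>x y. x \<in>\<^sub>M A \<and> y \<in>\<^sub>M B \<and> is_pair x y p)) \<and>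
     (\<forall>x. x \<in>\<^sub>M A \<longrightarrow> (\<exists>!y. maps f x y))"

definition is_restriction :: "'m \<Rightarrow> 'm \<Rightarrow> 'm \<Rightarrow> bool" where
  "is_restriction f A g \<longleftrightarrow>
     (\<forall>p. p \<in>\<^sub>M g \<longleftrightarrow> p \<in>\<^sub>M f \<and> (\<exists>x y. x \<in>\<^sub>M A \<and> is_pair x y p))"

definition transitive :: "'m \<Rightarrow> bool" where
  "transitive a \<longleftrightarrow> (\<forall>z. z \<in>\<^sub>M a \<longrightarrow> z \<subseteq>\<^sub>M a)"

text \<open>In the presence of Foundation, these are exactly the von Neumann ordinals.\<close>

definition is_ordinal :: "'m \<Rightarrow> bool" where
  "is_ordinal a \<longleftrightarrow> transitive a \<and> (\<forall>z. z \<in>\<^sub>M a \<longrightarrow> transitive z)"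

definition is_inductive :: "'m \<Rightarrow> bool" where
  "is_inductive a \<longleftrightarrow>
     (\<exists>z. is_empty z \<and> z \<in>\<^sub>M a) \<and>
     (\<forall>x. x \<in>\<^sub>M a \<longrightarrow> (\<exists>y. is_succ x y \<and> y \<in>\<^sub>M a))"

definition is_omega :: "'m \<Rightarrow> bool" where
  "is_omega N \<longleftrightarrow> is_inductive N \<and> (\<forall>a. is_inductive a \<longrightarrow> N \<subseteq>\<^sub>M a)"


section \<open>The real numbers inside a structure\<close>

definition is_binop :: "'m \<Rightarrow> 'm \<Rightarrow> bool" where
  "is_binop f R \<longleftrightarrow>
     (\<forall>q. q \<in>\<^sub>M f \<longrightarrow>
        (\<exists>x y z p. x \<in>\<^sub>M R \<and> y \<in>\<^sub>M R \<and> z \<in>\<^sub>M R \<and> is_pair x y p \<and> is_pair p z q)) \<and>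
     (\<forall>x y. x \<in>\<^sub>M R \<longrightarrow> y \<in>\<^sub>M R \<longrightarrow> (\<exists>!z. \<exists>p. is_pair x y p \<and> maps f p z))"

text \<open>The description is used only for elements of \<open>R\<close> and \<open>f\<close> with \<open>is_binop f R\<close>, where the
  value exists uniquely.\<close>

definition binop :: "'m \<Rightarrow> 'm \<Rightarrow> 'm \<Rightarrow> 'm" where
  "binop f x y = (THE z. \<exists>p. is_pair x y p \<and> maps f p z)"

definition is_ordered_field :: "'m \<Rightarrow> 'm \<Rightarrow> 'm \<Rightarrow> 'm \<Rightarrow> bool" where
  "is_ordered_field R add mul lt \<longleftrightarrow>
     is_binop add R \<and> is_binop mul R \<and>
     (\<forall>x y z. x \<in>\<^sub>M R \<longrightarrow> y \<in>\<^sub>M R \<longrightarrow> z \<in>\<^sub>M R \<longrightarrow>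
        binop add (binop add x y) z = binop add x (binop add y z) \<and>
        binop mul (binop mul x y) z = binop mul x (binop mul y z) \<and>
        binop add x y = binop add y x \<and>
        binop mul x y = binop mul y x \<and>
        binop mul x (binop add y z) = binop add (binop mul x y) (binop mul x z)) \<and>
     (\<exists>zero one. zero \<in>\<^sub>M R \<and> one \<in>\<^sub>M R \<and> zero \<noteq> one \<and>
        (\<forall>x. x \<in>\<^sub>M R \<longrightarrow>
           binop add zero x = x \<and> binop mul one x = x \<and>
           (\<exists>y. y \<in>\<^sub>M R \<and> binop add x y = zero) \<and>
           (x \<noteq> zero \<longrightarrow> (\<exists>y. y \<in>\<^sub>M R \<and> binop mul x y = one))) \<and>
        (\<forall>x y. x \<in>\<^sub>M R \<longrightarrow> y \<in>\<^sub>M R \<longrightarrow> maps lt zero x \<longrightarrow> maps lt zero y \<longrightarrow>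
           maps lt zero (binop mul x y))) \<and>
     (\<forall>x. x \<in>\<^sub>M R \<longrightarrow> \<not> maps lt x x) \<and>
     (\<forall>x y. x \<in>\<^sub>M R \<longrightarrow> y \<in>\<^sub>M R \<longrightarrow> maps lt x y \<or> x = y \<or> maps lt y x) \<and>
     (\<forall>x y z. x \<in>\<^sub>M R \<longrightarrow> y \<in>\<^sub>M R \<longrightarrow> z \<in>\<^sub>M R \<longrightarrow> maps lt x y \<longrightarrow>
        (maps lt y z \<longrightarrow> maps lt x z) \<and> maps lt (binop add x z) (binop add y z))"

definition is_upper_bound :: "'m \<Rightarrow> 'm \<Rightarrow> 'm \<Rightarrow> 'm \<Rightarrow> bool" where
  "is_upper_bound R lt S u \<longleftrightarrow>
     u \<in>\<^sub>M R \<and> (\<forall>x. x \<in>\<^sub>M S \<longrightarrow> x = u \<or> maps lt x u)"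

text \<open>A complete ordered field, that is, the field of real numbers, which ZF proves to exist and
  to be unique up to isomorphism. Completeness is that of the structure: only sets
  \<open>S\<close> of the structure are considered.\<close>

definition is_reals :: "'m \<Rightarrow> 'm \<Rightarrow> 'm \<Rightarrow> 'm \<Rightarrow> bool" where
  "is_reals R add mul lt \<longleftrightarrow>
     is_ordered_field R add mul lt \<and>
     (\<forall>S. S \<subseteq>\<^sub>M R \<longrightarrow> \<not> is_empty S \<longrightarrow> (\<exists>u. is_upper_bound R lt S u) \<longrightarrow>
        (\<exists>u. is_upper_bound R lt S u \<and>
           (\<forall>w. is_upper_bound R lt S w \<longrightarrow> u = w \<or> maps lt u w)))"


section \<open>Box games inside a structure\<close>

text \<open>
  The past opening moves of a player form a function \<open>s\<close> from an ordinal to the sets of boxes.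
  Every opening move has to open at least one box that is still closed. This makes precise that a
  play goes on until a guess is made or all boxes are open: otherwise a player could stall forever
  and, neither guessing nor opening all boxes, would never fail.
\<close>

definition opened :: "'m \<Rightarrow> 'm \<Rightarrow> bool" where
  "opened s b \<longleftrightarrow> (\<exists>\<beta> S. maps s \<beta> S \<and> b \<in>\<^sub>M S)"

definition is_opening_sequence :: "'m \<Rightarrow> 'm \<Rightarrow> bool" where
  "is_opening_sequence B s \<longleftrightarrow>
     (\<exists>\<alpha> PB. is_ordinal \<alpha> \<and> is_Pow B PB \<and> is_function s \<alpha> PB) \<and>
     (\<forall>\<beta> S s'. maps s \<beta> S \<longrightarrow> is_restriction s \<beta> s' \<longrightarrow>
        (\<exists>b. b \<in>\<^sub>M S \<and> \<not> opened s' b))"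

text \<open>A history is a pair of an opening sequence and a function giving the values seen in the
  opened boxes. The guess, being the final move, never belongs to a history.\<close>

definition is_history :: "'m \<Rightarrow> 'm \<Rightarrow> 'm \<Rightarrow> 'm \<Rightarrow> 'm \<Rightarrow> bool" where
  "is_history B V s w h \<longleftrightarrow>
     is_opening_sequence B s \<and>
     (\<exists>D. (\<forall>b. b \<in>\<^sub>M D \<longleftrightarrow> opened s b) \<and> is_function w D V) \<and>
     is_pair s w h"

definition all_opened :: "'m \<Rightarrow> 'm \<Rightarrow> bool" where
  "all_opened B s \<longleftrightarrow> (\<forall>b. b \<in>\<^sub>M B \<longrightarrow> opened s b)"

text \<open>Moves are tagged: \<open>(0, S)\<close> opens the boxes in \<open>S\<close>, and \<open>(1, (b, x))\<close> guesses that box \<open>b\<close>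
  contains \<open>x\<close>.\<close>

definition is_open_move :: "'m \<Rightarrow> 'm \<Rightarrow> bool" where
  "is_open_move S m \<longleftrightarrow> (\<exists>zero. is_empty zero \<and> is_pair zero S m)"

definition is_guess_move :: "'m \<Rightarrow> 'm \<Rightarrow> 'm \<Rightarrow> bool" where
  "is_guess_move b x m \<longleftrightarrow>
     (\<exists>zero one p. is_empty zero \<and> is_succ zero one \<and> is_pair b x p \<and> is_pair one p m)"

definition legal_move :: "'m \<Rightarrow> 'm \<Rightarrow> 'm \<Rightarrow> 'm \<Rightarrow> bool" where
  "legal_move B V s m \<longleftrightarrow>
     (\<exists>S. S \<subseteq>\<^sub>M B \<and> (\<exists>b. b \<in>\<^sub>M S \<and> \<not> opened s b) \<and> is_open_move S m) \<or>
     (\<exists>b x. b \<in>\<^sub>M B \<and> \<not> opened s b \<and> x \<in>\<^sub>M V \<and> is_guess_move b x m)"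

text \<open>A strategy is a set of the structure: a function assigning a legal move to every history in
  which some box is still closed.\<close>

definition is_strategy :: "'m \<Rightarrow> 'm \<Rightarrow> 'm \<Rightarrow> bool" where
  "is_strategy B V \<tau> \<longleftrightarrow>
     (\<forall>p. p \<in>\<^sub>M \<tau> \<longrightarrow>
        (\<exists>s w h m. is_history B V s w h \<and> \<not> all_opened B s \<and> legal_move B V s m \<and>
           is_pair h m p)) \<and>
     (\<forall>s w h. is_history B V s w h \<longrightarrow> \<not> all_opened B s \<longrightarrow> (\<exists>!m. maps \<tau> h m))"

definition is_team_strategy :: "'m \<Rightarrow> 'm \<Rightarrow> 'm \<Rightarrow> 'm \<Rightarrow> bool" where
  "is_team_strategy P B V \<sigma> \<longleftrightarrow>
     (\<forall>q. q \<in>\<^sub>M \<sigma> \<longrightarrow> (\<exists>p \<tau>. p \<in>\<^sub>M P \<and> is_strategy B V \<tau> \<and> is_pair p \<tau> q)) \<and>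
     (\<forall>p. p \<in>\<^sub>M P \<longrightarrow> (\<exists>!\<tau>. maps \<sigma> p \<tau>))"

text \<open>\<open>sees v s w\<close>: when the boxes contain the values \<open>v\<close>, the values seen after the moves \<open>s\<close>
  are \<open>w\<close>.\<close>

definition sees :: "'m \<Rightarrow> 'm \<Rightarrow> 'm \<Rightarrow> bool" where
  "sees v s w \<longleftrightarrow>
     (\<forall>p. p \<in>\<^sub>M w \<longleftrightarrow> p \<in>\<^sub>M v \<and> (\<exists>b x. opened s b \<and> is_pair b x p))"

text \<open>\<open>reaches B v \<tau> s h\<close>: the history \<open>h\<close>, with opening moves \<open>s\<close>, occurs when \<open>\<tau>\<close> is played
  against \<open>v\<close>, that is, each move in \<open>s\<close> is the one \<open>\<tau>\<close> prescribes for the preceding history.\<close>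

definition reaches :: "'m \<Rightarrow> 'm \<Rightarrow> 'm \<Rightarrow> 'm \<Rightarrow> 'm \<Rightarrow> bool" where
  "reaches B v \<tau> s h \<longleftrightarrow>
     is_opening_sequence B s \<and>
     (\<exists>w. sees v s w \<and> is_pair s w h) \<and>
     (\<forall>\<beta> S. maps s \<beta> S \<longrightarrow>
        (\<exists>s' w' h' m. is_restriction s \<beta> s' \<and> sees v s' w' \<and> is_pair s' w' h' \<and>
           is_open_move S m \<and> maps \<tau> h' m))"

definition fails :: "'m \<Rightarrow> 'm \<Rightarrow> 'm \<Rightarrow> bool" where
  "fails B v \<tau> \<longleftrightarrow>
     (\<exists>s h. reaches B v \<tau> s h \<and>
        ((\<exists>b x m. maps \<tau> h m \<and> is_guess_move b x m \<and> \<not> maps v b x) \<or> all_opened B s))"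

definition winnable :: "'m \<Rightarrow> 'm \<Rightarrow> 'm \<Rightarrow> bool" where
  "winnable P B V \<longleftrightarrow>
     (\<exists>\<sigma>. is_team_strategy P B V \<sigma> \<and>
        (\<forall>v. is_function v B V \<longrightarrow>
           (\<forall>p q \<tau> \<rho>. maps \<sigma> p \<tau> \<longrightarrow> maps \<sigma> q \<rho> \<longrightarrow>
              fails B v \<tau> \<longrightarrow> fails B v \<rho> \<longrightarrow> p = q)))"

end


section \<open>Structures satisfying ZF\<close>

text \<open>In the two schemas, the variables from index 1 and 2 on, respectively, of the assignment \<open>e\<close>
  serve as parameters.\<close>

locale ZF = set_structure +
  assumes extensionality: "\<forall>a b. (\<forall>z. z \<in>\<^sub>M a \<longleftrightarrow> z \<in>\<^sub>M b) \<longrightarrow> a = b"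
    and foundation:
      "\<forall>a. (\<exists>x. x \<in>\<^sub>M a) \<longrightarrow> (\<exists>x. x \<in>\<^sub>M a \<and> \<not> (\<exists>y. y \<in>\<^sub>M x \<and> y \<in>\<^sub>M a))"
    and pairing: "\<forall>a b. \<exists>c. is_upair a b c"
    and union: "\<forall>a. \<exists>u. \<forall>z. z \<in>\<^sub>M u \<longleftrightarrow> (\<exists>x. x \<in>\<^sub>M a \<and> z \<in>\<^sub>M x)"
    and powerset: "\<forall>a. \<exists>b. is_Pow a b"
    and infinity: "\<exists>a. is_inductive a"
    and separation:
      "\<forall>\<phi> e a. \<exists>b. \<forall>z. z \<in>\<^sub>M b \<longleftrightarrow> z \<in>\<^sub>M a \<and> sat mem (e(0 := z)) \<phi>"
    and replacement:
      "\<forall>\<phi> e a.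
         (\<forall>x y y'. x \<in>\<^sub>M a \<longrightarrow> sat mem (e(0 := x, 1 := y)) \<phi> \<longrightarrow>
            sat mem (e(0 := x, 1 := y')) \<phi> \<longrightarrow> y = y') \<longrightarrow>
         (\<exists>b. \<forall>y. y \<in>\<^sub>M b \<longleftrightarrow> (\<exists>x. x \<in>\<^sub>M a \<and> sat mem (e(0 := x, 1 := y)) \<phi>))"

end

theory Submission
  imports Defs
begin

text \<open>
  The boxes are named \<open>box W p n\<close> with \<open>W\<close> a set of functions \<open>y : \<omega> \<times> \<omega> \<rightarrow> R\<close> and \<open>p, n \<in> \<omega>\<close>;
  row \<open>p\<close> of the boxes with a given \<open>W\<close> belongs to player \<open>p\<close>. Every \<open>v\<close> builds an injective
  transfinite list of such functions: at a stage where the members of the list form the set \<open>W\<close>, let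
  \<open>y q n\<close> be the content of \<open>box W q n\<close>. The stage is covered if every row of \<open>y\<close> agrees up to finitely
  many places with that row of some listed function, and also the sequence of deviations (how far one
  has to go in row \<open>q\<close> before \<open>y\<close> agrees with the first such function) is, up to finitely many places,
  given by a listed function. If the stage is not covered, \<open>y\<close> or the sequence of deviations is new and
  is appended. By Hartogs' theorem a covered stage is reached, and there the list supplies the
  representatives of equivalence classes for which one usually needs the axiom of choice.

  At the covered stage player \<open>p\<close> sees all other rows, hence all other deviations and the representative
  of the sequence of deviations. It predicts a bound on the deviation of row \<open>p\<close> which is also at
  least every other deviation differing from its prediction. The player guesses, at the place of the
  bound, the value of the row's representative. A wrong guess means that the deviation of row \<open>p\<close>
  exceeds the bound, so among two players with wrong guesses each deviation would exceed the other.

  The player never needs to know the list in advance: opening every box that is not the guess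
  for any \<open>v\<close> compatible with what has been seen never opens the right box, and when this makes no
  progress the guess is determined.
\<close>

section \<open>Definability\<close>

text \<open>Separation and Replacement hold for first-order formulas only, so whatever forms a set
  must be shown definable; hence the many rules in \<open>dfn\<close>. The choice operator of HOL
  names only single elements of the structure, such as \<open>zer\<close>, \<open>base\<close> and a
  Hartogs number, which enter formulas as parameters. Values needed for all members of a set at once
  are unique ones described by \<open>desc\<close>, or least ones among ordinals. Sets of reals are
  needed as boxes because a configuration has countably many real entries and can be coded by one
  real: a set of configurations with two numbers as tag is then named by a set of reals. Agreement
  up to finitely many places is used twice. Along a row, it makes the representative insensitive to
  the one box that remains closed. Along the column of deviations, it makes the prediction
  insensitive to the deviation of the player's own row, which would depend on that closed
  box.\<close>

primrec ren :: "(nat \<Rightarrow> nat) \<Rightarrow> fm \<Rightarrow> fm" where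
  "ren r (Mem i j) = Mem (r i) (r j)"
| "ren r (Eq i j) = Eq (r i) (r j)"
| "ren r (Neg p) = Neg (ren r p)"
| "ren r (Conj p q) = Conj (ren r p) (ren r q)"
| "ren r (Ex i p) = Ex (r i) (ren r p)"

text \<open>Bound variables are renamed as well. Injectivity keeps an update at \<open>r i\<close>
  from touching the image of another variable.\<close>

lemma sat_ren:
  assumes "inj r"
  shows "sat mem e (ren r p) = sat mem (e \<circ> r) p"
proof (induction p arbitrary: e)
  case (Ex i p)
  have "e(r i := a) \<circ> r = (e \<circ> r)(i := a)" for a
    using assms by (auto simp: fun_eq_iff inj_eq)
  then show ?case by (simp only: ren.simps sat.simps Ex.IH)
qed auto

definition mix :: "(nat \<Rightarrow> 'a) \<Rightarrow> (nat \<Rightarrow> 'a) \<Rightarrow> nat \<Rightarrow> 'a" where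
  "mix e c n = (if even n then e (n div 2) else c (n div 2))"

lemma mix_simps [simp]: "mix e c (2 * n) = e n" "mix e c (Suc (2 * n)) = c n"
  by (auto simp: mix_def)

lemma mix_eqI:
  assumes "\<And>n. f (2 * n) = g (2 * n)" "\<And>n. f (Suc (2 * n)) = g (Suc (2 * n))"
  shows "f = g"
proof
  fix k show "f k = g k"
    using assms by (cases "even k") (auto elim!: evenE oddE)
qed

context ZF
begin

text \<open>
  \<open>dfn P\<close> says that a predicate on assignments is first-order definable with parameters, \<open>dtm t\<close> that the
  graph of \<open>t\<close> is. Even variables of the formula are those of the assignment, odd ones hold the parameters.
  Bound variables are de Bruijn indices, so that the rules collected in \<open>dfn\<close> prove definability
  by resolution.
\<close>

definition dfn :: "((nat \<Rightarrow> 'a) \<Rightarrow> bool) \<Rightarrow> bool" where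
  "dfn P \<longleftrightarrow> (\<exists>\<phi> c. \<forall>e. P e = sat mem (mix e c) \<phi>)"

definition dtm :: "((nat \<Rightarrow> 'a) \<Rightarrow> 'a) \<Rightarrow> bool" where
  "dtm t \<longleftrightarrow> dfn (\<lambda>e. e 0 = t (\<lambda>n. e (Suc n)))"

named_theorems dfn

lemma dfnI: "(\<And>e. P e = sat mem (mix e c) \<phi>) \<Longrightarrow> dfn P"
  unfolding dfn_def by blast

lemma dfn_ren:
  assumes "dfn P" "inj r"
  shows "dfn (\<lambda>e. P (\<lambda>n. e (r n)))"
proof -
  obtain \<phi> c where P: "\<And>e. P e = sat mem (mix e c) \<phi>"
    using assms(1) dfn_def by auto
  \<comment> \<open>Only the even places are renamed; the parameters at the odd ones stay.\<close>
  define s where "s k = (if even k then 2 * r (k div 2) else k)" for k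
  have "inj s"
    unfolding s_def inj_def
  proof (intro allI impI)
    fix x y assume *: "(if even x then 2 * r (x div 2) else x) = (if even y then 2 * r (y div 2) else y)"
    then have "even x = even y" by (metis even_mult_iff even_numeral)
    with * show "x = y" using assms(2) by (auto simp: inj_eq split: if_splits elim!: evenE)
  qed
  have "mix (\<lambda>n. e (r n)) c = mix e c \<circ> s" for e
    by (rule mix_eqI) (auto simp: s_def)
  then show ?thesis
    by (intro dfnI[where c = c and \<phi> = "ren s \<phi>"]) (simp add: P sat_ren \<open>inj s\<close>)
qed

section \<open>Closure of definability under connectives and quantifiers\<close>

lemma dfn_Not [dfn]: "dfn P \<Longrightarrow> dfn (\<lambda>e. \<not> P e)"
  unfolding dfn_def by (metis sat.simps(3))

lemma dfn_conj [dfn]: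
  assumes "dfn P" "dfn Q"
  shows "dfn (\<lambda>e. P e \<and> Q e)"
proof -
  obtain \<phi> c where P: "\<And>e. P e = sat mem (mix e c) \<phi>"
    using assms(1) dfn_def by auto
  obtain \<psi> d where Q: "\<And>e. Q e = sat mem (mix e d) \<psi>"
    using assms(2) dfn_def by auto
  \<comment> \<open>The two parameter sequences are merged: parameter \<open>n\<close> of
    \<open>c\<close> moves from place 2n+1 to 4n+1, that of \<open>d\<close> to 4n+3.\<close>
  define r where "r k = (if even k then k else 2 * k - 1)" for k :: nat
  define s where "s k = (if even k then k else 2 * k + 1)" for k :: nat
  have r: "inj r"
    unfolding r_def inj_def
    by (auto split: if_splits)
  have s: "inj s"
    unfolding s_def inj_def by (auto split: if_splits)
  have 1: "mix e c = mix e (mix c d) \<circ> r" for e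
  proof (rule mix_eqI)
    fix n
    have "r (Suc (2 * n)) = Suc (2 * (2 * n))" by (simp add: r_def)
    then show "mix e c (Suc (2 * n)) = (mix e (mix c d) \<circ> r) (Suc (2 * n))"
      by (simp only: comp_apply mix_simps)
  qed (simp add: r_def)
  have 2: "mix e d = mix e (mix c d) \<circ> s" for e
  proof (rule mix_eqI)
    fix n
    have "s (Suc (2 * n)) = Suc (2 * (Suc (2 * n)))" by (simp add: s_def)
    then show "mix e d (Suc (2 * n)) = (mix e (mix c d) \<circ> s) (Suc (2 * n))"
      by (simp only: comp_apply mix_simps)
  qed (simp add: s_def)
  show ?thesis
    by (intro dfnI[where c = "mix c d" and \<phi> = "Conj (ren r \<phi>) (ren s \<psi>)"])
      (simp add: P Q sat_ren r s flip: 1 2)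
qed

lemma dfn_Ex [dfn]:
  assumes "dfn (\<lambda>e. P (e 0) (\<lambda>n. e (Suc n)))"
  shows "dfn (\<lambda>e. \<exists>a. P a e)"
proof -
  obtain \<phi> c where P: "\<And>e. P (e 0) (\<lambda>n. e (Suc n)) = sat mem (mix e c) \<phi>"
    using assms dfn_def by auto
  \<comment> \<open>The variable to be bound moves to the first parameter place, the parameters move
    up to vacate it, and the other variables close the gap at index 0.\<close>
  define r where "r k = (if k = 0 then 1 else if even k then k - 2 else k + 2)" for k :: nat
  have r: "inj r"
    unfolding r_def inj_def by (auto split: if_splits elim!: evenE oddE; presburger)
  have 1: "(mix e (\<lambda>n. c (n - 1)))(1 := a) \<circ> r = mix (case_nat a e) c" for a e
  proof (rule mix_eqI)
    fix n
    show "((mix e (\<lambda>n. c (n - 1)))(1 := a) \<circ> r) (2 * n) = mix (case_nat a e) c (2 * n)"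
      by (cases n) (auto simp: r_def mix_def)
    have "r (Suc (2 * n)) = Suc (2 * Suc n)" by (simp add: r_def)
    then show "((mix e (\<lambda>n. c (n - 1)))(1 := a) \<circ> r) (Suc (2 * n)) = mix (case_nat a e) c (Suc (2 * n))"
      by (simp del: mult_Suc_right)
  qed
  have "P a e = sat mem ((mix e (\<lambda>n. c (n - 1)))(1 := a)) (ren r \<phi>)" for a e
    using P[of "case_nat a e"] by (simp only: sat_ren[OF r] 1) simp
  then show ?thesis
    by (intro dfnI[where c = "\<lambda>n. c (n - 1)" and \<phi> = "Ex 1 (ren r \<phi>)"]) simp
qed

lemma dfn_iff [dfn]: "dfn P \<Longrightarrow> dfn Q \<Longrightarrow> dfn (\<lambda>e. P e = Q e)"
proof -
  assume a: "dfn P" "dfn Q"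
  have "dfn (\<lambda>e. \<not> (P e \<and> \<not> Q e) \<and> \<not> (Q e \<and> \<not> P e))" by (intro dfn a)
  moreover have "(\<lambda>e. \<not> (P e \<and> \<not> Q e) \<and> \<not> (Q e \<and> \<not> P e)) = (\<lambda>e. P e = Q e)" by auto
  ultimately show ?thesis by simp
qed

lemma dfn_imp [dfn]: "dfn P \<Longrightarrow> dfn Q \<Longrightarrow> dfn (\<lambda>e. P e \<longrightarrow> Q e)"
proof -
  assume a: "dfn P" "dfn Q"
  have "dfn (\<lambda>e. \<not> (P e \<and> \<not> Q e))" by (intro dfn a)
  then show ?thesis by simp
qed

lemma dfn_disj [dfn]: "dfn P \<Longrightarrow> dfn Q \<Longrightarrow> dfn (\<lambda>e. P e \<or> Q e)"
proof -
  assume a: "dfn P" "dfn Q"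
  have "dfn (\<lambda>e. \<not> (\<not> P e \<and> \<not> Q e))" by (intro dfn a)
  then show ?thesis by simp
qed

lemma dfn_All [dfn]:
  assumes "dfn (\<lambda>e. P (e 0) (\<lambda>n. e (Suc n)))"
  shows "dfn (\<lambda>e. \<forall>a. P a e)"
proof -
  have "dfn (\<lambda>e. \<not> (\<exists>a. \<not> P a e))" by (intro dfn assms)
  then show ?thesis by simp
qed

lemma dfn_eq_var: "dfn (\<lambda>e. e i = e j)"
  by (intro dfnI[where c = undefined and \<phi> = "Eq (2 * i) (2 * j)"]) simp

lemma dfn_mem_var: "dfn (\<lambda>e. e i \<in>\<^sub>M e j)"
  by (intro dfnI[where c = undefined and \<phi> = "Mem (2 * i) (2 * j)"]) simp

lemma dfn_const [dfn]: "dfn (\<lambda>e. Q)"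
proof (cases Q)
  case True
  then show ?thesis using dfn_eq_var[of 0 0] by simp
next
  case False
  then show ?thesis using dfn_Not[OF dfn_eq_var[of 0 0]] by simp
qed

lemma dtm_var [dfn]: "dtm (\<lambda>e. e i)"
  unfolding dtm_def by (rule dfn_eq_var)

lemma dtm_const [dfn]: "dtm (\<lambda>e. a)"
  unfolding dtm_def
  by (intro dfnI[where c = "\<lambda>_. a" and \<phi> = "Eq 0 1"]) (simp add: mix_def)

section \<open>Substitution of definable terms\<close>

lemma dtm_weaken:
  assumes "dtm t"
  shows "dtm (\<lambda>e. t (\<lambda>n. e (Suc n)))"
proof -
  define s where "s k = (case k of 0 \<Rightarrow> 0 | Suc k \<Rightarrow> Suc (Suc k))" for k
  have "inj s" by (auto simp: s_def inj_def split: nat.splits)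
  from dfn_ren[OF assms[unfolded dtm_def] this] show ?thesis
    unfolding dtm_def s_def by simp
qed

text \<open>Terms are given only through their graphs, so they are substituted by quantifying over
  their values. The general \<open>dfn_sat\<close> uses this case for atomic formulas.\<close>

lemma dfn_subst_var:
  assumes R: "dfn (\<lambda>e. R (e 0) (e 1))" and t: "dtm s" "dtm t"
  shows "dfn (\<lambda>e. R (s e) (t e))"
proof -
  \<comment> \<open>The value of \<open>t\<close> is bound innermost and gets index 0, hence the
    swap.\<close>
  define r where "r k = (if k = 0 then 1 else if k = 1 then 0 else k)" for k :: nat
  have "inj r" by (auto simp: r_def inj_def split: if_splits)
  from dfn_ren[OF R this] have *: "dfn (\<lambda>e. R (e 1) (e 0))" by (simp add: r_def)
  have "dfn (\<lambda>e. \<exists>x. x = s e \<and> (\<exists>y. y = t e \<and> R x y))"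
    using dtm_weaken[OF t(2), unfolded dtm_def] t(1)[unfolded dtm_def] *
    by (intro dfn) auto
  then show ?thesis by simp
qed

lemma dfn_eq [dfn]: "dtm s \<Longrightarrow> dtm t \<Longrightarrow> dfn (\<lambda>e. s e = t e)"
  by (rule dfn_subst_var[where R = "(=)"]) (auto intro: dfn_eq_var)

lemma dfn_mem [dfn]: "dtm s \<Longrightarrow> dtm t \<Longrightarrow> dfn (\<lambda>e. s e \<in>\<^sub>M t e)"
  by (rule dfn_subst_var) (auto intro: dfn_mem_var)

text \<open>Simultaneous substitution for all variables, by induction on the formula. Under a
  quantifier the other terms are weakened, so none of them is captured.\<close>

lemma dfn_sat:
  assumes "\<And>i. dtm (\<lambda>e. ts e i)"
  shows "dfn (\<lambda>e. sat mem (ts e) \<phi>)"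
  using assms
proof (induction \<phi> arbitrary: ts)
  case (Ex j \<phi>)
  have "dtm (\<lambda>e. ((ts (\<lambda>n. e (Suc n)))(j := e 0)) i)" for i
    using dtm_weaken[OF Ex.prems] by (cases "i = j") (auto intro: dfn)
  from Ex.IH[where ts = "\<lambda>e. (ts (\<lambda>n. e (Suc n)))(j := e 0)", OF this]
  show ?case by (simp only: sat.simps) (rule dfn_Ex)
qed (auto intro: dfn)

lemma dfn_subst:
  assumes "dfn P" and ts: "\<And>i. dtm (\<lambda>e. ts e i)"
  shows "dfn (\<lambda>e. P (ts e))"
proof -
  obtain \<phi> c where P: "\<And>e. P e = sat mem (mix e c) \<phi>"
    using assms(1) dfn_def by auto
  show ?thesis
    unfolding P
  proof (rule dfn_sat)
    show "dtm (\<lambda>e. mix (ts e) c i)" for i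
      by (cases "even i") (auto simp: mix_def intro: ts dtm_const)
  qed
qed

lemma dtm_subst:
  assumes "dtm t" and ts: "\<And>i. dtm (\<lambda>e. ts e i)"
  shows "dtm (\<lambda>e. t (ts e))"
proof -
  have "dtm (\<lambda>e. case_nat (e 0) (ts (\<lambda>n. e (Suc n))) i)" for i
    using dtm_weaken[OF ts] by (cases i) (auto intro: dfn)
  from dfn_subst[OF assms(1)[unfolded dtm_def], where ts = "\<lambda>e. case_nat (e 0) (ts (\<lambda>n. e (Suc n)))", OF this]
  show ?thesis unfolding dtm_def by simp
qed

text \<open>A finite argument list becomes a total assignment by repeating its head, so that every
  entry is again a definable term.\<close>

definition args :: "'a list \<Rightarrow> nat \<Rightarrow> 'a" where
  "args xs i = (if i < length xs then xs ! i else hd xs)"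

lemma dtm_args:
  assumes "list_all dtm ts" "ts \<noteq> []"
  shows "dtm (\<lambda>e. args (map (\<lambda>t. t e) ts) i)"
proof -
  have "args (map (\<lambda>t. t e) ts) i = (if i < length ts then ts ! i else hd ts) e" for e
    using assms(2) by (simp add: args_def hd_map)
  then show ?thesis
    using assms by (auto simp: list_all_length hd_conv_nth)
qed

lemma dfn_args: "dfn P \<Longrightarrow> list_all dtm ts \<Longrightarrow> ts \<noteq> [] \<Longrightarrow> dfn (\<lambda>e. P (args (map (\<lambda>t. t e) ts)))"
  using dfn_subst[OF _ dtm_args] .

lemma dtm_args': "dtm P \<Longrightarrow> list_all dtm ts \<Longrightarrow> ts \<noteq> [] \<Longrightarrow> dtm (\<lambda>e. P (args (map (\<lambda>t. t e) ts)))"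
  using dtm_subst[OF _ dtm_args] .

lemma dfn_subst1: "dfn (\<lambda>e. R (e 0)) \<Longrightarrow> dtm s \<Longrightarrow> dfn (\<lambda>e. R (s e))"
  using dfn_args[of "\<lambda>e. R (e 0)" "[s]"] by (simp add: args_def)
lemma dfn_subst2: "dfn (\<lambda>e. R (e 0) (e 1)) \<Longrightarrow> dtm s \<Longrightarrow> dtm t \<Longrightarrow> dfn (\<lambda>e. R (s e) (t e))"
  using dfn_args[of "\<lambda>e. R (e 0) (e 1)" "[s, t]"] by (simp add: args_def)
lemma dfn_subst3: "dfn (\<lambda>e. R (e 0) (e 1) (e 2)) \<Longrightarrow> dtm s \<Longrightarrow> dtm t \<Longrightarrow> dtm u \<Longrightarrow>
    dfn (\<lambda>e. R (s e) (t e) (u e))"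
  using dfn_args[of "\<lambda>e. R (e 0) (e 1) (e 2)" "[s, t, u]"] by (simp add: args_def)
lemma dfn_subst4: "dfn (\<lambda>e. R (e 0) (e 1) (e 2) (e 3)) \<Longrightarrow> dtm s \<Longrightarrow> dtm t \<Longrightarrow> dtm u \<Longrightarrow> dtm v \<Longrightarrow>
    dfn (\<lambda>e. R (s e) (t e) (u e) (v e))"
  using dfn_args[of "\<lambda>e. R (e 0) (e 1) (e 2) (e 3)" "[s, t, u, v]"] by (simp add: args_def)
lemma dfn_subst5: "dfn (\<lambda>e. R (e 0) (e 1) (e 2) (e 3) (e 4)) \<Longrightarrow> dtm s \<Longrightarrow> dtm t \<Longrightarrow> dtm u \<Longrightarrow> dtm v \<Longrightarrow>
    dtm w \<Longrightarrow> dfn (\<lambda>e. R (s e) (t e) (u e) (v e) (w e))"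
  using dfn_args[of "\<lambda>e. R (e 0) (e 1) (e 2) (e 3) (e 4)" "[s, t, u, v, w]"] by (simp add: args_def)

lemma dtm_subst1: "dtm (\<lambda>e. R (e 0)) \<Longrightarrow> dtm s \<Longrightarrow> dtm (\<lambda>e. R (s e))"
  using dtm_args'[of "\<lambda>e. R (e 0)" "[s]"] by (simp add: args_def)
lemma dtm_subst2: "dtm (\<lambda>e. R (e 0) (e 1)) \<Longrightarrow> dtm s \<Longrightarrow> dtm t \<Longrightarrow> dtm (\<lambda>e. R (s e) (t e))"
  using dtm_args'[of "\<lambda>e. R (e 0) (e 1)" "[s, t]"] by (simp add: args_def)
lemma dtm_subst3: "dtm (\<lambda>e. R (e 0) (e 1) (e 2)) \<Longrightarrow> dtm s \<Longrightarrow> dtm t \<Longrightarrow> dtm u \<Longrightarrow>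
    dtm (\<lambda>e. R (s e) (t e) (u e))"
  using dtm_args'[of "\<lambda>e. R (e 0) (e 1) (e 2)" "[s, t, u]"] by (simp add: args_def)
lemma dtm_subst4: "dtm (\<lambda>e. R (e 0) (e 1) (e 2) (e 3)) \<Longrightarrow> dtm s \<Longrightarrow> dtm t \<Longrightarrow> dtm u \<Longrightarrow> dtm v \<Longrightarrow>
    dtm (\<lambda>e. R (s e) (t e) (u e) (v e))"
  using dtm_args'[of "\<lambda>e. R (e 0) (e 1) (e 2) (e 3)" "[s, t, u, v]"] by (simp add: args_def)

text \<open>Unlike \<open>THE\<close>, this has a definable graph also where no unique value exists.\<close>

definition desc :: "('a \<Rightarrow> bool) \<Rightarrow> 'a" where
  "desc P = (if \<exists>!x. P x then THE x. P x else undefined)"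

lemma desc_eq: "P a \<Longrightarrow> (\<And>x. P x \<Longrightarrow> x = a) \<Longrightarrow> desc P = a"
  unfolding desc_def by (metis the_equality)

lemma descI: "\<exists>!x. P x \<Longrightarrow> P (desc P)"
  unfolding desc_def by (simp add: theI')

lemma dtm_desc [dfn]:
  assumes "dfn (\<lambda>e. P (e 0) (\<lambda>n. e (Suc n)))"
  shows "dtm (\<lambda>e. desc (\<lambda>x. P x e))"
proof -
  have 1: "dfn (\<lambda>e. P (e 0) (\<lambda>n. e (Suc (Suc n))))"
    using dfn_ren[OF assms, of "case_nat 0 (\<lambda>i. Suc (Suc i))"]
    by (simp add: inj_def split: nat.splits)
  have 2: "dfn (\<lambda>e. P (e 0) (\<lambda>n. e (Suc (Suc (Suc n)))))"
    using dfn_ren[OF assms, of "case_nat 0 (\<lambda>i. Suc (Suc (Suc i)))"]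
    by (simp add: inj_def split: nat.splits)
  \<comment> \<open>The graph by cases: the unique witness or, failing that, the default
    \<open>undefined\<close>, which is just another parameter.\<close>
  have "dfn (\<lambda>e. (P (e 0) (\<lambda>n. e (Suc n)) \<and> (\<forall>y. P y (\<lambda>n. e (Suc n)) \<longrightarrow> y = e 0)) \<or>
      \<not> (\<exists>x. P x (\<lambda>n. e (Suc n)) \<and> (\<forall>y. P y (\<lambda>n. e (Suc n)) \<longrightarrow> y = x)) \<and> e 0 = undefined)"
    by (intro dfn assms 1 2)
  moreover have "(P x \<and> (\<forall>y. P y \<longrightarrow> y = x)) \<or> \<not> (\<exists>x. P x \<and> (\<forall>y. P y \<longrightarrow> y = x)) \<and> x = undefined
      \<longleftrightarrow> x = desc P" for x P
  proof (cases "\<exists>!x. P x")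
    case True
    then show ?thesis using descI[OF True] by blast
  next
    case False
    then have "desc P = undefined" by (simp add: desc_def)
    with False show ?thesis unfolding Ex1_def by auto
  qed
  then have "(\<lambda>e. (P (e 0) (\<lambda>n. e (Suc n)) \<and> (\<forall>y. P y (\<lambda>n. e (Suc n)) \<longrightarrow> y = e 0)) \<or>
      \<not> (\<exists>x. P x (\<lambda>n. e (Suc n)) \<and> (\<forall>y. P y (\<lambda>n. e (Suc n)) \<longrightarrow> y = x)) \<and> e 0 = undefined)
     = (\<lambda>e. e 0 = desc (\<lambda>x. P x (\<lambda>n. e (Suc n))))"
    by (intro ext)
  ultimately show ?thesis unfolding dtm_def by simp
qed

lemma dfn_Ex1 [dfn]:
  assumes "dfn (\<lambda>e. P (e 0) (\<lambda>n. e (Suc n)))"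
  shows "dfn (\<lambda>e. \<exists>!x. P x e)"
proof -
  have 1: "dfn (\<lambda>e. P (e 0) (\<lambda>n. e (Suc (Suc n))))"
    using dfn_ren[OF assms, of "case_nat 0 (\<lambda>i. Suc (Suc i))"]
    by (simp add: inj_def split: nat.splits)
  show ?thesis unfolding Ex1_def by (intro dfn assms 1)
qed

lemma dtm_if [dfn]:
  assumes "dfn P" "dtm s" "dtm t"
  shows "dtm (\<lambda>e. if P e then s e else t e)"
proof -
  have P: "dfn (\<lambda>e. P (\<lambda>n. e (Suc n)))" by (rule dfn_ren[OF assms(1)]) simp
  have "dfn (\<lambda>e. (P (\<lambda>n. e (Suc n)) \<and> e 0 = s (\<lambda>n. e (Suc n))) \<or>
     (\<not> P (\<lambda>n. e (Suc n)) \<and> e 0 = t (\<lambda>n. e (Suc n))))"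
    by (intro dfn P dtm_weaken assms)
  then show ?thesis unfolding dtm_def by (rule back_subst[where P = dfn]) auto
qed

section \<open>Separation and Replacement for definable predicates\<close>

lemma Sep_ex:
  assumes "dfn (\<lambda>e. P (e 0))"
  shows "\<exists>b. \<forall>z. z \<in>\<^sub>M b \<longleftrightarrow> z \<in>\<^sub>M a \<and> P z"
proof -
  obtain \<phi> c where P: "\<And>e. P (e 0) = sat mem (mix e c) \<phi>"
    using assms(1) dfn_def by auto
  have "(mix (\<lambda>_. a) c)(0 := z) = mix ((\<lambda>_. a)(0 := z)) c" for z
    by (rule mix_eqI) auto
  then have "sat mem ((mix (\<lambda>_. a) c)(0 := z)) \<phi> = P z" for z
    using P[of "(\<lambda>_. a)(0 := z)"] by simp
  then show ?thesis using separation by metis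
qed

lemma Repl_ex:
  assumes "dtm (\<lambda>e. F (e 0))"
  shows "\<exists>b. \<forall>y. y \<in>\<^sub>M b \<longleftrightarrow> (\<exists>x. x \<in>\<^sub>M a \<and> y = F x)"
proof -
  have "dfn (\<lambda>e. e 1 = F (e 0))" using assms by (intro dfn)
  then obtain \<phi> c where P: "\<And>e. (e 1 = F (e 0)) = sat mem (mix e c) \<phi>"
    using dfn_def by auto
  \<comment> \<open>The schema has its second variable at 1, which \<open>mix\<close> reserves for a
    parameter; the value of the function sits at 2.\<close>
  define r where "r k = (if k = 2 then 1 else if k = 1 then 2 else k)" for k :: nat
  have r: "inj r" by (auto simp: r_def inj_def split: if_splits)
  have "(mix (\<lambda>_. a) c \<circ> r)(0 := x, 1 := y) \<circ> r = mix ((\<lambda>_. a)(0 := x, 1 := y)) c" for x y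
    by (auto simp: r_def mix_def fun_eq_iff elim!: evenE)
  then have "sat mem ((mix (\<lambda>_. a) c \<circ> r)(0 := x, 1 := y)) (ren r \<phi>) = (y = F x)" for x y
    using P[of "(\<lambda>_. a)(0 := x, 1 := y)"] by (simp add: sat_ren[OF r])
  with replacement[rule_format, of a "mix (\<lambda>_. a) c \<circ> r" "ren r \<phi>"] show ?thesis by simp
qed

section \<open>Basic set constructions\<close>

lemma ext: "(\<And>z. z \<in>\<^sub>M a \<longleftrightarrow> z \<in>\<^sub>M b) \<Longrightarrow> a = b"
  using extensionality by blast

lemma dfn_subset [dfn]: "dtm s \<Longrightarrow> dtm t \<Longrightarrow> dfn (\<lambda>e. s e \<subseteq>\<^sub>M t e)"
  by (rule dfn_subst2[where R = subset]) (unfold subset_def, intro dfn)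

lemma subsetD: "a \<subseteq>\<^sub>M b \<Longrightarrow> z \<in>\<^sub>M a \<Longrightarrow> z \<in>\<^sub>M b"
  by (simp add: subset_def)

lemma desc_set_iff:
  assumes "\<exists>b. \<forall>z. z \<in>\<^sub>M b \<longleftrightarrow> Q z"
  shows "z \<in>\<^sub>M desc (\<lambda>b. \<forall>z. z \<in>\<^sub>M b \<longleftrightarrow> Q z) \<longleftrightarrow> Q z"
proof -
  obtain b where b: "\<And>z. z \<in>\<^sub>M b \<longleftrightarrow> Q z" using assms by blast
  have "desc (\<lambda>b. \<forall>z. z \<in>\<^sub>M b \<longleftrightarrow> Q z) = b"
  proof (rule desc_eq)
    show "x = b" if "\<forall>z. z \<in>\<^sub>M x \<longleftrightarrow> Q z" for x
      by (rule ext) (simp only: b that)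
  qed (simp only: b, simp)
  then show ?thesis by (simp only: b)
qed

definition Sep :: "'a \<Rightarrow> ('a \<Rightarrow> bool) \<Rightarrow> 'a" where
  "Sep a P = desc (\<lambda>b. \<forall>z. z \<in>\<^sub>M b \<longleftrightarrow> z \<in>\<^sub>M a \<and> P z)"

lemma Sep_iff: "dfn (\<lambda>e. P (e 0)) \<Longrightarrow> z \<in>\<^sub>M Sep a P \<longleftrightarrow> z \<in>\<^sub>M a \<and> P z"
  unfolding Sep_def by (rule desc_set_iff) (rule Sep_ex)

lemma dtm_Sep [dfn]:
  assumes "dtm a" "dfn (\<lambda>e. P (e 0) (\<lambda>n. e (Suc n)))"
  shows "dtm (\<lambda>e. Sep (a e) (\<lambda>x. P x e))"
proof -
  have "dfn (\<lambda>e. P (e 0) (\<lambda>n. e (Suc (Suc n))))"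
    using dfn_ren[OF assms(2), of "case_nat 0 (\<lambda>i. Suc (Suc i))"]
    by (simp add: inj_def split: nat.splits)
  then show ?thesis
    unfolding Sep_def by (intro dfn dtm_weaken[OF dtm_weaken] assms(1))
qed

definition Repl :: "'a \<Rightarrow> ('a \<Rightarrow> 'a) \<Rightarrow> 'a" where
  "Repl a F = desc (\<lambda>b. \<forall>z. z \<in>\<^sub>M b \<longleftrightarrow> (\<exists>x. x \<in>\<^sub>M a \<and> z = F x))"

lemma Repl_iff: "dtm (\<lambda>e. F (e 0)) \<Longrightarrow> z \<in>\<^sub>M Repl a F \<longleftrightarrow> (\<exists>x. x \<in>\<^sub>M a \<and> z = F x)"
  unfolding Repl_def by (rule desc_set_iff) (rule Repl_ex)

lemma dtm_Repl [dfn]: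
  assumes "dtm a" "dtm (\<lambda>e. F (e 0) (\<lambda>n. e (Suc n)))"
  shows "dtm (\<lambda>e. Repl (a e) (\<lambda>x. F x e))"
proof -
  have "dtm (\<lambda>e. F (e 0) (\<lambda>n. e (Suc (Suc (Suc n)))))"
  proof -
    have "dtm (\<lambda>e. case_nat (e 0) (\<lambda>n. e (Suc (Suc (Suc n)))) i)" for i
      by (cases i) (auto intro: dtm_var)
    from dtm_subst[OF assms(2), where ts = "\<lambda>e. case_nat (e 0) (\<lambda>n. e (Suc (Suc (Suc n))))", OF this]
    show ?thesis by simp
  qed
  then show ?thesis
    unfolding Repl_def
    by (intro dfn dtm_weaken[OF dtm_weaken[OF dtm_weaken]] assms(1))
qed

lemma Repl_cong: "(\<And>x. x \<in>\<^sub>M a \<Longrightarrow> F x = G x) \<Longrightarrow> Repl a F = Repl a G"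
  unfolding Repl_def by (metis (mono_tags, lifting))

definition upair :: "'a \<Rightarrow> 'a \<Rightarrow> 'a" where
  "upair a b = desc (\<lambda>c. \<forall>z. z \<in>\<^sub>M c \<longleftrightarrow> z = a \<or> z = b)"

lemma upair_iff [simp]: "z \<in>\<^sub>M upair a b \<longleftrightarrow> z = a \<or> z = b"
  unfolding upair_def by (rule desc_set_iff) (use pairing is_upair_def in simp)

lemma dtm_upair [dfn]: "dtm s \<Longrightarrow> dtm t \<Longrightarrow> dtm (\<lambda>e. upair (s e) (t e))"
  by (rule dtm_subst2) (unfold upair_def, intro dfn)

lemma is_upair_iff: "is_upair a b c \<longleftrightarrow> c = upair a b"
  unfolding is_upair_def by (auto intro: ext)

definition pair :: "'a \<Rightarrow> 'a \<Rightarrow> 'a" where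
  "pair a b = upair (upair a a) (upair a b)"

lemma dtm_pair [dfn]: "dtm s \<Longrightarrow> dtm t \<Longrightarrow> dtm (\<lambda>e. pair (s e) (t e))"
  by (rule dtm_subst2) (unfold pair_def, intro dfn)

lemma is_pair_iff: "is_pair a b p \<longleftrightarrow> p = pair a b"
  unfolding is_pair_def is_upair_iff pair_def by auto

lemma upair_eq_iff: "upair a b = upair c d \<longleftrightarrow> a = c \<and> b = d \<or> a = d \<and> b = c"
proof
  assume "upair a b = upair c d"
  then have "z = a \<or> z = b \<longleftrightarrow> z = c \<or> z = d" for z by (metis upair_iff)
  then show "a = c \<and> b = d \<or> a = d \<and> b = c" by metis
qed (auto intro: ext)

lemma pair_inject [simp]: "pair a b = pair c d \<longleftrightarrow> a = c \<and> b = d"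
  unfolding pair_def upair_eq_iff by auto

lemma maps_iff: "maps f x y \<longleftrightarrow> pair x y \<in>\<^sub>M f"
  unfolding maps_def is_pair_iff by auto

lemma dfn_maps [dfn]: "dtm s \<Longrightarrow> dtm t \<Longrightarrow> dtm u \<Longrightarrow> dfn (\<lambda>e. maps (s e) (t e) (u e))"
  unfolding maps_iff by (intro dfn)

definition Fst :: "'a \<Rightarrow> 'a" where "Fst p = desc (\<lambda>a. \<exists>b. p = pair a b)"
definition Snd :: "'a \<Rightarrow> 'a" where "Snd p = desc (\<lambda>b. \<exists>a. p = pair a b)"

lemma Fst_pair [simp]: "Fst (pair a b) = a"
  unfolding Fst_def by (rule desc_eq) auto
lemma Snd_pair [simp]: "Snd (pair a b) = b"
  unfolding Snd_def by (rule desc_eq) auto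
lemma dtm_Fst [dfn]: "dtm s \<Longrightarrow> dtm (\<lambda>e. Fst (s e))"
  by (rule dtm_subst1) (unfold Fst_def, intro dfn)
lemma dtm_Snd [dfn]: "dtm s \<Longrightarrow> dtm (\<lambda>e. Snd (s e))"
  by (rule dtm_subst1) (unfold Snd_def, intro dfn)

definition Uni :: "'a \<Rightarrow> 'a" where
  "Uni a = desc (\<lambda>u. \<forall>z. z \<in>\<^sub>M u \<longleftrightarrow> (\<exists>x. x \<in>\<^sub>M a \<and> z \<in>\<^sub>M x))"

lemma Uni_iff [simp]: "z \<in>\<^sub>M Uni a \<longleftrightarrow> (\<exists>x. x \<in>\<^sub>M a \<and> z \<in>\<^sub>M x)"
  unfolding Uni_def by (rule desc_set_iff) (use union in simp)

lemma dtm_Uni [dfn]: "dtm s \<Longrightarrow> dtm (\<lambda>e. Uni (s e))"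
  by (rule dtm_subst1) (unfold Uni_def, intro dfn)

definition Pow :: "'a \<Rightarrow> 'a" where
  "Pow a = desc (\<lambda>u. \<forall>z. z \<in>\<^sub>M u \<longleftrightarrow> z \<subseteq>\<^sub>M a)"

lemma Pow_iff [simp]: "z \<in>\<^sub>M Pow a \<longleftrightarrow> z \<subseteq>\<^sub>M a"
  unfolding Pow_def by (rule desc_set_iff) (use powerset is_Pow_def in simp)

lemma dtm_Pow [dfn]: "dtm s \<Longrightarrow> dtm (\<lambda>e. Pow (s e))"
  by (rule dtm_subst1) (unfold Pow_def, intro dfn)

lemma is_Pow_iff: "is_Pow a b \<longleftrightarrow> b = Pow a"
  unfolding is_Pow_def by (auto intro: ext)

definition emp :: 'a where "emp = desc is_empty"

lemma dfn_is_empty [dfn]: "dtm s \<Longrightarrow> dfn (\<lambda>e. is_empty (s e))"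
  by (rule dfn_subst1) (unfold is_empty_def, intro dfn)

lemma is_empty_iff: "is_empty a \<longleftrightarrow> a = emp" and emp_iff [simp]: "\<not> z \<in>\<^sub>M emp"
proof -
  have "z \<in>\<^sub>M Sep undefined (\<lambda>_. False) \<longleftrightarrow> False" for z
    by (subst Sep_iff) (auto intro: dfn)
  then have e: "is_empty (Sep undefined (\<lambda>_. False))" by (simp add: is_empty_def)
  then have "emp = Sep undefined (\<lambda>_. False)"
    unfolding emp_def by (intro desc_eq) (auto simp: is_empty_def intro: ext)
  then show "is_empty a \<longleftrightarrow> a = emp" "\<not> z \<in>\<^sub>M emp"
    using e by (auto simp: is_empty_def intro: ext)
qed

definition union :: "'a \<Rightarrow> 'a \<Rightarrow> 'a" (infixl "\<union>\<^sub>M" 65) where "a \<union>\<^sub>M b = Uni (upair a b)"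

lemma union_iff [simp]: "z \<in>\<^sub>M a \<union>\<^sub>M b \<longleftrightarrow> z \<in>\<^sub>M a \<or> z \<in>\<^sub>M b"
  unfolding union_def by auto

lemma dtm_union [dfn]: "dtm s \<Longrightarrow> dtm t \<Longrightarrow> dtm (\<lambda>e. s e \<union>\<^sub>M t e)"
  unfolding union_def by (intro dfn)

definition suc :: "'a \<Rightarrow> 'a" where "suc a = a \<union>\<^sub>M upair a a"

lemma suc_iff [simp]: "z \<in>\<^sub>M suc a \<longleftrightarrow> z \<in>\<^sub>M a \<or> z = a"
  unfolding suc_def by auto

lemma dtm_suc [dfn]: "dtm s \<Longrightarrow> dtm (\<lambda>e. suc (s e))"
  unfolding suc_def by (intro dfn)

lemma is_succ_iff: "is_succ a b \<longleftrightarrow> b = suc a"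
  unfolding is_succ_def by (auto intro: ext)

definition prod :: "'a \<Rightarrow> 'a \<Rightarrow> 'a" (infixr "\<times>\<^sub>M" 70) where
  "a \<times>\<^sub>M b = Uni (Repl a (\<lambda>x. Repl b (\<lambda>y. pair x y)))"

lemma prod_iff: "p \<in>\<^sub>M a \<times>\<^sub>M b \<longleftrightarrow> (\<exists>x y. x \<in>\<^sub>M a \<and> y \<in>\<^sub>M b \<and> p = pair x y)"
proof -
  have "p \<in>\<^sub>M Repl b (\<lambda>y. pair x y) \<longleftrightarrow> (\<exists>y. y \<in>\<^sub>M b \<and> p = pair x y)" for p x
    by (rule Repl_iff) (intro dfn)
  moreover have "p \<in>\<^sub>M Repl a (\<lambda>x. Repl b (\<lambda>y. pair x y)) \<longleftrightarrow> (\<exists>x. x \<in>\<^sub>M a \<and> p = Repl b (\<lambda>y. pair x y))" for p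
    by (rule Repl_iff) (intro dfn)
  ultimately show ?thesis unfolding prod_def by auto
qed

lemma pair_prod_iff [simp]: "pair x y \<in>\<^sub>M a \<times>\<^sub>M b \<longleftrightarrow> x \<in>\<^sub>M a \<and> y \<in>\<^sub>M b"
  unfolding prod_iff by auto

lemma dtm_prod [dfn]: "dtm s \<Longrightarrow> dtm t \<Longrightarrow> dtm (\<lambda>e. s e \<times>\<^sub>M t e)"
  by (rule dtm_subst2) (unfold prod_def, intro dfn)

section \<open>Functions as sets of pairs\<close>

definition app :: "'a \<Rightarrow> 'a \<Rightarrow> 'a" (infixl "\<cdot>" 90) where
  "f \<cdot> x = desc (\<lambda>y. pair x y \<in>\<^sub>M f)"

lemma dtm_app [dfn]: "dtm s \<Longrightarrow> dtm t \<Longrightarrow> dtm (\<lambda>e. s e \<cdot> t e)"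
  by (rule dtm_subst2) (unfold app_def, intro dfn)

definition lam :: "'a \<Rightarrow> ('a \<Rightarrow> 'a) \<Rightarrow> 'a" where
  "lam a F = Repl a (\<lambda>x. pair x (F x))"

lemma lam_iff: "dtm (\<lambda>e. F (e 0)) \<Longrightarrow> p \<in>\<^sub>M lam a F \<longleftrightarrow> (\<exists>x. x \<in>\<^sub>M a \<and> p = pair x (F x))"
  unfolding lam_def by (rule Repl_iff) (intro dfn)

lemma dtm_lam [dfn]:
  assumes "dtm a" "dtm (\<lambda>e. F (e 0) (\<lambda>n. e (Suc n)))"
  shows "dtm (\<lambda>e. lam (a e) (\<lambda>x. F x e))"
  unfolding lam_def by (intro dfn assms)

lemma app_eq:
  assumes "pair x y \<in>\<^sub>M f" "\<And>z. pair x z \<in>\<^sub>M f \<Longrightarrow> z = y"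
  shows "f \<cdot> x = y"
  unfolding app_def by (rule desc_eq) (use assms in blast)+

lemma app_lam: "dtm (\<lambda>e. F (e 0)) \<Longrightarrow> x \<in>\<^sub>M a \<Longrightarrow> lam a F \<cdot> x = F x"
  by (rule app_eq) (auto simp: lam_iff)

lemma lam_cong: "(\<And>x. x \<in>\<^sub>M a \<Longrightarrow> F x = G x) \<Longrightarrow> lam a F = lam a G"
  unfolding lam_def by (rule Repl_cong) simp

definition funs :: "'a \<Rightarrow> 'a \<Rightarrow> 'a" where
  "funs a b = Sep (Pow (a \<times>\<^sub>M b)) (\<lambda>f. is_function f a b)"

lemma dfn_is_function [dfn]: "dtm s \<Longrightarrow> dtm t \<Longrightarrow> dtm u \<Longrightarrow> dfn (\<lambda>e. is_function (s e) (t e) (u e))"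
  by (rule dfn_subst3) (unfold is_function_def is_pair_iff, intro dfn)

lemma is_function_iff: "is_function f a b \<longleftrightarrow> f \<subseteq>\<^sub>M a \<times>\<^sub>M b \<and> (\<forall>x. x \<in>\<^sub>M a \<longrightarrow> (\<exists>!y. pair x y \<in>\<^sub>M f))"
  unfolding is_function_def is_pair_iff maps_iff subset_def prod_iff by auto

lemma fun_iff_is: "f \<in>\<^sub>M funs a b \<longleftrightarrow> is_function f a b"
proof -
  have "f \<in>\<^sub>M funs a b \<longleftrightarrow> f \<in>\<^sub>M Pow (a \<times>\<^sub>M b) \<and> is_function f a b"
    unfolding funs_def by (rule Sep_iff) (intro dfn)
  then show ?thesis by (auto simp: is_function_iff)
qed

lemma funD:
  assumes "f \<in>\<^sub>M funs a b"
  shows "x \<in>\<^sub>M a \<Longrightarrow> f \<cdot> x \<in>\<^sub>M b"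
    and "x \<in>\<^sub>M a \<Longrightarrow> pair x (f \<cdot> x) \<in>\<^sub>M f"
    and "pair x y \<in>\<^sub>M f \<longleftrightarrow> x \<in>\<^sub>M a \<and> y = f \<cdot> x"
    and "f = lam a (\<lambda>x. f \<cdot> x)"
proof -
  have f: "f \<subseteq>\<^sub>M a \<times>\<^sub>M b" "\<And>x. x \<in>\<^sub>M a \<Longrightarrow> \<exists>!y. pair x y \<in>\<^sub>M f"
    using assms unfolding fun_iff_is is_function_iff by auto
  have 1: "pair x (f \<cdot> x) \<in>\<^sub>M f" if "x \<in>\<^sub>M a" for x
    using descI[OF f(2)[OF that]] unfolding app_def .
  have 2: "f \<cdot> x = y" if "pair x y \<in>\<^sub>M f" for x y
  proof -
    have "x \<in>\<^sub>M a" using that f(1) by (auto dest: subsetD)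
    then show ?thesis using 1 that f(2) by blast
  qed
  show "x \<in>\<^sub>M a \<Longrightarrow> f \<cdot> x \<in>\<^sub>M b" "x \<in>\<^sub>M a \<Longrightarrow> pair x (f \<cdot> x) \<in>\<^sub>M f"
    using 1 subsetD[OF f(1) 1] by simp_all
  show 3: "pair x y \<in>\<^sub>M f \<longleftrightarrow> x \<in>\<^sub>M a \<and> y = f \<cdot> x" for x y
    using 1 2 f(1) by (auto dest: subsetD)
  show "f = lam a (\<lambda>x. f \<cdot> x)"
  proof (rule ext)
    fix p
    have "p \<in>\<^sub>M f \<longleftrightarrow> (\<exists>x y. p = pair x y \<and> p \<in>\<^sub>M f)"
      using f(1) by (metis prod_iff subsetD)
    also have "\<dots> \<longleftrightarrow> p \<in>\<^sub>M lam a (\<lambda>x. f \<cdot> x)"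
      by (subst lam_iff) (auto intro: dfn simp: 3)
    finally show "p \<in>\<^sub>M f \<longleftrightarrow> p \<in>\<^sub>M lam a (\<lambda>x. f \<cdot> x)" .
  qed
qed

lemma lam_fun: "dtm (\<lambda>e. F (e 0)) \<Longrightarrow> (\<And>x. x \<in>\<^sub>M a \<Longrightarrow> F x \<in>\<^sub>M b) \<Longrightarrow> lam a F \<in>\<^sub>M funs a b"
  unfolding fun_iff_is is_function_iff subset_def by (auto simp: lam_iff)

lemma fun_ext:
  assumes "f \<in>\<^sub>M funs a b" "g \<in>\<^sub>M funs a c" "\<And>x. x \<in>\<^sub>M a \<Longrightarrow> f \<cdot> x = g \<cdot> x"
  shows "f = g"
proof -
  have "f = lam a (\<lambda>x. f \<cdot> x)" by (rule funD(4)[OF assms(1)])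
  also have "\<dots> = lam a (\<lambda>x. g \<cdot> x)" by (rule lam_cong) (rule assms(3))
  also have "\<dots> = g" by (rule funD(4)[OF assms(2), symmetric])
  finally show ?thesis .
qed

lemma emp_neq_suc: "emp \<noteq> suc a" "suc a \<noteq> emp"
  by (metis emp_iff suc_iff)+

text \<open>Foundation speaks of sets, so the induction is confined to a set \<open>t\<close>: a
  minimal element of the set of counterexamples in \<open>t\<close> is refuted by the step.\<close>

lemma mem_induct:
  assumes "dfn (\<lambda>e. P (e 0))" and step: "\<And>x. (\<And>y. y \<in>\<^sub>M x \<Longrightarrow> y \<in>\<^sub>M t \<Longrightarrow> P y) \<Longrightarrow> x \<in>\<^sub>M t \<Longrightarrow> P x"
    and "x \<in>\<^sub>M t"
  shows "P x"
proof (rule ccontr)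
  assume "\<not> P x"
  define b where "b = Sep t (\<lambda>x. \<not> P x)"
  have b: "z \<in>\<^sub>M b \<longleftrightarrow> z \<in>\<^sub>M t \<and> \<not> P z" for z
    unfolding b_def by (rule Sep_iff) (intro dfn assms)
  then obtain m where "m \<in>\<^sub>M b" "\<And>y. y \<in>\<^sub>M m \<Longrightarrow> \<not> y \<in>\<^sub>M b"
    using foundation[rule_format, of b] \<open>x \<in>\<^sub>M t\<close> \<open>\<not> P x\<close> by metis
  then have "m \<in>\<^sub>M t" "\<not> P m" "\<And>y. y \<in>\<^sub>M m \<Longrightarrow> y \<in>\<^sub>M t \<Longrightarrow> P y"
    by (simp_all add: b)
  then show False using step[of m] by simp
qed

lemma mem_irrefl: "\<not> x \<in>\<^sub>M x"
  using foundation[rule_format, of "upair x x"] by auto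

lemma mem_asym: "x \<in>\<^sub>M y \<Longrightarrow> \<not> y \<in>\<^sub>M x"
  using foundation[rule_format, of "upair x y"] by auto

section \<open>Ordinals\<close>

lemma dfn_transitive [dfn]: "dtm s \<Longrightarrow> dfn (\<lambda>e. transitive (s e))"
  by (rule dfn_subst1) (unfold transitive_def, intro dfn)

lemma dfn_is_ordinal [dfn]: "dtm s \<Longrightarrow> dfn (\<lambda>e. is_ordinal (s e))"
  by (rule dfn_subst1) (unfold is_ordinal_def, intro dfn)

lemma Ord_mem: "is_ordinal a \<Longrightarrow> b \<in>\<^sub>M a \<Longrightarrow> is_ordinal b"
  unfolding is_ordinal_def transitive_def subset_def by blast

lemma Ord_trans: "is_ordinal a \<Longrightarrow> b \<in>\<^sub>M a \<Longrightarrow> c \<in>\<^sub>M b \<Longrightarrow> c \<in>\<^sub>M a"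
  unfolding is_ordinal_def transitive_def subset_def by blast

lemma OrdI: "(\<And>x y. x \<in>\<^sub>M a \<Longrightarrow> y \<in>\<^sub>M x \<Longrightarrow> y \<in>\<^sub>M a) \<Longrightarrow> (\<And>x. x \<in>\<^sub>M a \<Longrightarrow> is_ordinal x) \<Longrightarrow> is_ordinal a"
  unfolding is_ordinal_def transitive_def[of a] subset_def by blast

lemma Ord_induct:
  assumes P: "dfn (\<lambda>e. P (e 0))" and a: "is_ordinal a"
    and step: "\<And>x. is_ordinal x \<Longrightarrow> (\<And>y. y \<in>\<^sub>M x \<Longrightarrow> P y) \<Longrightarrow> P x"
  shows "P a"
proof (rule mem_induct[OF P])
  \<comment> \<open>For an ordinal \<open>a\<close>, the set \<open>suc a\<close> contains
    \<open>a\<close> and all members of its members.\<close>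
  show "a \<in>\<^sub>M suc a" by simp
  fix x assume x: "\<And>y. y \<in>\<^sub>M x \<Longrightarrow> y \<in>\<^sub>M suc a \<Longrightarrow> P y" "x \<in>\<^sub>M suc a"
  show "P x"
  proof (rule step)
    show "is_ordinal x" using x(2) a Ord_mem by auto
    show "P y" if "y \<in>\<^sub>M x" for y
      using x(1)[OF that] x(2) that Ord_trans[OF a] by auto
  qed
qed

lemma Ord_linear:
  assumes "is_ordinal a" "is_ordinal b"
  shows "a \<in>\<^sub>M b \<or> a = b \<or> b \<in>\<^sub>M a"
proof -
  have "\<forall>b. is_ordinal b \<longrightarrow> a \<in>\<^sub>M b \<or> a = b \<or> b \<in>\<^sub>M a"
  proof (rule Ord_induct[OF _ assms(1)], intro dfn)
    fix a assume a: "is_ordinal a" and IHa: "\<And>x. x \<in>\<^sub>M a \<Longrightarrow> \<forall>b. is_ordinal b \<longrightarrow> x \<in>\<^sub>M b \<or> x = b \<or> b \<in>\<^sub>M x"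
    have "a \<in>\<^sub>M b \<or> a = b \<or> b \<in>\<^sub>M a" if "is_ordinal b" for b
    proof (rule Ord_induct[OF _ that], intro dfn)
      fix b assume b: "is_ordinal b" and IHb: "\<And>x. x \<in>\<^sub>M b \<Longrightarrow> a \<in>\<^sub>M x \<or> a = x \<or> x \<in>\<^sub>M a"
      show "a \<in>\<^sub>M b \<or> a = b \<or> b \<in>\<^sub>M a"
        using IHa IHb Ord_trans[OF a] Ord_trans[OF b] b ext[of a b] by metis
    qed
    then show "\<forall>b. is_ordinal b \<longrightarrow> a \<in>\<^sub>M b \<or> a = b \<or> b \<in>\<^sub>M a" by blast
  qed
  then show ?thesis using assms by blast
qed

text \<open>Membership in \<open>suc c\<close> serves as the weak order throughout: here
  \<open>b\<close> is at most \<open>c\<close>.\<close>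

lemma Ord_mem_trans: "is_ordinal c \<Longrightarrow> a \<in>\<^sub>M b \<Longrightarrow> b \<in>\<^sub>M suc c \<Longrightarrow> a \<in>\<^sub>M c"
  using Ord_trans by auto

lemma Ord_suc [intro]: "is_ordinal a \<Longrightarrow> is_ordinal (suc a)"
  unfolding is_ordinal_def transitive_def subset_def suc_iff by blast

definition least :: "('a \<Rightarrow> bool) \<Rightarrow> 'a" where
  "least P = desc (\<lambda>a. is_ordinal a \<and> P a \<and> (\<forall>b. b \<in>\<^sub>M a \<longrightarrow> \<not> P b))"

lemma dtm_least [dfn]:
  assumes P: "dfn (\<lambda>e. P (e 0) (\<lambda>n. e (Suc n)))"
  shows "dtm (\<lambda>e. least (\<lambda>x. P x e))"
proof -
  have "dfn (\<lambda>e. P (e 0) (\<lambda>n. e (Suc (Suc n))))"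
    using dfn_ren[OF P, of "case_nat 0 (\<lambda>i. Suc (Suc i))"]
    by (simp add: inj_def split: nat.splits)
  then show ?thesis
    unfolding least_def by (intro dfn P)
qed

lemma least_eq:
  assumes "is_ordinal a" "P a" "\<And>b. b \<in>\<^sub>M a \<Longrightarrow> \<not> P b"
  shows "least P = a"
  unfolding least_def
  by (rule desc_eq) (use assms Ord_linear in blast)+

lemma least:
  assumes P: "dfn (\<lambda>e. P (e 0))" and a: "is_ordinal a" "P a"
  shows "is_ordinal (least P)" "P (least P)" "b \<in>\<^sub>M least P \<Longrightarrow> \<not> P b"
    "least P \<in>\<^sub>M suc a"
proof -
  obtain m where m: "is_ordinal m" "P m" "\<And>b. b \<in>\<^sub>M m \<Longrightarrow> \<not> P b"
  proof (rule ccontr)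
    assume *: "\<not> thesis"
    have "\<not> P a"
      by (rule Ord_induct[OF _ a(1)], intro dfn P) (use that * in blast)
    with a show False by blast
  qed
  have "least P = m" by (rule least_eq) (use m in auto)
  then show "is_ordinal (least P)" "P (least P)" "b \<in>\<^sub>M least P \<Longrightarrow> \<not> P b" "least P \<in>\<^sub>M suc a"
    using m Ord_linear[OF m(1) a(1)] a(2) by auto
qed

lemma least_cong:
  assumes "\<And>x. P x = Q x"
  shows "least P = least Q"
  using assms by presburger

section \<open>The natural numbers\<close>

lemma dfn_is_inductive [dfn]: "dtm s \<Longrightarrow> dfn (\<lambda>e. is_inductive (s e))"
  by (rule dfn_subst1) (unfold is_inductive_def is_succ_iff, intro dfn)

lemma is_inductive_iff: "is_inductive a \<longleftrightarrow> emp \<in>\<^sub>M a \<and> (\<forall>x. x \<in>\<^sub>M a \<longrightarrow> suc x \<in>\<^sub>M a)"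
  unfolding is_inductive_def is_succ_iff is_empty_iff by auto

definition om :: 'a where "om = desc is_omega"

lemma om_iff: "n \<in>\<^sub>M om \<longleftrightarrow> (\<forall>a. is_inductive a \<longrightarrow> n \<in>\<^sub>M a)"
  and is_omega_iff: "is_omega N \<longleftrightarrow> N = om"
proof -
  obtain I where I: "is_inductive I" using infinity by blast
  define N0 where "N0 = Sep I (\<lambda>n. \<forall>a. is_inductive a \<longrightarrow> n \<in>\<^sub>M a)"
  have N0: "n \<in>\<^sub>M N0 \<longleftrightarrow> (\<forall>a. is_inductive a \<longrightarrow> n \<in>\<^sub>M a)" for n
  proof -
    have "n \<in>\<^sub>M N0 \<longleftrightarrow> n \<in>\<^sub>M I \<and> (\<forall>a. is_inductive a \<longrightarrow> n \<in>\<^sub>M a)"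
      unfolding N0_def by (rule Sep_iff) (intro dfn)
    then show ?thesis using I by blast
  qed
  have "is_inductive N0" unfolding is_inductive_iff N0 by blast
  then have 1: "is_omega N \<longleftrightarrow> N = N0" for N
    unfolding is_omega_def subset_def using N0 by (metis ext)
  then have "is_omega N0" by simp
  then have "om = N0" unfolding om_def by (rule desc_eq) (simp add: 1)
  then show "n \<in>\<^sub>M om \<longleftrightarrow> (\<forall>a. is_inductive a \<longrightarrow> n \<in>\<^sub>M a)" "is_omega N \<longleftrightarrow> N = om"
    using N0 1 by auto
qed

lemma emp_om [simp, intro]: "emp \<in>\<^sub>M om"
  and suc_om [simp, intro]: "n \<in>\<^sub>M om \<Longrightarrow> suc n \<in>\<^sub>M om"
  by (auto simp: om_iff is_inductive_iff)

lemma om_induct [consumes 2, case_names emp suc]: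
  assumes P: "dfn (\<lambda>e. P (e 0))" and n: "n \<in>\<^sub>M om" and "P emp"
    and "\<And>n. n \<in>\<^sub>M om \<Longrightarrow> P n \<Longrightarrow> P (suc n)"
  shows "P n"
proof -
  define b where "b = Sep om P"
  have b: "x \<in>\<^sub>M b \<longleftrightarrow> x \<in>\<^sub>M om \<and> P x" for x
    unfolding b_def by (rule Sep_iff) (rule P)
  have "is_inductive b"
    unfolding is_inductive_iff b using assms by auto
  with n b show ?thesis by (auto simp: om_iff)
qed

lemma Ord_emp [simp]: "is_ordinal emp"
  by (simp add: is_ordinal_def transitive_def subset_def)

lemma om_Ord [simp]: "n \<in>\<^sub>M om \<Longrightarrow> is_ordinal n"
  by (rule om_induct[where n = n], intro dfn) auto

lemma om_trans:
  assumes "n \<in>\<^sub>M om" "m \<in>\<^sub>M n"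
  shows "m \<in>\<^sub>M om"
proof -
  have "\<forall>m. m \<in>\<^sub>M n \<longrightarrow> m \<in>\<^sub>M om"
    by (rule om_induct[OF _ assms(1)]) (intro dfn, auto)
  then show ?thesis using assms by blast
qed

lemma om_cases:
  assumes "n \<in>\<^sub>M om"
  obtains "n = emp" | m where "m \<in>\<^sub>M om" "n = suc m"
proof -
  have "n = emp \<or> (\<exists>m. m \<in>\<^sub>M om \<and> n = suc m)"
    by (rule om_induct[OF _ assms]) (intro dfn, auto)
  then show ?thesis using that by blast
qed

lemma suc_inject [simp]: "suc a = suc b \<longleftrightarrow> a = b"
  by (metis mem_asym suc_iff)

lemma suc_mem_mono: "is_ordinal n \<Longrightarrow> m \<in>\<^sub>M n \<Longrightarrow> suc m \<in>\<^sub>M suc n"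
  using Ord_linear[of "suc m" n] Ord_mem[of n m] Ord_suc[of m] mem_asym mem_irrefl
  by (metis suc_iff)

lemma emp_mem_suc: "n \<in>\<^sub>M om \<Longrightarrow> emp \<in>\<^sub>M suc n"
  by (rule om_induct[where n = n], intro dfn) auto

lemma om_max:
  assumes "m \<in>\<^sub>M om" "n \<in>\<^sub>M om"
  obtains k where "k \<in>\<^sub>M om" "\<And>j. j \<in>\<^sub>M m \<or> j \<in>\<^sub>M n \<Longrightarrow> j \<in>\<^sub>M k" "m \<in>\<^sub>M suc k" "n \<in>\<^sub>M suc k"
  using Ord_linear[of m n] assms Ord_trans that by (metis om_Ord suc_iff)

section \<open>Recursion on the natural numbers\<close>

text \<open>Application is total, so the domain of an attempt does not matter.\<close>

definition attempt :: "'a \<Rightarrow> ('a \<Rightarrow> 'a \<Rightarrow> 'a) \<Rightarrow> 'a \<Rightarrow> 'a \<Rightarrow> bool" where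
  "attempt a G n f \<longleftrightarrow> f \<cdot> emp = a \<and> (\<forall>k. k \<in>\<^sub>M n \<longrightarrow> f \<cdot> suc k = G k (f \<cdot> k))"

definition nrec :: "'a \<Rightarrow> ('a \<Rightarrow> 'a \<Rightarrow> 'a) \<Rightarrow> 'a \<Rightarrow> 'a" where
  "nrec a G n = desc (\<lambda>x. \<exists>f. attempt a G n f \<and> x = f \<cdot> n)"

text \<open>For bodies with two variables of their own, such as the step of \<open>nrec\<close>,
  that occur under \<open>m\<close> further binders.\<close>

lemma dtm_shift:
  assumes "dtm (\<lambda>e. G (e 0) (e 1) (\<lambda>n. e (Suc (Suc n))))" "dtm s" "dtm t"
  shows "dtm (\<lambda>e. G (s e) (t e) (\<lambda>n. e (m + n)))"
proof -
  have "dtm (\<lambda>e. case_nat (s e) (case_nat (t e) (\<lambda>n. e (m + n))) i)" for i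
    by (cases i; cases "i - 1") (auto intro: assms dtm_var)
  from dtm_subst[OF assms(1), where ts = "\<lambda>e. case_nat (s e) (case_nat (t e) (\<lambda>n. e (m + n)))", OF this]
  show ?thesis by simp
qed

lemma dtm_nrec [dfn]:
  assumes "dtm a" "dtm (\<lambda>e. G (e 0) (e 1) (\<lambda>n. e (Suc (Suc n))))" "dtm t"
  shows "dtm (\<lambda>e. nrec (a e) (\<lambda>n x. G n x e) (t e))"
proof -
  note w = dtm_weaken[OF dtm_weaken[OF assms(1)]] dtm_weaken[OF dtm_weaken[OF assms(3)]]
    dtm_weaken[OF dtm_weaken[OF dtm_weaken[OF assms(3)]]]
  have "dtm (\<lambda>e. G (e 0) (e (Suc 0) \<cdot> e 0) (\<lambda>n. e (Suc (Suc (Suc n)))))"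
    using dtm_shift[OF assms(2), of "\<lambda>e. e 0" "\<lambda>e. e (Suc 0) \<cdot> e 0" "Suc (Suc (Suc 0))"]
    by (simp add: dfn)
  then show ?thesis
    unfolding nrec_def attempt_def
    by (intro dfn w)
qed

context
  fixes a :: 'a and G
  assumes G: "dtm (\<lambda>e. G (e 0) (e 1))"
begin

private lemma dfn_attempt: "dtm s \<Longrightarrow> dtm t \<Longrightarrow> dfn (\<lambda>e. attempt a G (s e) (t e))"
  by (rule dfn_subst2) (unfold attempt_def, intro dfn dtm_subst2[OF G])

private lemma attempt_ex: "n \<in>\<^sub>M om \<Longrightarrow> \<exists>f. attempt a G n f"
proof (rule om_induct[where n = n])
  show "dfn (\<lambda>e. \<exists>f. attempt a G (e 0) f)" by (intro dfn dfn_attempt)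
  show "\<exists>f. attempt a G emp f"
    by (rule exI[of _ "lam (upair emp emp) (\<lambda>_. a)"])
      (simp add: attempt_def app_lam dtm_const)
next
  fix n assume n: "n \<in>\<^sub>M om" "\<exists>f. attempt a G n f"
  then obtain f where f: "attempt a G n f" by blast
  define g where "g = lam (suc (suc n)) (\<lambda>k. if k = suc n then G n (f \<cdot> n) else f \<cdot> k)"
  have g: "g \<cdot> k = (if k = suc n then G n (f \<cdot> n) else f \<cdot> k)" if "k \<in>\<^sub>M suc (suc n)" for k
    unfolding g_def using that by (subst app_lam) (auto intro!: dfn)
  have "attempt a G (suc n) g"
    unfolding attempt_def
  proof (intro conjI allI impI)
    show "g \<cdot> emp = a"
      using f emp_mem_suc[of "suc n"] n by (subst g) (auto simp: attempt_def emp_neq_suc)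
    fix k assume k: "k \<in>\<^sub>M suc n"
    then have 1: "k \<noteq> suc n" using mem_irrefl by blast
    have 2: "suc k \<in>\<^sub>M suc (suc n)" by (rule suc_mem_mono[OF om_Ord]) (use n k in auto)
    have 3: "k \<in>\<^sub>M suc (suc n)" using k by simp
    show "g \<cdot> suc k = G k (g \<cdot> k)"
      unfolding g[OF 2] g[OF 3] using k f 1 by (auto simp: attempt_def)
  qed
  then show "\<exists>f. attempt a G (suc n) f" by blast
qed

private lemma attempt_unique:
  assumes n: "n \<in>\<^sub>M om" and f: "attempt a G n f" and g: "attempt a G n g"
  shows "f \<cdot> n = g \<cdot> n"
proof -
  have "k \<in>\<^sub>M suc n \<longrightarrow> f \<cdot> k = g \<cdot> k" if "k \<in>\<^sub>M om" for k
  proof (rule om_induct[OF _ that], intro dfn)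
    show "emp \<in>\<^sub>M suc n \<longrightarrow> f \<cdot> emp = g \<cdot> emp" using f g by (simp add: attempt_def)
    fix k assume k: "k \<in>\<^sub>M suc n \<longrightarrow> f \<cdot> k = g \<cdot> k"
    show "suc k \<in>\<^sub>M suc n \<longrightarrow> f \<cdot> suc k = g \<cdot> suc k"
    proof
      assume "suc k \<in>\<^sub>M suc n"
      then have "k \<in>\<^sub>M n" using Ord_mem_trans[OF om_Ord[OF n], of k "suc k"] by simp
      then show "f \<cdot> suc k = g \<cdot> suc k" using k f g by (simp add: attempt_def)
    qed
  qed
  then show ?thesis using n by simp
qed

private lemma nrec_eq:
  assumes "n \<in>\<^sub>M om" "attempt a G n f"
  shows "nrec a G n = f \<cdot> n"
  unfolding nrec_def by (rule desc_eq) (use assms attempt_unique[OF assms(1)] in blast)+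

lemma nrec_emp: "nrec a G emp = a"
proof -
  obtain f where f: "attempt a G emp f" using attempt_ex[of emp] by auto
  with nrec_eq[of emp f] show ?thesis by (simp add: attempt_def)
qed

lemma nrec_suc:
  assumes "n \<in>\<^sub>M om"
  shows "nrec a G (suc n) = G n (nrec a G n)"
proof -
  obtain f where f: "attempt a G (suc n) f" using attempt_ex[of "suc n"] assms by auto
  then have "attempt a G n f" by (auto simp: attempt_def)
  with nrec_eq[OF _ f] nrec_eq[of n f] assms f show ?thesis by (simp add: attempt_def)
qed

end

section \<open>Hartogs' theorem\<close>

definition im :: "'a \<Rightarrow> 'a \<Rightarrow> 'a" where "im f a = Repl a (\<lambda>x. f \<cdot> x)"

lemma im_iff: "y \<in>\<^sub>M im f a \<longleftrightarrow> (\<exists>x. x \<in>\<^sub>M a \<and> y = f \<cdot> x)"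
  unfolding im_def by (rule Repl_iff) (intro dfn)

lemma dtm_im [dfn]: "dtm s \<Longrightarrow> dtm t \<Longrightarrow> dtm (\<lambda>e. im (s e) (t e))"
  by (rule dtm_subst2) (unfold im_def, intro dfn)

lemma im_cong: "(\<And>x. x \<in>\<^sub>M a \<Longrightarrow> f \<cdot> x = g \<cdot> x) \<Longrightarrow> im f a = im g a"
  unfolding im_def by (rule Repl_cong)

text \<open>Values are compared only with those at members of \<open>x\<close>. On an ordinal this
  amounts to injectivity, since its members are comparable, and it is the form in which newness
  against earlier list entries arises.\<close>

definition inj_into :: "'a \<Rightarrow> 'a \<Rightarrow> 'a \<Rightarrow> bool" where
  "inj_into f a y \<longleftrightarrow> (\<forall>x. x \<in>\<^sub>M a \<longrightarrow> f \<cdot> x \<in>\<^sub>M y \<and> (\<forall>z. z \<in>\<^sub>M x \<longrightarrow> f \<cdot> x \<noteq> f \<cdot> z))"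

lemma dfn_inj_into [dfn]: "dtm s \<Longrightarrow> dtm t \<Longrightarrow> dtm u \<Longrightarrow> dfn (\<lambda>e. inj_into (s e) (t e) (u e))"
  by (rule dfn_subst3) (unfold inj_into_def, intro dfn)

lemma inj_into_eq:
  assumes "is_ordinal a" "inj_into f a y" "b \<in>\<^sub>M a" "c \<in>\<^sub>M a" "f \<cdot> b = f \<cdot> c"
  shows "b = c"
  using Ord_linear[of b c] assms Ord_mem[of a] unfolding inj_into_def by metis

text \<open>The images of the initial segments of \<open>a\<close> form a chain under inclusion that
  is a copy of \<open>a\<close>, and a well-ordered chain determines its ordinal. Thus an ordinal
  that injects into \<open>y\<close> is recovered from a set of subsets of \<open>y\<close>.\<close>

lemma segments_unique:
  assumes a: "is_ordinal a" "inj_into f a y" and b: "is_ordinal b" "inj_into g b y"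
    and eq: "Repl a (im f) = Repl b (im g)"
  shows "a = b"
proof -
  have iff: "z \<in>\<^sub>M Repl a (im f) \<longleftrightarrow> (\<exists>x. x \<in>\<^sub>M a \<and> z = im f x)" for z f a
    by (rule Repl_iff) (intro dfn)
  have less: "im f d \<subseteq>\<^sub>M im f x \<and> im f d \<noteq> im f x"
    if "is_ordinal a" "inj_into f a y" "d \<in>\<^sub>M x" "x \<in>\<^sub>M a" for d x a f
  proof -
    have "f \<cdot> d \<in>\<^sub>M im f x" using that by (auto simp: im_iff)
    moreover have "\<not> f \<cdot> d \<in>\<^sub>M im f d"
      using inj_into_eq[OF that(1,2), of d] that mem_irrefl Ord_trans[OF that(1)] unfolding im_iff by metis
    moreover have "im f d \<subseteq>\<^sub>M im f x"
      using that Ord_trans[OF Ord_mem[OF that(1,4)]] by (auto simp: im_iff subset_def)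
    ultimately show ?thesis by auto
  qed
  have *: "x \<in>\<^sub>M a \<longrightarrow> x \<in>\<^sub>M b \<longrightarrow> im f x = im g x" if "is_ordinal x" for x
  proof (rule Ord_induct[OF _ that], intro dfn, intro impI)
    fix x assume x: "is_ordinal x" "x \<in>\<^sub>M a" "x \<in>\<^sub>M b"
      and IH: "\<And>d. d \<in>\<^sub>M x \<Longrightarrow> d \<in>\<^sub>M a \<longrightarrow> d \<in>\<^sub>M b \<longrightarrow> im f d = im g d"
    have half: "im g x \<subseteq>\<^sub>M im f x"
      if h: "is_ordinal a" "inj_into f a y" "is_ordinal b" "inj_into g b y" "x \<in>\<^sub>M a" "x \<in>\<^sub>M b"
        "Repl a (im f) = Repl b (im g)" "\<And>d. d \<in>\<^sub>M x \<Longrightarrow> im f d = im g d" for f g a b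
    proof -
      have "im f x \<in>\<^sub>M Repl a (im f)" using h(5) iff by blast
      then obtain d where d: "d \<in>\<^sub>M b" "im f x = im g d"
        unfolding h(7) iff by blast
      \<comment> \<open>Below \<open>x\<close> the segments of both functions agree and are properly
        smaller than \<open>im f x\<close>.\<close>
      have "\<not> d \<in>\<^sub>M x"
        using h(8)[of d] less[OF h(1,2) _ h(5), of d] d by auto
      then have "x \<in>\<^sub>M d \<or> x = d"
        using Ord_linear[of x d] x(1) Ord_mem[OF h(3)] d by auto
      then show ?thesis
        using less[OF h(3,4), of x d] d by (auto simp: subset_def)
    qed
    have IH': "im f d = im g d" if "d \<in>\<^sub>M x" for d
      using IH[OF that] that x Ord_trans[OF a(1)] Ord_trans[OF b(1)] by blast
    have "im g x \<subseteq>\<^sub>M im f x" by (rule half[OF a b x(2,3) eq IH'])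
    moreover have "im f x \<subseteq>\<^sub>M im g x"
      by (rule half[OF b a x(3,2) eq[symmetric] IH'[symmetric]])
    ultimately show "im f x = im g x" by (intro ext) (auto simp: subset_def)
  qed
  \<comment> \<open>If \<open>a\<close> were shorter than \<open>b\<close>, the segment
    \<open>im g a\<close> would equal an earlier segment of \<open>g\<close>, against strict
    growth.\<close>
  have no: False if h: "is_ordinal a" "inj_into f a y" "is_ordinal b" "inj_into g b y" "a \<in>\<^sub>M b"
    "Repl a (im f) = Repl b (im g)" "\<And>x. is_ordinal x \<Longrightarrow> x \<in>\<^sub>M a \<Longrightarrow> x \<in>\<^sub>M b \<Longrightarrow> im f x = im g x" for a b f g
  proof -
    have "im g a \<in>\<^sub>M Repl b (im g)" using h(5) iff by blast
    then obtain d where d: "d \<in>\<^sub>M a" "im g a = im f d" unfolding h(6)[symmetric] iff by blast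
    have "im f d = im g d"
      using h(7)[of d] d Ord_mem[OF h(1)] Ord_trans[OF h(3,5)] by auto
    then show False using less[OF h(3,4) d(1) h(5)] d by simp
  qed
  have "\<not> a \<in>\<^sub>M b" using no[OF a b _ eq] * by blast
  moreover have "\<not> b \<in>\<^sub>M a" using no[OF b a _ eq[symmetric]] * by (metis (no_types))
  ultimately show ?thesis using Ord_linear[OF a(1) b(1)] by blast
qed

text \<open>Burali-Forti: the set of all ordinals would itself be an ordinal and hence its own
  element.\<close>

lemma no_set_of_ordinals: "\<exists>a. is_ordinal a \<and> \<not> a \<in>\<^sub>M t"
proof (rule ccontr)
  assume "\<not> ?thesis"
  then have *: "is_ordinal a \<Longrightarrow> a \<in>\<^sub>M t" for a by blast
  define b where "b = Sep t is_ordinal"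
  have b: "x \<in>\<^sub>M b \<longleftrightarrow> is_ordinal x" for x
    unfolding b_def by (subst Sep_iff) (auto intro: dfn *)
  have "is_ordinal b" by (rule OrdI) (simp_all only: b, rule Ord_mem)
  then have "b \<in>\<^sub>M b" by (simp only: b)
  with mem_irrefl show False by simp
qed

text \<open>Otherwise every ordinal would be recovered from a member of \<open>Pow (Pow y)\<close>,
  namely from the chain of images of its initial segments, and Replacement would collect all
  ordinals in a set.\<close>

lemma Hartogs: "\<exists>t. is_ordinal t \<and> (\<forall>f. \<not> inj_into f t y)"
proof (rule ccontr)
  assume "\<not> ?thesis"
  then have all: "\<exists>f. inj_into f a y" if "is_ordinal a" for a using that by blast
  \<comment> \<open>No injection is chosen: by \<open>segments_unique\<close> all injections with
    the same chain \<open>c\<close> have the same ordinal as domain.\<close>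
  define F where "F c = desc (\<lambda>a. is_ordinal a \<and> (\<exists>f. inj_into f a y \<and> c = Repl a (im f)))" for c
  define t where "t = Repl (Pow (Pow y)) F"
  have t: "z \<in>\<^sub>M t \<longleftrightarrow> (\<exists>c. c \<in>\<^sub>M Pow (Pow y) \<and> z = F c)" for z
    unfolding t_def F_def by (rule Repl_iff) (intro dfn)
  obtain a where a: "is_ordinal a" "\<not> a \<in>\<^sub>M t" using no_set_of_ordinals by blast
  obtain f where f: "inj_into f a y" using all a by blast
  have "F (Repl a (im f)) = a"
    unfolding F_def by (rule desc_eq) (use a f segments_unique in \<open>blast, metis\<close>)
  moreover have "Repl a (im f) \<in>\<^sub>M Pow (Pow y)"
  proof -
    have "z \<in>\<^sub>M Repl a (im f) \<longleftrightarrow> (\<exists>x. x \<in>\<^sub>M a \<and> z = im f x)" for z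
      by (rule Repl_iff) (intro dfn)
    then show ?thesis
      using f Ord_trans[OF a(1)] by (fastforce simp: subset_def im_iff inj_into_def)
  qed
  ultimately show False using a t by metis
qed

section \<open>Pairs of natural numbers\<close>

definition pred :: "'a \<Rightarrow> 'a" where "pred n = desc (\<lambda>m. n = suc m)"

lemma dtm_pred [dfn]: "dtm s \<Longrightarrow> dtm (\<lambda>e. pred (s e))"
  by (rule dtm_subst1) (unfold pred_def, intro dfn)

lemma pred_suc [simp]: "pred (suc m) = m"
  unfolding pred_def by (rule desc_eq) auto

text \<open>The enumeration runs down the diagonals of the plane.\<close>

definition enum :: "'a \<Rightarrow> 'a" where
  "enum i = nrec (pair emp emp)
    (\<lambda>_ q. if Fst q = emp then pair (suc (Snd q)) emp else pair (pred (Fst q)) (suc (Snd q))) i"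

lemma dtm_enum [dfn]: "dtm s \<Longrightarrow> dtm (\<lambda>e. enum (s e))"
  by (rule dtm_subst1) (unfold enum_def, intro dfn)

lemma enum_emp: "enum emp = pair emp emp"
  unfolding enum_def by (rule nrec_emp) (intro dfn)
lemma enum_suc: "i \<in>\<^sub>M om \<Longrightarrow> enum (suc i) = (if Fst (enum i) = emp then pair (suc (Snd (enum i))) emp
    else pair (pred (Fst (enum i))) (suc (Snd (enum i))))"
  unfolding enum_def by (rule nrec_suc) (intro dfn)

definition nadd :: "'a \<Rightarrow> 'a \<Rightarrow> 'a" where "nadd a k = nrec a (\<lambda>_ x. suc x) k"

lemma dtm_nadd [dfn]: "dtm s \<Longrightarrow> dtm t \<Longrightarrow> dtm (\<lambda>e. nadd (s e) (t e))"
  by (rule dtm_subst2) (unfold nadd_def, intro dfn)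

lemma nadd_emp: "nadd a emp = a"
  unfolding nadd_def by (rule nrec_emp) (intro dfn)
lemma nadd_suc: "k \<in>\<^sub>M om \<Longrightarrow> nadd a (suc k) = suc (nadd a k)"
  unfolding nadd_def by (rule nrec_suc) (intro dfn)

lemma nadd_om: "k \<in>\<^sub>M om \<Longrightarrow> a \<in>\<^sub>M om \<Longrightarrow> nadd a k \<in>\<^sub>M om"
  by (rule om_induct[where n = k], intro dfn) (auto simp: nadd_emp nadd_suc)
lemma nadd_suc_left: "k \<in>\<^sub>M om \<Longrightarrow> nadd (suc a) k = suc (nadd a k)"
  by (rule om_induct[where n = k], intro dfn) (auto simp: nadd_emp nadd_suc)
lemma nadd_emp_left: "k \<in>\<^sub>M om \<Longrightarrow> nadd emp k = k"
  by (rule om_induct[where n = k], intro dfn) (auto simp: nadd_emp nadd_suc)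

text \<open>A diagonal starts at \<open>(k, 0)\<close> and ends at \<open>(0, k)\<close>, after
  which comes \<open>(suc k, 0)\<close>; so all starting points are hit. The pair
  \<open>(a, b)\<close> is reached \<open>b\<close> steps after the start \<open>nadd a b\<close> of
  its diagonal.\<close>

lemma enum_surj:
  assumes "a \<in>\<^sub>M om" "b \<in>\<^sub>M om"
  shows "\<exists>i. i \<in>\<^sub>M om \<and> enum i = pair a b"
proof -
  define hit where "hit a b \<longleftrightarrow> (\<exists>i. i \<in>\<^sub>M om \<and> enum i = pair a b)" for a b
  have dfn_hit: "dtm s \<Longrightarrow> dtm t \<Longrightarrow> dfn (\<lambda>e. hit (s e) (t e))" for s t
    by (rule dfn_subst2) (unfold hit_def, intro dfn)
  have step1: "hit a (suc b)" if "hit (suc a) b" for a b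
  proof -
    obtain i where i: "i \<in>\<^sub>M om" "enum i = pair (suc a) b" using \<open>hit (suc a) b\<close> unfolding hit_def by auto
    then have "enum (suc i) = pair a (suc b)" by (simp add: enum_suc emp_neq_suc)
    with i show ?thesis unfolding hit_def by (intro exI[of _ "suc i"]) simp
  qed
  have step2: "hit (suc b) emp" if "hit emp b" for b
  proof -
    obtain i where i: "i \<in>\<^sub>M om" "enum i = pair emp b" using \<open>hit emp b\<close> unfolding hit_def by auto
    then have "enum (suc i) = pair (suc b) emp" by (simp add: enum_suc)
    with i show ?thesis unfolding hit_def by (intro exI[of _ "suc i"]) simp
  qed
  have "\<forall>a b. hit (nadd a k) b \<longrightarrow> hit a (nadd b k)" if k: "k \<in>\<^sub>M om" for k
  proof (rule om_induct[OF _ k], intro dfn dfn_hit)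
    show "\<forall>a b. hit (nadd a emp) b \<longrightarrow> hit a (nadd b emp)" by (simp add: nadd_emp)
    fix k assume k: "k \<in>\<^sub>M om" and IH: "\<forall>a b. hit (nadd a k) b \<longrightarrow> hit a (nadd b k)"
    show "\<forall>a b. hit (nadd a (suc k)) b \<longrightarrow> hit a (nadd b (suc k))"
    proof (intro allI impI)
      fix a b assume "hit (nadd a (suc k)) b"
      then have "hit (nadd a k) (suc b)" using k by (intro step1) (simp add: nadd_suc)
      then have "hit a (nadd (suc b) k)" using IH by blast
      then show "hit a (nadd b (suc k))" using k by (simp add: nadd_suc nadd_suc_left)
    qed
  qed
  then have walk: "hit a (nadd b k)" if "hit (nadd a k) b" "k \<in>\<^sub>M om" for a b k
    using that by blast
  have row: "hit k emp" if k: "k \<in>\<^sub>M om" for k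
  proof (rule om_induct[OF _ k], intro dfn dfn_hit)
    show "hit emp emp" unfolding hit_def using enum_emp emp_om by blast
    fix k assume k: "k \<in>\<^sub>M om" "hit k emp"
    then have "hit emp k" using walk[of emp k emp] by (simp add: nadd_emp_left)
    then show "hit (suc k) emp" by (rule step2)
  qed
  have "hit (nadd a b) emp" using row nadd_om assms by blast
  then have "hit a b" using walk[of a b emp] assms by (simp add: nadd_emp_left)
  then show ?thesis unfolding hit_def .
qed

definition lft :: "'a \<Rightarrow> 'a" where "lft i = Fst (enum i)"
definition rgt :: "'a \<Rightarrow> 'a" where "rgt i = Snd (enum i)"

lemma dtm_lft [dfn]: "dtm s \<Longrightarrow> dtm (\<lambda>e. lft (s e))"
  unfolding lft_def by (intro dfn)
lemma dtm_rgt [dfn]: "dtm s \<Longrightarrow> dtm (\<lambda>e. rgt (s e))"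
  unfolding rgt_def by (intro dfn)

lemma lft_rgt_surj:
  assumes "a \<in>\<^sub>M om" "b \<in>\<^sub>M om"
  obtains i where "i \<in>\<^sub>M om" "lft i = a" "rgt i = b"
  using enum_surj[OF assms] unfolding lft_def rgt_def by auto

section \<open>Plays inside the structure\<close>

lemma dfn_opened [dfn]: "dtm s \<Longrightarrow> dtm t \<Longrightarrow> dfn (\<lambda>e. opened (s e) (t e))"
  by (rule dfn_subst2) (unfold opened_def, intro dfn)
lemma dfn_is_restriction [dfn]: "dtm s \<Longrightarrow> dtm t \<Longrightarrow> dtm u \<Longrightarrow> dfn (\<lambda>e. is_restriction (s e) (t e) (u e))"
  by (rule dfn_subst3) (unfold is_restriction_def is_pair_iff, intro dfn)
lemma dfn_is_opening_sequence [dfn]: "dtm s \<Longrightarrow> dtm t \<Longrightarrow> dfn (\<lambda>e. is_opening_sequence (s e) (t e))"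
  by (rule dfn_subst2) (unfold is_opening_sequence_def is_Pow_iff, intro dfn)
lemma dfn_all_opened [dfn]: "dtm s \<Longrightarrow> dtm t \<Longrightarrow> dfn (\<lambda>e. all_opened (s e) (t e))"
  by (rule dfn_subst2) (unfold all_opened_def, intro dfn)
lemma dfn_is_history [dfn]:
  "dtm s \<Longrightarrow> dtm t \<Longrightarrow> dtm u \<Longrightarrow> dtm v \<Longrightarrow> dtm w \<Longrightarrow> dfn (\<lambda>e. is_history (s e) (t e) (u e) (v e) (w e))"
  by (rule dfn_subst5) (unfold is_history_def is_pair_iff, intro dfn)

lemma opened_iff: "opened s b \<longleftrightarrow> (\<exists>\<beta> S. pair \<beta> S \<in>\<^sub>M s \<and> b \<in>\<^sub>M S)"
  unfolding opened_def maps_iff ..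

definition restriction :: "'a \<Rightarrow> 'a \<Rightarrow> 'a" where
  "restriction s a = Sep s (\<lambda>p. \<exists>x y. x \<in>\<^sub>M a \<and> p = pair x y)"

lemma restriction_iff: "p \<in>\<^sub>M restriction s a \<longleftrightarrow> p \<in>\<^sub>M s \<and> (\<exists>x y. x \<in>\<^sub>M a \<and> p = pair x y)"
  unfolding restriction_def by (rule Sep_iff) (intro dfn)

lemma is_restriction_iff: "is_restriction s a s' \<longleftrightarrow> s' = restriction s a"
proof
  assume "is_restriction s a s'"
  then show "s' = restriction s a"
    unfolding is_restriction_def is_pair_iff by (intro ext) (simp only: restriction_iff)
next
  assume "s' = restriction s a"
  then show "is_restriction s a s'"
    unfolding is_restriction_def is_pair_iff by (simp only: restriction_iff simp_thms)
qed

lemma opened_restriction: "opened (restriction s a) b \<longleftrightarrow> (\<exists>\<beta> S. \<beta> \<in>\<^sub>M a \<and> pair \<beta> S \<in>\<^sub>M s \<and> b \<in>\<^sub>M S)"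
  unfolding opened_iff restriction_iff pair_inject by blast

lemma opening_sequenceD:
  assumes "is_opening_sequence b s"
  obtains a where "is_ordinal a" "s \<in>\<^sub>M funs a (Pow b)"
    "\<And>x. x \<in>\<^sub>M a \<Longrightarrow> \<exists>c. c \<in>\<^sub>M s \<cdot> x \<and> \<not> opened (restriction s x) c"
proof -
  obtain a where a: "is_ordinal a" "is_function s a (Pow b)"
    using assms unfolding is_opening_sequence_def is_Pow_iff by blast
  have s: "s \<in>\<^sub>M funs a (Pow b)" using a(2) fun_iff_is by blast
  have "\<exists>c. c \<in>\<^sub>M s \<cdot> x \<and> \<not> opened (restriction s x) c" if "x \<in>\<^sub>M a" for x
    using assms funD(2)[OF s that] unfolding is_opening_sequence_def maps_iff is_restriction_iff by blast
  then show thesis using that a(1) s by blast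
qed

lemma opened_subset:
  assumes "is_opening_sequence b s" "opened s c"
  shows "c \<in>\<^sub>M b"
proof -
  obtain a where s: "s \<in>\<^sub>M funs a (Pow b)" using opening_sequenceD[OF assms(1)] by blast
  obtain x S where S: "pair x S \<in>\<^sub>M s" "c \<in>\<^sub>M S" using assms(2) unfolding opened_iff by blast
  have "S \<in>\<^sub>M Pow b" using S(1)[unfolded funD(3)[OF s]] funD(1)[OF s] by metis
  with S(2) show ?thesis by (simp add: subset_def)
qed

text \<open>Picked by the choice operator, hence used only at a fixed \<open>y\<close>, as a
  parameter; no definability in \<open>y\<close> is claimed.\<close>

definition Hartogs_number :: "'a \<Rightarrow> 'a" where
  "Hartogs_number y = (SOME t. is_ordinal t \<and> (\<forall>f. \<not> inj_into f t y))"

lemma Hartogs_number: "is_ordinal (Hartogs_number y)" "\<not> inj_into f (Hartogs_number y) y"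
  using someI_ex[OF Hartogs[of y]] unfolding Hartogs_number_def by blast+

text \<open>Each move opens a new box, so the unions of the moves before \<open>x\<close> grow
  strictly with \<open>x\<close> and inject the length of the sequence into \<open>Pow b\<close>.
  With its length bounded, opening sequences form a set, which is what allows a strategy to be a set
  of the structure.\<close>

lemma opening_sequence_bounded:
  assumes "is_opening_sequence b s"
  shows "s \<in>\<^sub>M Pow (Hartogs_number (Pow b) \<times>\<^sub>M Pow b)"
proof -
  obtain a where a: "is_ordinal a" "s \<in>\<^sub>M funs a (Pow b)"
    "\<And>x. x \<in>\<^sub>M a \<Longrightarrow> \<exists>c. c \<in>\<^sub>M s \<cdot> x \<and> \<not> opened (restriction s x) c"
    using opening_sequenceD[OF assms] by blast
  define f where "f = lam a (\<lambda>x. Uni (im s x))"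
  have f: "f \<cdot> x = Uni (im s x)" if "x \<in>\<^sub>M a" for x
    unfolding f_def by (rule app_lam[OF _ that]) (intro dfn)
  have sub: "s \<cdot> x \<subseteq>\<^sub>M b" if "x \<in>\<^sub>M a" for x using funD(1)[OF a(2) that] by simp
  have pw: "f \<cdot> x \<in>\<^sub>M Pow b" if x: "x \<in>\<^sub>M a" for x
    unfolding f[OF x] Pow_iff subset_def Uni_iff im_iff
    using sub Ord_trans[OF a(1) x] unfolding subset_def by blast
  have neq: "f \<cdot> x \<noteq> f \<cdot> z" if x: "x \<in>\<^sub>M a" "z \<in>\<^sub>M x" for x z
  proof -
    have z: "z \<in>\<^sub>M a" by (rule Ord_trans[OF a(1) x])
    obtain c where c: "c \<in>\<^sub>M s \<cdot> z" "\<not> opened (restriction s z) c" using a(3)[OF z] by blast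
    have "c \<in>\<^sub>M f \<cdot> x" unfolding f[OF x(1)] Uni_iff im_iff using c(1) x(2) by blast
    moreover have "\<not> c \<in>\<^sub>M f \<cdot> z"
    proof
      assume "c \<in>\<^sub>M f \<cdot> z"
      then obtain y where y: "y \<in>\<^sub>M z" "c \<in>\<^sub>M s \<cdot> y" unfolding f[OF z] Uni_iff im_iff by blast
      have "pair y (s \<cdot> y) \<in>\<^sub>M s" by (rule funD(2)[OF a(2) Ord_trans[OF a(1) z y(1)]])
      with c(2) y show False unfolding opened_restriction by blast
    qed
    ultimately show ?thesis by metis
  qed
  have "a \<in>\<^sub>M Hartogs_number (Pow b)"
  proof (rule ccontr)
    assume "\<not> ?thesis"
    then have "Hartogs_number (Pow b) \<in>\<^sub>M suc a" using Ord_linear[OF a(1) Hartogs_number(1)] by auto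
    then have "x \<in>\<^sub>M a" if "x \<in>\<^sub>M Hartogs_number (Pow b)" for x by (rule Ord_mem_trans[OF a(1) that])
    then have "inj_into f (Hartogs_number (Pow b)) (Pow b)" unfolding inj_into_def using pw neq by blast
    with Hartogs_number(2) show False by blast
  qed
  then have "x \<in>\<^sub>M Hartogs_number (Pow b)" if "x \<in>\<^sub>M a" for x using Ord_trans[OF Hartogs_number(1) _ that] by blast
  moreover have "s \<subseteq>\<^sub>M a \<times>\<^sub>M Pow b"
    using a(2) unfolding fun_iff_is is_function_iff by blast
  ultimately show ?thesis unfolding Pow_iff subset_def prod_iff by blast
qed

text \<open>The domain of \<open>w\<close>, read off from its pairs. It lets a move depend on the
  seen values alone, whatever the order of opening.\<close>

definition seen :: "'a \<Rightarrow> 'a" where "seen w = Repl w Fst"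

lemma seen_iff: "c \<in>\<^sub>M seen w \<longleftrightarrow> (\<exists>u. u \<in>\<^sub>M w \<and> c = Fst u)"
  unfolding seen_def by (rule Repl_iff) (intro dfn)

lemma dtm_seen [dfn]: "dtm s \<Longrightarrow> dtm (\<lambda>e. seen (s e))"
  by (rule dtm_subst1) (unfold seen_def, intro dfn)

lemma history_seen:
  assumes "is_history b y s w h"
  shows "c \<in>\<^sub>M seen w \<longleftrightarrow> opened s c" "w \<in>\<^sub>M Pow (b \<times>\<^sub>M y)" "h = pair s w" "is_opening_sequence b s"
proof -
  obtain d where d: "\<And>c. c \<in>\<^sub>M d \<longleftrightarrow> opened s c" "is_function w d y" "h = pair s w" "is_opening_sequence b s"
    using assms unfolding is_history_def is_pair_iff by blast
  have w: "w \<in>\<^sub>M funs d y" using d(2) fun_iff_is by blast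
  have sub: "w \<subseteq>\<^sub>M d \<times>\<^sub>M y" using d(2) unfolding is_function_iff by blast
  show "h = pair s w" "is_opening_sequence b s" by (rule d)+
  show "w \<in>\<^sub>M Pow (b \<times>\<^sub>M y)"
    using sub opened_subset[OF d(4)] d(1) unfolding Pow_iff subset_def prod_iff by blast
  have "c \<in>\<^sub>M seen w \<longleftrightarrow> c \<in>\<^sub>M d"
  proof
    assume "c \<in>\<^sub>M seen w"
    then obtain u where u: "u \<in>\<^sub>M w" "c = Fst u" unfolding seen_iff by blast
    then obtain x z where "x \<in>\<^sub>M d" "u = pair x z" using subsetD[OF sub u(1)] unfolding prod_iff by blast
    with u show "c \<in>\<^sub>M d" by simp
  next
    assume "c \<in>\<^sub>M d"
    then have "pair c (w \<cdot> c) \<in>\<^sub>M w" by (rule funD(2)[OF w])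
    then show "c \<in>\<^sub>M seen w" unfolding seen_iff using Fst_pair by metis
  qed
  then show "c \<in>\<^sub>M seen w \<longleftrightarrow> opened s c" using d(1) by simp
qed

lemma is_open_move_iff: "is_open_move S m \<longleftrightarrow> m = pair emp S"
  unfolding is_open_move_def is_empty_iff is_pair_iff by auto

lemma is_guess_move_iff: "is_guess_move b x m \<longleftrightarrow> m = pair (suc emp) (pair b x)"
  unfolding is_guess_move_def is_empty_iff is_pair_iff is_succ_iff by auto

end

locale ZF_reals = ZF +
  fixes R add mul lt :: 'a
  assumes reals: "is_reals R add mul lt"
begin

section \<open>The ordered group of the reals\<close>

definition plus :: "'a \<Rightarrow> 'a \<Rightarrow> 'a" (infixl "\<oplus>" 65) where
  "x \<oplus> y = add \<cdot> pair x y"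

definition less :: "'a \<Rightarrow> 'a \<Rightarrow> bool" (infix "\<prec>" 50) where
  "x \<prec> y \<longleftrightarrow> pair x y \<in>\<^sub>M lt"

definition leq :: "'a \<Rightarrow> 'a \<Rightarrow> bool" (infix "\<preceq>" 50) where
  "x \<preceq> y \<longleftrightarrow> x = y \<or> x \<prec> y"

lemma dtm_plus [dfn]: "dtm s \<Longrightarrow> dtm t \<Longrightarrow> dtm (\<lambda>e. s e \<oplus> t e)"
  unfolding plus_def by (intro dfn)
lemma dfn_less [dfn]: "dtm s \<Longrightarrow> dtm t \<Longrightarrow> dfn (\<lambda>e. s e \<prec> t e)"
  unfolding less_def by (intro dfn)
lemma dfn_leq [dfn]: "dtm s \<Longrightarrow> dtm t \<Longrightarrow> dfn (\<lambda>e. s e \<preceq> t e)"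
  unfolding leq_def by (intro dfn)

text \<open>\<open>binop\<close> is a description on the level of HOL; on \<open>R\<close> it
  coincides with \<open>app\<close>, whose graph is definable.\<close>

lemma binop:
  assumes f: "is_binop f R" and xy: "x \<in>\<^sub>M R" "y \<in>\<^sub>M R"
  shows "binop f x y = f \<cdot> pair x y" "f \<cdot> pair x y \<in>\<^sub>M R"
proof -
  have ex: "\<exists>!z. pair (pair x y) z \<in>\<^sub>M f"
    using f xy unfolding is_binop_def is_pair_iff maps_iff by simp
  have "binop f x y = (THE z. pair (pair x y) z \<in>\<^sub>M f)"
    unfolding binop_def is_pair_iff maps_iff by simp
  then show "binop f x y = f \<cdot> pair x y"
    unfolding app_def desc_def using ex by simp
  have "pair (pair x y) (f \<cdot> pair x y) \<in>\<^sub>M f"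
    unfolding app_def using descI[OF ex] .
  then obtain z p where "z \<in>\<^sub>M R" "pair (pair x y) (f \<cdot> pair x y) = pair p z"
    using f unfolding is_binop_def is_pair_iff by blast
  then show "f \<cdot> pair x y \<in>\<^sub>M R" unfolding pair_inject by blast
qed

lemma field: "is_ordered_field R add mul lt"
  using reals by (simp add: is_reals_def)

lemmas field_rules = field[unfolded is_ordered_field_def maps_iff less_def[symmetric]]
lemmas field_ring = field_rules[THEN conjunct2, THEN conjunct2, THEN conjunct1, rule_format]
lemmas field_zero_one = field_rules[THEN conjunct2, THEN conjunct2, THEN conjunct2, THEN conjunct1]
lemmas field_order = field_rules[THEN conjunct2, THEN conjunct2, THEN conjunct2, THEN conjunct2]

lemma binops: "is_binop add R" "is_binop mul R"
  using field unfolding is_ordered_field_def by blast+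

lemma plus_closed [simp, intro]: "x \<in>\<^sub>M R \<Longrightarrow> y \<in>\<^sub>M R \<Longrightarrow> x \<oplus> y \<in>\<^sub>M R"
  unfolding plus_def by (rule binop(2)[OF binops(1)])

lemma binop_add: "x \<in>\<^sub>M R \<Longrightarrow> y \<in>\<^sub>M R \<Longrightarrow> binop add x y = x \<oplus> y"
  unfolding plus_def by (rule binop(1)[OF binops(1)])

lemma plus_assoc:
  assumes "x \<in>\<^sub>M R" "y \<in>\<^sub>M R" "z \<in>\<^sub>M R"
  shows "(x \<oplus> y) \<oplus> z = x \<oplus> (y \<oplus> z)"
  using field_ring[OF assms, THEN conjunct1] assms by (simp add: binop_add)

lemma plus_comm:
  assumes "x \<in>\<^sub>M R" "y \<in>\<^sub>M R"
  shows "x \<oplus> y = y \<oplus> x"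
  using field_ring[OF assms assms(1), THEN conjunct2, THEN conjunct2, THEN conjunct1] assms
  by (simp add: binop_add)

lemma plus_left_comm: "x \<in>\<^sub>M R \<Longrightarrow> y \<in>\<^sub>M R \<Longrightarrow> z \<in>\<^sub>M R \<Longrightarrow> x \<oplus> (y \<oplus> z) = y \<oplus> (x \<oplus> z)"
  by (metis plus_assoc plus_comm)

lemma less_irrefl: "x \<in>\<^sub>M R \<Longrightarrow> \<not> x \<prec> x"
  and less_linear: "x \<in>\<^sub>M R \<Longrightarrow> y \<in>\<^sub>M R \<Longrightarrow> x \<prec> y \<or> x = y \<or> y \<prec> x"
  and less_trans: "x \<in>\<^sub>M R \<Longrightarrow> y \<in>\<^sub>M R \<Longrightarrow> z \<in>\<^sub>M R \<Longrightarrow> x \<prec> y \<Longrightarrow> y \<prec> z \<Longrightarrow> x \<prec> z"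
  and plus_right_mono: "x \<in>\<^sub>M R \<Longrightarrow> y \<in>\<^sub>M R \<Longrightarrow> z \<in>\<^sub>M R \<Longrightarrow> x \<prec> y \<Longrightarrow> x \<oplus> z \<prec> y \<oplus> z"
proof -
  have b: "binop add x y = x \<oplus> y" if "x \<in>\<^sub>M R" "y \<in>\<^sub>M R" for x y
    unfolding plus_def by (rule binop(1)[OF binops(1) that])
  have *: "(\<forall>x. x \<in>\<^sub>M R \<longrightarrow> \<not> x \<prec> x) \<and>
     (\<forall>x y. x \<in>\<^sub>M R \<longrightarrow> y \<in>\<^sub>M R \<longrightarrow> x \<prec> y \<or> x = y \<or> y \<prec> x) \<and>
     (\<forall>x y z. x \<in>\<^sub>M R \<longrightarrow> y \<in>\<^sub>M R \<longrightarrow> z \<in>\<^sub>M R \<longrightarrow> x \<prec> y \<longrightarrow>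
        (y \<prec> z \<longrightarrow> x \<prec> z) \<and> binop add x z \<prec> binop add y z)"
    by (rule field_order)
  from * show "x \<in>\<^sub>M R \<Longrightarrow> \<not> x \<prec> x"
    "x \<in>\<^sub>M R \<Longrightarrow> y \<in>\<^sub>M R \<Longrightarrow> x \<prec> y \<or> x = y \<or> y \<prec> x"
    "x \<in>\<^sub>M R \<Longrightarrow> y \<in>\<^sub>M R \<Longrightarrow> z \<in>\<^sub>M R \<Longrightarrow> x \<prec> y \<Longrightarrow> y \<prec> z \<Longrightarrow> x \<prec> z"
    by blast+
  show "x \<in>\<^sub>M R \<Longrightarrow> y \<in>\<^sub>M R \<Longrightarrow> z \<in>\<^sub>M R \<Longrightarrow> x \<prec> y \<Longrightarrow> x \<oplus> z \<prec> y \<oplus> z"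
    using * b by metis
qed

lemma leq_refl [simp]: "x \<preceq> x"
  by (simp add: leq_def)
lemma leq_trans: "x \<in>\<^sub>M R \<Longrightarrow> y \<in>\<^sub>M R \<Longrightarrow> z \<in>\<^sub>M R \<Longrightarrow> x \<preceq> y \<Longrightarrow> y \<preceq> z \<Longrightarrow> x \<preceq> z"
  unfolding leq_def using less_trans by blast
lemma leq_less_trans: "x \<in>\<^sub>M R \<Longrightarrow> y \<in>\<^sub>M R \<Longrightarrow> z \<in>\<^sub>M R \<Longrightarrow> x \<preceq> y \<Longrightarrow> y \<prec> z \<Longrightarrow> x \<prec> z"
  unfolding leq_def using less_trans by blast
lemma less_leq_trans: "x \<in>\<^sub>M R \<Longrightarrow> y \<in>\<^sub>M R \<Longrightarrow> z \<in>\<^sub>M R \<Longrightarrow> x \<prec> y \<Longrightarrow> y \<preceq> z \<Longrightarrow> x \<prec> z"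
  unfolding leq_def using less_trans by blast
lemma not_less: "x \<in>\<^sub>M R \<Longrightarrow> y \<in>\<^sub>M R \<Longrightarrow> \<not> x \<prec> y \<longleftrightarrow> y \<preceq> x"
  unfolding leq_def using less_trans less_linear less_irrefl by blast
lemma plus_left_mono: "x \<in>\<^sub>M R \<Longrightarrow> y \<in>\<^sub>M R \<Longrightarrow> z \<in>\<^sub>M R \<Longrightarrow> x \<prec> y \<Longrightarrow> z \<oplus> x \<prec> z \<oplus> y"
  using plus_right_mono plus_comm by metis
lemma plus_leq_mono: "x \<in>\<^sub>M R \<Longrightarrow> y \<in>\<^sub>M R \<Longrightarrow> z \<in>\<^sub>M R \<Longrightarrow> w \<in>\<^sub>M R \<Longrightarrow> x \<preceq> y \<Longrightarrow> z \<preceq> w \<Longrightarrow> x \<oplus> z \<preceq> y \<oplus> w"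
  unfolding leq_def using plus_left_mono plus_right_mono less_trans plus_closed by metis
lemma plus_less_cancel: "x \<in>\<^sub>M R \<Longrightarrow> y \<in>\<^sub>M R \<Longrightarrow> z \<in>\<^sub>M R \<Longrightarrow> x \<oplus> z \<prec> y \<oplus> z \<longleftrightarrow> x \<prec> y"
  using plus_right_mono less_linear less_irrefl less_trans plus_closed by metis
lemma plus_less_mono: "x \<in>\<^sub>M R \<Longrightarrow> y \<in>\<^sub>M R \<Longrightarrow> z \<in>\<^sub>M R \<Longrightarrow> w \<in>\<^sub>M R \<Longrightarrow> x \<prec> y \<Longrightarrow> z \<prec> w \<Longrightarrow> x \<oplus> z \<prec> y \<oplus> w"
  by (rule less_trans[where y = "y \<oplus> z"]) (auto intro: plus_left_mono plus_right_mono)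

definition zer :: 'a where "zer = (SOME z. z \<in>\<^sub>M R \<and> (\<forall>x. x \<in>\<^sub>M R \<longrightarrow> z \<oplus> x = x))"

lemma zero_one_ex: "\<exists>z one. z \<in>\<^sub>M R \<and> one \<in>\<^sub>M R \<and> z \<noteq> one \<and>
   (\<forall>x. x \<in>\<^sub>M R \<longrightarrow> z \<oplus> x = x \<and> mul \<cdot> pair one x = x \<and> (\<exists>y. y \<in>\<^sub>M R \<and> x \<oplus> y = z) \<and>
      (x \<noteq> z \<longrightarrow> (\<exists>y. y \<in>\<^sub>M R \<and> mul \<cdot> pair x y = one)))"
proof -
  obtain z one where *: "z \<in>\<^sub>M R" "one \<in>\<^sub>M R" "z \<noteq> one"
      "\<forall>x. x \<in>\<^sub>M R \<longrightarrow> binop add z x = x \<and> binop mul one x = x \<and>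
           (\<exists>y. y \<in>\<^sub>M R \<and> binop add x y = z) \<and>
           (x \<noteq> z \<longrightarrow> (\<exists>y. y \<in>\<^sub>M R \<and> binop mul x y = one))"
    using field_zero_one by (elim exE conjE) (rule that; assumption)
  show ?thesis
    unfolding plus_def
    using * binop(1)[OF binops(1)] binop(1)[OF binops(2)]
    by (intro exI[of _ z] exI[of _ one]) (metis (no_types, opaque_lifting))
qed

lemma zer: "zer \<in>\<^sub>M R" "x \<in>\<^sub>M R \<Longrightarrow> zer \<oplus> x = x"
proof -
  have "zer \<in>\<^sub>M R \<and> (\<forall>x. x \<in>\<^sub>M R \<longrightarrow> zer \<oplus> x = x)"
    unfolding zer_def by (rule someI_ex) (use zero_one_ex in blast)
  then show "zer \<in>\<^sub>M R" "x \<in>\<^sub>M R \<Longrightarrow> zer \<oplus> x = x" by auto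
qed

lemma zer_unique: "z \<in>\<^sub>M R \<Longrightarrow> z \<oplus> zer = zer \<Longrightarrow> z = zer"
  using zer plus_comm[of z zer] by simp

lemma zer_right: "x \<in>\<^sub>M R \<Longrightarrow> x \<oplus> zer = x"
  using zer plus_comm[of x zer] by simp

lemma neg_ex:
  assumes "x \<in>\<^sub>M R"
  shows "\<exists>y. y \<in>\<^sub>M R \<and> x \<oplus> y = zer"
proof -
  obtain z y where "z \<in>\<^sub>M R" "z \<oplus> zer = zer" "y \<in>\<^sub>M R" "x \<oplus> y = z"
    using zero_one_ex assms zer by metis
  then show ?thesis using zer_unique by blast
qed

lemma diff_ex:
  assumes "x \<in>\<^sub>M R" "y \<in>\<^sub>M R"
  obtains d where "d \<in>\<^sub>M R" "d \<oplus> x = y"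
proof -
  obtain n where n: "n \<in>\<^sub>M R" "x \<oplus> n = zer" using neg_ex assms by blast
  have "(y \<oplus> n) \<oplus> x = y"
    using n assms plus_assoc[of y n x] plus_comm[of n x] zer_right by simp
  with n assms show ?thesis by (intro that[of "y \<oplus> n"]) auto
qed

text \<open>Multiplication serves to divide by two. The order excludes
  \<open>one \<oplus> one = z\<close>, so that this sum has an inverse.\<close>

lemma half_ex:
  assumes x: "x \<in>\<^sub>M R"
  shows "\<exists>h. h \<in>\<^sub>M R \<and> h \<oplus> h = x"
proof -
  obtain z one where 1: "z \<in>\<^sub>M R" "one \<in>\<^sub>M R" "z \<noteq> one" and 2:
    "\<forall>x. x \<in>\<^sub>M R \<longrightarrow> z \<oplus> x = x \<and> mul \<cdot> pair one x = x \<and> (\<exists>y. y \<in>\<^sub>M R \<and> x \<oplus> y = z) \<and>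
      (x \<noteq> z \<longrightarrow> (\<exists>y. y \<in>\<^sub>M R \<and> mul \<cdot> pair x y = one))"
    using zero_one_ex by (elim exE conjE) (rule that; assumption)
  have 3: "z \<oplus> x = x" "mul \<cdot> pair one x = x" "x \<noteq> z \<Longrightarrow> \<exists>y. y \<in>\<^sub>M R \<and> mul \<cdot> pair x y = one"
    if "x \<in>\<^sub>M R" for x using 2[rule_format, OF that] by simp_all
  note z = 1 3
  have "one \<oplus> one \<noteq> z"
  proof
    assume eq: "one \<oplus> one = z"
    have "one \<prec> z \<or> z \<prec> one" using less_linear z by blast
    then show False
    proof
      assume l: "one \<prec> z"
      then have "one \<oplus> one \<prec> z \<oplus> one" using z by (intro plus_right_mono)
      with l eq z show False using less_trans less_irrefl by metis
    next
      assume l: "z \<prec> one"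
      then have "z \<oplus> one \<prec> one \<oplus> one" using z by (intro plus_right_mono)
      with l eq z show False using less_trans less_irrefl by metis
    qed
  qed
  then obtain i where i: "i \<in>\<^sub>M R" "mul \<cdot> pair (one \<oplus> one) i = one"
    using z(6)[OF plus_closed[OF z(2) z(2)]] by blast
  have bm: "binop mul x y = mul \<cdot> pair x y" "mul \<cdot> pair x y \<in>\<^sub>M R" if "x \<in>\<^sub>M R" "y \<in>\<^sub>M R" for x y
    using binop[OF binops(2) that] by auto
  have ba: "binop add x y = x \<oplus> y" if "x \<in>\<^sub>M R" "y \<in>\<^sub>M R" for x y
    unfolding plus_def by (rule binop(1)[OF binops(1) that])
  have "binop mul x y = binop mul y x \<and>
     binop mul x (binop add y z) = binop add (binop mul x y) (binop mul x z)"
    if "x \<in>\<^sub>M R" "y \<in>\<^sub>M R" "z \<in>\<^sub>M R" for x y z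
    using field_ring[OF that] by blast
  then have m: "mul \<cdot> pair x y = mul \<cdot> pair y x"
     "mul \<cdot> pair x (y \<oplus> z) = mul \<cdot> pair x y \<oplus> mul \<cdot> pair x z"
    if "x \<in>\<^sub>M R" "y \<in>\<^sub>M R" "z \<in>\<^sub>M R" for x y z
    using that by (simp_all add: bm ba)
  have "mul \<cdot> pair x i \<oplus> mul \<cdot> pair x i = mul \<cdot> pair x (i \<oplus> i)"
    using m x i by simp
  also have "i \<oplus> i = mul \<cdot> pair i (one \<oplus> one)"
    using m(2)[of i one one] m(1)[of i one] z i by simp
  also have "\<dots> = one" using m(1)[of i "one \<oplus> one"] i z by simp
  also have "mul \<cdot> pair x one = x" using m(1)[of x one] x z by simp
  finally show ?thesis using bm(2)[OF x i(1)] by blast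
qed

section \<open>Suprema and halves\<close>

definition is_lub :: "'a \<Rightarrow> 'a \<Rightarrow> bool" where
  "is_lub S u \<longleftrightarrow> u \<in>\<^sub>M R \<and> (\<forall>x. x \<in>\<^sub>M S \<longrightarrow> x \<preceq> u) \<and>
    (\<forall>w. w \<in>\<^sub>M R \<longrightarrow> (\<forall>x. x \<in>\<^sub>M S \<longrightarrow> x \<preceq> w) \<longrightarrow> u \<preceq> w)"

lemma is_lub_ex:
  assumes "S \<subseteq>\<^sub>M R" "a \<in>\<^sub>M S" "b \<in>\<^sub>M R" "\<forall>x. x \<in>\<^sub>M S \<longrightarrow> x \<preceq> b"
  shows "\<exists>u. is_lub S u"
proof -
  have ub: "is_upper_bound R lt S u \<longleftrightarrow> u \<in>\<^sub>M R \<and> (\<forall>x. x \<in>\<^sub>M S \<longrightarrow> x \<preceq> u)" for u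
    unfolding is_upper_bound_def maps_iff leq_def less_def by simp
  have "\<not> is_empty S" using assms(2) unfolding is_empty_def by blast
  moreover have "\<exists>u. is_upper_bound R lt S u" unfolding ub using assms(3,4) by blast
  ultimately have "\<exists>u. is_upper_bound R lt S u \<and> (\<forall>w. is_upper_bound R lt S w \<longrightarrow> u \<preceq> w)"
    using reals[unfolded is_reals_def maps_iff less_def[symmetric] leq_def[symmetric],
        THEN conjunct2, rule_format, OF assms(1)] by (simp only: simp_thms)
  then show ?thesis unfolding ub is_lub_def by (elim ex_forward) simp
qed

lemma is_lub_unique:
  assumes "is_lub S u" "is_lub S v"
  shows "u = v"
proof -
  have "u \<in>\<^sub>M R" "v \<in>\<^sub>M R" "u \<preceq> v" "v \<preceq> u" using assms unfolding is_lub_def by simp_all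
  then show ?thesis using not_less[of u v] unfolding leq_def by auto
qed

definition sup :: "'a \<Rightarrow> 'a" where
  "sup S = desc (is_lub S)"

lemma dtm_sup [dfn]: "dtm s \<Longrightarrow> dtm (\<lambda>e. sup (s e))"
  by (rule dtm_subst1) (unfold sup_def is_lub_def, intro dfn)

lemma sup:
  assumes "S \<subseteq>\<^sub>M R" "a \<in>\<^sub>M S" "b \<in>\<^sub>M R" "\<forall>x. x \<in>\<^sub>M S \<longrightarrow> x \<preceq> b"
  shows "sup S \<in>\<^sub>M R" "x \<in>\<^sub>M S \<Longrightarrow> x \<preceq> sup S"
    "w \<in>\<^sub>M R \<Longrightarrow> (\<And>x. x \<in>\<^sub>M S \<Longrightarrow> x \<preceq> w) \<Longrightarrow> sup S \<preceq> w"
proof -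
  obtain u where u: "is_lub S u" using is_lub_ex[OF assms] by blast
  then have "sup S = u"
    unfolding sup_def using is_lub_unique by (intro desc_eq) blast+
  with u have "is_lub S (sup S)" by simp
  then show "sup S \<in>\<^sub>M R" "x \<in>\<^sub>M S \<Longrightarrow> x \<preceq> sup S"
    "w \<in>\<^sub>M R \<Longrightarrow> (\<And>x. x \<in>\<^sub>M S \<Longrightarrow> x \<preceq> w) \<Longrightarrow> sup S \<preceq> w"
    unfolding is_lub_def by simp_all
qed

definition half :: "'a \<Rightarrow> 'a" where "half x = desc (\<lambda>h. h \<in>\<^sub>M R \<and> h \<oplus> h = x)"

lemma dtm_half [dfn]: "dtm s \<Longrightarrow> dtm (\<lambda>e. half (s e))"
  by (rule dtm_subst1) (unfold half_def, intro dfn)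

lemma half:
  assumes x: "x \<in>\<^sub>M R"
  shows "half x \<in>\<^sub>M R" "half x \<oplus> half x = x"
proof -
  obtain h where h: "h \<in>\<^sub>M R" "h \<oplus> h = x" using half_ex[OF x] by blast
  have "half x = h"
    unfolding half_def
  proof (rule desc_eq)
    fix k assume k: "k \<in>\<^sub>M R \<and> k \<oplus> k = x"
    show "k = h"
      using less_linear[of k h] plus_less_mono[of k h k h] plus_less_mono[of h k h k] k h x less_irrefl[of x]
      by auto
  qed (use h in auto)
  with h show "half x \<in>\<^sub>M R" "half x \<oplus> half x = x" by auto
qed

lemma half_pos:
  assumes "x \<in>\<^sub>M R" "zer \<prec> x"
  shows "zer \<prec> half x"
proof (rule ccontr)
  assume "\<not> zer \<prec> half x"
  then have "half x \<preceq> zer" using not_less half assms zer by blast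
  then have "half x \<oplus> half x \<preceq> zer \<oplus> zer" using half assms zer by (intro plus_leq_mono)
  with assms half zer show False using less_leq_trans less_irrefl by metis
qed

lemma half_less:
  assumes "x \<in>\<^sub>M R" "zer \<prec> x"
  shows "half x \<prec> x"
  using plus_right_mono[of zer "half x" "half x"] half half_pos assms zer by simp

section \<open>A rapidly decreasing sequence of positive weights\<close>

definition base :: 'a where "base = (SOME x. x \<in>\<^sub>M R \<and> zer \<prec> x)"

lemma base: "base \<in>\<^sub>M R" "zer \<prec> base"
proof -
  obtain x where x: "x \<in>\<^sub>M R" "x \<noteq> zer" using zero_one_ex by metis
  obtain y where y: "y \<in>\<^sub>M R" "x \<oplus> y = zer" using neg_ex x by blast
  have "zer \<prec> x \<or> zer \<prec> y"
    using less_linear[OF x(1) zer(1)] plus_right_mono[of x zer y] x y zer by auto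
  then have "\<exists>x. x \<in>\<^sub>M R \<and> zer \<prec> x" using x y by blast
  then have "base \<in>\<^sub>M R \<and> zer \<prec> base" unfolding base_def by (rule someI_ex)
  then show "base \<in>\<^sub>M R" "zer \<prec> base" by auto
qed

text \<open>Quartering makes each weight exceed the sum of all later ones.\<close>

definition weight :: "'a \<Rightarrow> 'a" where "weight n = nrec base (\<lambda>_ x. half (half x)) n"

lemma dtm_weight [dfn]: "dtm s \<Longrightarrow> dtm (\<lambda>e. weight (s e))"
  by (rule dtm_subst1) (unfold weight_def, intro dfn)

lemma weight_emp: "weight emp = base"
  unfolding weight_def by (rule nrec_emp) (intro dfn)
lemma weight_suc: "n \<in>\<^sub>M om \<Longrightarrow> weight (suc n) = half (half (weight n))"
  unfolding weight_def by (rule nrec_suc) (intro dfn)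

lemma weight: "n \<in>\<^sub>M om \<Longrightarrow> weight n \<in>\<^sub>M R \<and> zer \<prec> weight n"
  by (rule om_induct[where n = n], intro dfn) (auto simp: weight_emp weight_suc base half half_pos)

text \<open>Twice a quarter is a half. In this form the fast decrease bounds infinite sums without a
  theory of series.\<close>

lemma weight_double:
  assumes "n \<in>\<^sub>M om"
  shows "weight (suc n) \<oplus> weight (suc n) \<prec> weight n"
  using half(2)[of "half (weight n)"] half_less[of "weight n"] half(1)[of "weight n"] weight[OF assms] weight_suc[OF assms] by simp

lemma weight_suc_less:
  assumes "n \<in>\<^sub>M om"
  shows "weight (suc n) \<prec> weight n"
  using half_less[of "half (weight n)"] half_pos[of "weight n"] half_less[of "weight n"] half(1) weight[OF assms] weight_suc[OF assms] less_trans
  by (metis)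

lemma weight_less:
  assumes "n \<in>\<^sub>M om" "m \<in>\<^sub>M n"
  shows "weight n \<prec> weight m"
proof -
  have m: "m \<in>\<^sub>M om" using om_trans assms by blast
  have "m \<in>\<^sub>M n \<longrightarrow> weight n \<prec> weight m"
  proof (rule om_induct[OF _ assms(1)], intro dfn)
    fix k assume "k \<in>\<^sub>M om" "m \<in>\<^sub>M k \<longrightarrow> weight k \<prec> weight m"
    then show "m \<in>\<^sub>M suc k \<longrightarrow> weight (suc k) \<prec> weight m"
      using weight_suc_less[of k] less_trans weight m by (metis suc_iff suc_om)
  qed simp
  then show ?thesis using assms by blast
qed

lemma weight_inj:
  assumes "m \<in>\<^sub>M om" "n \<in>\<^sub>M om" "weight m = weight n"
  shows "m = n"
  using Ord_linear[of m n] weight_less[of m n] weight_less[of n m] assms less_irrefl weight by (metis om_Ord)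

text \<open>By completeness the lower bounds of all weights have a supremum. If it were positive,
  its double would be larger and still a lower bound, because twice \<open>weight (suc n)\<close> is
  below \<open>weight n\<close>.\<close>

lemma weight_small:
  assumes d: "d \<in>\<^sub>M R" "zer \<prec> d"
  shows "\<exists>n. n \<in>\<^sub>M om \<and> weight n \<prec> d"
proof (rule ccontr)
  assume "\<not> ?thesis"
  then have le: "d \<preceq> weight n" if "n \<in>\<^sub>M om" for n using not_less d weight that by blast
  define S where "S = Sep R (\<lambda>x. \<forall>n. n \<in>\<^sub>M om \<longrightarrow> x \<preceq> weight n)"
  have S: "x \<in>\<^sub>M S \<longleftrightarrow> x \<in>\<^sub>M R \<and> (\<forall>n. n \<in>\<^sub>M om \<longrightarrow> x \<preceq> weight n)" for x
    unfolding S_def by (rule Sep_iff) (intro dfn)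
  have dS: "d \<in>\<^sub>M S" using le d S by blast
  have SR: "S \<subseteq>\<^sub>M R" unfolding subset_def using S by blast
  have Sb: "\<forall>x. x \<in>\<^sub>M S \<longrightarrow> x \<preceq> base" unfolding S by (metis weight_emp emp_om)
  note s = sup[OF SR dS base(1) Sb]
  have u: "sup S \<preceq> weight n" if "n \<in>\<^sub>M om" for n
    using s(3)[of "weight n"] S weight that by blast
  have pos: "zer \<prec> sup S"
    using less_leq_trans[OF zer(1) d(1) s(1) d(2) s(2)[OF dS]] .
  have "sup S \<oplus> sup S \<preceq> weight n" if n: "n \<in>\<^sub>M om" for n
  proof -
    have "sup S \<oplus> sup S \<preceq> weight (suc n) \<oplus> weight (suc n)"
      using u[of "suc n"] s(1) weight[of "suc n"] n by (intro plus_leq_mono) auto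
    then show ?thesis
      using leq_less_trans[OF _ _ _ _ weight_double[OF n]] s(1) weight n unfolding leq_def[of _ "weight n"] by auto
  qed
  then have "sup S \<oplus> sup S \<in>\<^sub>M S" using S s(1) by auto
  then have "sup S \<oplus> sup S \<preceq> sup S" by (rule s(2))
  moreover have "zer \<oplus> sup S \<prec> sup S \<oplus> sup S" using pos s(1) zer by (intro plus_right_mono)
  ultimately show False using s(1) zer less_leq_trans less_irrefl by (metis plus_closed)
qed

section \<open>The Archimedean property and separation of reals by countably many tests\<close>

definition mult :: "'a \<Rightarrow> 'a \<Rightarrow> 'a" where "mult n k = nrec zer (\<lambda>_ x. x \<oplus> weight n) k"

lemma dtm_mult [dfn]: "dtm s \<Longrightarrow> dtm t \<Longrightarrow> dtm (\<lambda>e. mult (s e) (t e))"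
  by (rule dtm_subst2) (unfold mult_def, intro dfn)

lemma mult_emp: "mult n emp = zer"
  unfolding mult_def by (rule nrec_emp) (intro dfn)
lemma mult_suc: "k \<in>\<^sub>M om \<Longrightarrow> mult n (suc k) = mult n k \<oplus> weight n"
  unfolding mult_def by (rule nrec_suc) (intro dfn)

lemma mult_R: "k \<in>\<^sub>M om \<Longrightarrow> n \<in>\<^sub>M om \<Longrightarrow> mult n k \<in>\<^sub>M R"
  by (rule om_induct[where n = k], intro dfn) (auto simp: mult_emp mult_suc zer weight)

text \<open>Lowering the supremum of bounded multiples by one \<open>weight n\<close> would still
  leave an upper bound.\<close>

lemma archimedean:
  assumes n: "n \<in>\<^sub>M om" and x: "x \<in>\<^sub>M R"
  shows "\<exists>k. k \<in>\<^sub>M om \<and> x \<prec> mult n k"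
proof (rule ccontr)
  assume "\<not> ?thesis"
  then have le: "mult n k \<preceq> x" if "k \<in>\<^sub>M om" for k using not_less x mult_R n that by blast
  define S where "S = Repl om (mult n)"
  have S: "x \<in>\<^sub>M S \<longleftrightarrow> (\<exists>k. k \<in>\<^sub>M om \<and> x = mult n k)" for x
    unfolding S_def by (rule Repl_iff) (intro dfn)
  have SR: "S \<subseteq>\<^sub>M R" unfolding subset_def S using mult_R n by auto
  have Sb: "\<forall>y. y \<in>\<^sub>M S \<longrightarrow> y \<preceq> x" unfolding S using le by auto
  have "mult n emp \<in>\<^sub>M S" using S by blast
  note s = sup[OF SR this x Sb]
  obtain w where w: "w \<in>\<^sub>M R" "w \<oplus> weight n = sup S" using diff_ex[of "weight n" "sup S"] weight n s(1) by blast
  have "sup S \<preceq> w"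
  proof (rule s(3)[OF w(1)])
    fix y assume "y \<in>\<^sub>M S"
    then obtain k where k: "k \<in>\<^sub>M om" "y = mult n k" using S by blast
    have "mult n k \<oplus> weight n \<in>\<^sub>M S" using S k mult_suc by (metis suc_om)
    then have "mult n k \<oplus> weight n \<preceq> w \<oplus> weight n" using s(2) w by simp
    then show "y \<preceq> w"
      unfolding k(2) using not_less plus_less_cancel[of w "mult n k" "weight n"] w(1) mult_R[OF k(1) n] weight[OF n] by (metis plus_closed)
  qed
  moreover have "zer \<oplus> w \<prec> weight n \<oplus> w" using weight n w zer by (intro plus_right_mono) auto
  ultimately show False using zer w s(1) less_leq_trans less_irrefl plus_comm weight n by metis
qed

text \<open>The translation by \<open>mult emp m\<close> makes both numbers positive, so that natural multiples suffice.\<close>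

lemma separate:
  assumes r: "r \<in>\<^sub>M R" "r' \<in>\<^sub>M R" "r \<prec> r'"
  shows "\<exists>n k m. n \<in>\<^sub>M om \<and> k \<in>\<^sub>M om \<and> m \<in>\<^sub>M om \<and> mult n k \<prec> r' \<oplus> mult emp m \<and> \<not> mult n k \<prec> r \<oplus> mult emp m"
proof -
  obtain d where d: "d \<in>\<^sub>M R" "d \<oplus> r = r'" using diff_ex r by blast
  have "zer \<prec> d" using plus_less_cancel[of zer d r] d r zer by simp
  then obtain n where n: "n \<in>\<^sub>M om" "weight n \<prec> d" using weight_small d by blast
  obtain s where s: "s \<in>\<^sub>M R" "s \<oplus> r = zer" using diff_ex r zer by blast
  obtain m where m: "m \<in>\<^sub>M om" "s \<prec> mult emp m" using archimedean[of emp s] s by auto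
  have gm: "mult emp m \<in>\<^sub>M R" using mult_R m by auto
  let ?t = "r \<oplus> mult emp m"
  have t: "?t \<in>\<^sub>M R" using r gm by auto
  have pos: "zer \<prec> ?t" using plus_right_mono[of s "mult emp m" r] s gm r m plus_comm by metis
  \<comment> \<open>The multiples of \<open>weight n\<close> form a grid of mesh less than
    \<open>d\<close>; its first point not below \<open>?t\<close> is therefore below
    \<open>?t \<oplus> d\<close>.\<close>
  define P where "P k \<longleftrightarrow> k \<in>\<^sub>M om \<and> \<not> mult n k \<prec> ?t" for k
  have P: "dfn (\<lambda>e. P (e 0))" unfolding P_def by (intro dfn)
  obtain k0 where k0: "k0 \<in>\<^sub>M om" "?t \<prec> mult n k0" using archimedean[OF n(1) t] by blast
  then have "P k0" unfolding P_def using less_trans less_irrefl t mult_R n by blast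
  note l = least[OF P om_Ord[OF k0(1)] this]
  let ?k = "least P"
  have k: "?k \<in>\<^sub>M om" "\<not> mult n ?k \<prec> ?t" using l(2) unfolding P_def by auto
  have "?k \<noteq> emp" using k pos mult_emp by metis
  then obtain j where j: "j \<in>\<^sub>M om" "?k = suc j" using om_cases[OF k(1)] by blast
  then have "mult n j \<prec> ?t" using l(3)[of j] unfolding P_def by simp
  then have "mult n j \<oplus> weight n \<prec> ?t \<oplus> d" using plus_less_mono n d t mult_R j weight by metis
  also have "?t \<oplus> d = r' \<oplus> mult emp m"
    using d r gm by (metis plus_assoc plus_comm plus_left_comm)
  finally have "mult n ?k \<prec> r' \<oplus> mult emp m" using mult_suc j by simp
  with k n m show ?thesis by blast
qed

text \<open>Sums start at \<open>base \<oplus> base\<close> so that no code of a set is itself a weight; weights then serve as tags in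
  the names of boxes.\<close>

definition partial_sum :: "'a \<Rightarrow> 'a \<Rightarrow> 'a" where
  "partial_sum A n = nrec (base \<oplus> base) (\<lambda>k x. if k \<in>\<^sub>M A then x \<oplus> weight k else x) n"

lemma dtm_partial_sum [dfn]: "dtm s \<Longrightarrow> dtm t \<Longrightarrow> dtm (\<lambda>e. partial_sum (s e) (t e))"
  by (rule dtm_subst2) (unfold partial_sum_def, intro dfn)

lemma partial_sum_emp: "partial_sum A emp = base \<oplus> base"
  unfolding partial_sum_def by (rule nrec_emp) (intro dfn)
lemma partial_sum_suc: "n \<in>\<^sub>M om \<Longrightarrow> partial_sum A (suc n) = (if n \<in>\<^sub>M A then partial_sum A n \<oplus> weight n else partial_sum A n)"
  unfolding partial_sum_def by (rule nrec_suc) (intro dfn)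

lemma partial_sum_R: "n \<in>\<^sub>M om \<Longrightarrow> partial_sum A n \<in>\<^sub>M R"
  by (rule om_induct[where n = n], intro dfn) (auto simp: partial_sum_emp partial_sum_suc base weight)

lemma partial_sum_suc_leq:
  assumes "n \<in>\<^sub>M om"
  shows "partial_sum A n \<preceq> partial_sum A (suc n)" "partial_sum A (suc n) \<preceq> partial_sum A n \<oplus> weight n"
proof -
  have "partial_sum A n \<prec> partial_sum A n \<oplus> weight n"
    using plus_left_mono[of zer "weight n" "partial_sum A n"] weight partial_sum_R zer zer_right assms by simp
  then show "partial_sum A n \<preceq> partial_sum A (suc n)" "partial_sum A (suc n) \<preceq> partial_sum A n \<oplus> weight n"
    using assms by (auto simp: partial_sum_suc leq_def)
qed

lemma partial_sum_mono:
  assumes "n \<in>\<^sub>M om" "m \<in>\<^sub>M suc n"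
  shows "partial_sum A m \<preceq> partial_sum A n"
proof -
  have m: "m \<in>\<^sub>M om" using om_trans assms by auto
  have "m \<in>\<^sub>M suc n \<longrightarrow> partial_sum A m \<preceq> partial_sum A n"
  proof (rule om_induct[OF _ assms(1)], intro dfn)
    fix k assume "k \<in>\<^sub>M om" "m \<in>\<^sub>M suc k \<longrightarrow> partial_sum A m \<preceq> partial_sum A k"
    then show "m \<in>\<^sub>M suc (suc k) \<longrightarrow> partial_sum A m \<preceq> partial_sum A (suc k)"
      using partial_sum_suc_leq(1)[of k A] leq_trans partial_sum_R m by (metis suc_iff suc_om leq_refl)
  qed simp
  then show ?thesis using assms by blast
qed

text \<open>Adding \<open>weight n\<close> twice turns the increasing partial sums into decreasing
  upper bounds, since one more term costs at most \<open>weight n\<close> and the new margin is less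
  than \<open>weight n\<close>. For \<open>n\<close> below \<open>k\<close>, monotonicity
  suffices.\<close>

lemma partial_sum_bound:
  assumes k: "k \<in>\<^sub>M om" and n: "n \<in>\<^sub>M om"
  shows "partial_sum A n \<preceq> partial_sum A k \<oplus> (weight k \<oplus> weight k)"
proof -
  let ?T = "\<lambda>n. partial_sum A n \<oplus> (weight n \<oplus> weight n)"
  have TR: "?T n \<in>\<^sub>M R" if "n \<in>\<^sub>M om" for n using partial_sum_R weight that by auto
  have step: "?T (suc n) \<preceq> ?T n" if n: "n \<in>\<^sub>M om" for n
  proof -
    have "?T (suc n) \<preceq> (partial_sum A n \<oplus> weight n) \<oplus> weight n"
      using partial_sum_suc_leq(2)[OF n] weight_double[OF n] weight partial_sum_R n
      by (intro plus_leq_mono) (auto simp: leq_def)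
    then show ?thesis using plus_assoc weight partial_sum_R n by simp
  qed
  have le: "partial_sum A n \<preceq> ?T n" if "n \<in>\<^sub>M om" for n
  proof -
    have "zer \<prec> weight n \<oplus> weight n" using plus_less_mono[of zer "weight n" zer "weight n"] weight[OF that] zer by simp
    then show ?thesis
      using plus_left_mono[of zer "weight n \<oplus> weight n" "partial_sum A n"] weight partial_sum_R zer zer_right that by (auto simp: leq_def)
  qed
  have "\<not> n \<in>\<^sub>M k \<longrightarrow> ?T n \<preceq> ?T k"
  proof (rule om_induct[OF _ n], intro dfn)
    show "\<not> emp \<in>\<^sub>M k \<longrightarrow> ?T emp \<preceq> ?T k"
      using emp_mem_suc[OF k] by auto
    fix j assume j: "j \<in>\<^sub>M om" "\<not> j \<in>\<^sub>M k \<longrightarrow> ?T j \<preceq> ?T k"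
    show "\<not> suc j \<in>\<^sub>M k \<longrightarrow> ?T (suc j) \<preceq> ?T k"
    proof (cases "j \<in>\<^sub>M k")
      case True
      then have "suc j \<in>\<^sub>M suc k" using suc_mem_mono k by simp
      then show ?thesis by auto
    next
      case False
      then show ?thesis
        using j leq_trans[OF TR[of "suc j"] TR[OF j(1)] TR[OF k] step[OF j(1)]] by simp
    qed
  qed
  moreover have "partial_sum A n \<preceq> ?T k" if "n \<in>\<^sub>M k"
    using partial_sum_mono[of k n A] le[OF k] leq_trans partial_sum_R TR k n that by (metis suc_iff)
  ultimately show ?thesis using le[OF n] leq_trans partial_sum_R TR k n by metis
qed

definition real_of :: "'a \<Rightarrow> 'a" where "real_of A = sup (Repl om (partial_sum A))"

lemma dtm_real_of [dfn]: "dtm s \<Longrightarrow> dtm (\<lambda>e. real_of (s e))"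
  by (rule dtm_subst1) (unfold real_of_def, intro dfn)

lemma real_of:
  shows "real_of A \<in>\<^sub>M R" "n \<in>\<^sub>M om \<Longrightarrow> partial_sum A n \<preceq> real_of A"
    "w \<in>\<^sub>M R \<Longrightarrow> (\<And>n. n \<in>\<^sub>M om \<Longrightarrow> partial_sum A n \<preceq> w) \<Longrightarrow> real_of A \<preceq> w"
proof -
  let ?S = "Repl om (partial_sum A)"
  have S: "x \<in>\<^sub>M ?S \<longleftrightarrow> (\<exists>n. n \<in>\<^sub>M om \<and> x = partial_sum A n)" for x
    by (rule Repl_iff) (intro dfn)
  have 1: "?S \<subseteq>\<^sub>M R" unfolding subset_def S using partial_sum_R by auto
  have 2: "partial_sum A emp \<in>\<^sub>M ?S" using S by blast
  have 3: "partial_sum A emp \<oplus> (weight emp \<oplus> weight emp) \<in>\<^sub>M R" using partial_sum_R weight by auto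
  have 4: "\<forall>x. x \<in>\<^sub>M ?S \<longrightarrow> x \<preceq> partial_sum A emp \<oplus> (weight emp \<oplus> weight emp)" unfolding S using partial_sum_bound by auto
  note s = sup[OF 1 2 3 4, folded real_of_def]
  show "real_of A \<in>\<^sub>M R" "n \<in>\<^sub>M om \<Longrightarrow> partial_sum A n \<preceq> real_of A"
    "w \<in>\<^sub>M R \<Longrightarrow> (\<And>n. n \<in>\<^sub>M om \<Longrightarrow> partial_sum A n \<preceq> w) \<Longrightarrow> real_of A \<preceq> w"
    using s(1) s(2)[of "partial_sum A n"] s(3)[of w] unfolding S by auto
qed

lemma real_of_neq_weight: "n \<in>\<^sub>M om \<Longrightarrow> real_of A \<noteq> weight n"
proof -
  assume n: "n \<in>\<^sub>M om"
  have "weight n \<preceq> base"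
  proof (cases "n = emp")
    case False
    then have "emp \<in>\<^sub>M n" using emp_mem_suc[OF n] by auto
    then show ?thesis using weight_less[OF n, of emp] weight_emp by (simp add: leq_def)
  qed (simp add: weight_emp)
  moreover have "base \<prec> base \<oplus> base" using plus_right_mono[of zer base base] base zer by simp
  moreover have "base \<oplus> base \<preceq> real_of A" using real_of(2)[of emp] partial_sum_emp by simp
  ultimately show ?thesis
    using leq_less_trans less_leq_trans less_irrefl weight n real_of(1) base plus_closed by metis
qed

text \<open>At the first difference \<open>k\<close>, the set \<open>A\<close> gains
  \<open>weight k\<close>, while everything \<open>B\<close> can still gain is at most twice
  \<open>weight (suc k)\<close>.\<close>

lemma real_of_less:
  assumes k: "k \<in>\<^sub>M om" "k \<in>\<^sub>M A" "\<not> k \<in>\<^sub>M B" and eq: "\<And>j. j \<in>\<^sub>M k \<Longrightarrow> j \<in>\<^sub>M A \<longleftrightarrow> j \<in>\<^sub>M B"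
  shows "real_of B \<prec> real_of A"
proof -
  have "j \<in>\<^sub>M suc k \<longrightarrow> partial_sum A j = partial_sum B j" if "j \<in>\<^sub>M om" for j
  proof (rule om_induct[OF _ that], intro dfn)
    fix j assume j: "j \<in>\<^sub>M om" "j \<in>\<^sub>M suc k \<longrightarrow> partial_sum A j = partial_sum B j"
    show "suc j \<in>\<^sub>M suc k \<longrightarrow> partial_sum A (suc j) = partial_sum B (suc j)"
    proof
      assume "suc j \<in>\<^sub>M suc k"
      then have "j \<in>\<^sub>M k" using Ord_mem_trans[OF om_Ord[OF k(1)], of j "suc j"] by simp
      then show "partial_sum A (suc j) = partial_sum B (suc j)" using j eq[of j] by (simp add: partial_sum_suc)
    qed
  qed (simp add: partial_sum_emp)
  then have eqk: "partial_sum A k = partial_sum B k" using k by simp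
  have "real_of B \<preceq> partial_sum B (suc k) \<oplus> (weight (suc k) \<oplus> weight (suc k))"
    using real_of(3) partial_sum_bound[of "suc k"] k partial_sum_R weight by (metis suc_om plus_closed)
  moreover have "partial_sum B (suc k) \<oplus> (weight (suc k) \<oplus> weight (suc k)) \<prec> partial_sum A k \<oplus> weight k"
    using k weight_double[OF k(1)] partial_sum_R weight eqk by (auto simp: partial_sum_suc intro!: plus_left_mono)
  moreover have "partial_sum A k \<oplus> weight k \<preceq> real_of A"
    using real_of(2)[of "suc k" A] k by (simp add: partial_sum_suc)
  moreover have R: "partial_sum B (suc k) \<oplus> (weight (suc k) \<oplus> weight (suc k)) \<in>\<^sub>M R" "partial_sum A k \<oplus> weight k \<in>\<^sub>M R"
    using partial_sum_R weight k by auto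
  ultimately show ?thesis
    by (intro less_leq_trans[OF real_of(1) R(2) real_of(1)] leq_less_trans[OF real_of(1) R])
qed

lemma real_of_inj:
  assumes "A \<subseteq>\<^sub>M om" "B \<subseteq>\<^sub>M om" "real_of A = real_of B"
  shows "A = B"
proof (rule ccontr)
  assume "A \<noteq> B"
  then obtain n where n: "n \<in>\<^sub>M om" "(n \<in>\<^sub>M A) \<noteq> (n \<in>\<^sub>M B)"
    using ext[of A B] assms(1,2) unfolding subset_def by blast
  define P where "P k \<longleftrightarrow> k \<in>\<^sub>M om \<and> (k \<in>\<^sub>M A) \<noteq> (k \<in>\<^sub>M B)" for k
  have P: "dfn (\<lambda>e. P (e 0))" unfolding P_def by (intro dfn)
  have "P n" using n unfolding P_def by blast
  note l = least[OF P om_Ord[OF n(1)] this]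
  have k: "least P \<in>\<^sub>M om" "(least P \<in>\<^sub>M A) \<noteq> (least P \<in>\<^sub>M B)" using l(2) unfolding P_def by auto
  have eq: "j \<in>\<^sub>M A \<longleftrightarrow> j \<in>\<^sub>M B" if "j \<in>\<^sub>M least P" for j
    using l(3)[OF that] om_trans[OF k(1) that] unfolding P_def by blast
  show False
    using real_of_less[OF k(1), of A B] real_of_less[OF k(1), of B A] eq k(2) assms(3)
      less_irrefl real_of(1) by metis
qed

section \<open>Coding sequences of reals and naming boxes\<close>

definition configs :: 'a where "configs = funs (om \<times>\<^sub>M om) R"

text \<open>A joint Dedekind cut of all entries: \<open>i\<close> codes a place of the configuration
  and three numbers, and the set records the outcome of the comparison from \<open>separate\<close>
  with these numbers at that place.\<close>

definition below :: "'a \<Rightarrow> 'a" where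
  "below x = Sep om (\<lambda>i. mult (lft (rgt i)) (lft (rgt (rgt i))) \<prec>
     x \<cdot> pair (lft (lft i)) (rgt (lft i)) \<oplus> mult emp (rgt (rgt (rgt i))))"

lemma below_iff: "i \<in>\<^sub>M below x \<longleftrightarrow> i \<in>\<^sub>M om \<and> mult (lft (rgt i)) (lft (rgt (rgt i))) \<prec>
     x \<cdot> pair (lft (lft i)) (rgt (lft i)) \<oplus> mult emp (rgt (rgt (rgt i)))"
  unfolding below_def by (rule Sep_iff) (intro dfn)

lemma dtm_below [dfn]: "dtm s \<Longrightarrow> dtm (\<lambda>e. below (s e))"
  by (rule dtm_subst1) (unfold below_def, intro dfn)

definition code :: "'a \<Rightarrow> 'a" where "code x = real_of (below x)"

lemma dtm_code [dfn]: "dtm s \<Longrightarrow> dtm (\<lambda>e. code (s e))"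
  unfolding code_def by (intro dfn)

lemma configs_app: "x \<in>\<^sub>M configs \<Longrightarrow> q \<in>\<^sub>M om \<Longrightarrow> n \<in>\<^sub>M om \<Longrightarrow> x \<cdot> pair q n \<in>\<^sub>M R"
  unfolding configs_def by (rule funD(1)[where a = "om \<times>\<^sub>M om"]) simp_all

lemma configs_ext:
  assumes "x \<in>\<^sub>M configs" "y \<in>\<^sub>M configs" "\<And>q n. q \<in>\<^sub>M om \<Longrightarrow> n \<in>\<^sub>M om \<Longrightarrow> x \<cdot> pair q n = y \<cdot> pair q n"
  shows "x = y"
  using assms unfolding configs_def by (intro fun_ext[of x "om \<times>\<^sub>M om" R y R]) (auto simp: prod_iff)

lemma code_R: "code x \<in>\<^sub>M R"
  unfolding code_def by (rule real_of)

text \<open>Two different entries are told apart by some test, and the number coding this place and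
  test lies in only one of the two sets.\<close>

lemma code_inj:
  assumes "x \<in>\<^sub>M configs" "y \<in>\<^sub>M configs" "code x = code y"
  shows "x = y"
proof (rule configs_ext[OF assms(1,2)], rule ccontr)
  fix q n assume q: "q \<in>\<^sub>M om" "n \<in>\<^sub>M om" and neq: "x \<cdot> pair q n \<noteq> y \<cdot> pair q n"
  have sub: "below x \<subseteq>\<^sub>M om" for x unfolding subset_def below_iff by blast
  have eq: "below x = below y"
    by (rule real_of_inj[OF sub sub assms(3)[unfolded code_def]])
  have no: False if h: "x \<in>\<^sub>M configs" "y \<in>\<^sub>M configs" "below x = below y" "x \<cdot> pair q n \<prec> y \<cdot> pair q n" for x y
  proof -
    obtain a k m where a: "a \<in>\<^sub>M om" "k \<in>\<^sub>M om" "m \<in>\<^sub>M om"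
        "mult a k \<prec> y \<cdot> pair q n \<oplus> mult emp m" "\<not> mult a k \<prec> x \<cdot> pair q n \<oplus> mult emp m"
      using separate[OF configs_app[OF h(1) q] configs_app[OF h(2) q] h(4)] by blast
    obtain i1 where i1: "i1 \<in>\<^sub>M om" "lft i1 = q" "rgt i1 = n" using lft_rgt_surj[OF q] by blast
    obtain i2 where i2: "i2 \<in>\<^sub>M om" "lft i2 = k" "rgt i2 = m" using lft_rgt_surj[OF a(2,3)] by blast
    obtain i3 where i3: "i3 \<in>\<^sub>M om" "lft i3 = a" "rgt i3 = i2" using lft_rgt_surj[OF a(1) i2(1)] by blast
    obtain i where i: "i \<in>\<^sub>M om" "lft i = i1" "rgt i = i3" using lft_rgt_surj[OF i1(1) i3(1)] by blast
    have "i \<in>\<^sub>M below y" "\<not> i \<in>\<^sub>M below x"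
      unfolding below_iff i(2,3) i3(2,3) i2(2,3) i1(2,3) using i(1) a(4,5) by blast+
    with h(3) show False by simp
  qed
  show False
    using less_linear[OF configs_app[OF assms(1) q] configs_app[OF assms(2) q]] neq
      no[OF assms(1,2) eq] no[OF assms(2,1) eq[symmetric]] by blast
qed

text \<open>The configurations are stored by their codes and the two numbers by weights, which are
  never codes. All indices of the pair \<open>(p, n)\<close> are included, so none has to be singled
  out.\<close>

definition box :: "'a \<Rightarrow> 'a \<Rightarrow> 'a \<Rightarrow> 'a" where
  "box W p n = Repl W code \<union>\<^sub>M Repl (Sep om (\<lambda>i. lft i = p \<and> rgt i = n)) weight"

lemma dtm_box [dfn]: "dtm s \<Longrightarrow> dtm t \<Longrightarrow> dtm u \<Longrightarrow> dtm (\<lambda>e. box (s e) (t e) (u e))"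
  by (rule dtm_subst3) (unfold box_def, intro dfn)

lemma box_iff: "z \<in>\<^sub>M box W p n \<longleftrightarrow> (\<exists>x. x \<in>\<^sub>M W \<and> z = code x) \<or> (\<exists>i. i \<in>\<^sub>M om \<and> lft i = p \<and> rgt i = n \<and> z = weight i)"
proof -
  have "z \<in>\<^sub>M Repl W code \<longleftrightarrow> (\<exists>x. x \<in>\<^sub>M W \<and> z = code x)"
    by (rule Repl_iff) (intro dfn)
  moreover have "z \<in>\<^sub>M Repl (Sep om (\<lambda>i. lft i = p \<and> rgt i = n)) weight \<longleftrightarrow>
      (\<exists>i. i \<in>\<^sub>M Sep om (\<lambda>i. lft i = p \<and> rgt i = n) \<and> z = weight i)"
    by (rule Repl_iff) (intro dfn)
  moreover have "i \<in>\<^sub>M Sep om (\<lambda>i. lft i = p \<and> rgt i = n) \<longleftrightarrow> i \<in>\<^sub>M om \<and> lft i = p \<and> rgt i = n" for i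
    by (rule Sep_iff) (intro dfn)
  ultimately show ?thesis unfolding box_def by simp
qed

lemma box_Pow: "box W p n \<subseteq>\<^sub>M R"
  unfolding subset_def box_iff using code_R weight by auto

lemma code_neq_weight: "i \<in>\<^sub>M om \<Longrightarrow> code x \<noteq> weight i"
  unfolding code_def by (rule real_of_neq_weight)

lemma box_inj:
  assumes W: "W \<subseteq>\<^sub>M configs" "W' \<subseteq>\<^sub>M configs" and p: "p \<in>\<^sub>M om" "n \<in>\<^sub>M om" and eq: "box W p n = box W' p' n'"
  shows "W = W'" "p = p'" "n = n'"
proof -
  have *: "W \<subseteq>\<^sub>M W'" if h: "W \<subseteq>\<^sub>M configs" "W' \<subseteq>\<^sub>M configs" "box W p n = box W' p' n'" for W W' p n p' n'
    unfolding subset_def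
  proof (intro allI impI)
    fix x assume x: "x \<in>\<^sub>M W"
    then have "code x \<in>\<^sub>M box W' p' n'" unfolding h(3)[symmetric] box_iff by blast
    then obtain y where y: "y \<in>\<^sub>M W'" "code x = code y" unfolding box_iff using code_neq_weight by blast
    have "x = y" by (rule code_inj) (use x y h(1,2) subsetD in blast)+
    then show "x \<in>\<^sub>M W'" using y by simp
  qed
  from *[OF W eq] *[OF W(2,1) eq[symmetric]] show "W = W'" by (intro ext) (auto dest: subsetD)
  \<comment> \<open>The pair has an index because the pairing is onto, so the tag is non-empty. Its
    weight is no code and must lie in the other tag.\<close>
  obtain i where i: "i \<in>\<^sub>M om" "lft i = p" "rgt i = n" using lft_rgt_surj[OF p] by blast
  then have "weight i \<in>\<^sub>M box W' p' n'" unfolding eq[symmetric] box_iff by blast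
  then obtain j where j: "j \<in>\<^sub>M om" "lft j = p'" "rgt j = n'" "weight i = weight j"
    unfolding box_iff using code_neq_weight[OF i(1)] by metis
  with weight_inj[OF i(1) j(1)] i show "p = p'" "n = n'" by auto
qed

section \<open>Guessing from a list of configurations\<close>

text \<open>
  In the following, \<open>f\<close> is a list of configurations of length \<open>a\<close>. The deviations are coded by a
  configuration that is constant along rows, to be compared in the column \<open>emp\<close>.
\<close>

definition agree :: "'a \<Rightarrow> 'a \<Rightarrow> 'a \<Rightarrow> bool" where
  "agree x y q \<longleftrightarrow> (\<exists>m. m \<in>\<^sub>M om \<and> (\<forall>n. n \<in>\<^sub>M om \<longrightarrow> \<not> n \<in>\<^sub>M m \<longrightarrow> x \<cdot> pair q n = y \<cdot> pair q n))"

definition hasrow :: "'a \<Rightarrow> 'a \<Rightarrow> 'a \<Rightarrow> 'a \<Rightarrow> bool" where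
  "hasrow a f y q \<longleftrightarrow> (\<exists>b. b \<in>\<^sub>M a \<and> agree (f \<cdot> b) y q)"

definition rowrep :: "'a \<Rightarrow> 'a \<Rightarrow> 'a \<Rightarrow> 'a \<Rightarrow> 'a" where
  "rowrep a f y q = f \<cdot> least (\<lambda>b. b \<in>\<^sub>M a \<and> agree (f \<cdot> b) y q)"

definition deviation :: "'a \<Rightarrow> 'a \<Rightarrow> 'a \<Rightarrow> 'a \<Rightarrow> 'a" where
  "deviation a f y q = least (\<lambda>m. m \<in>\<^sub>M om \<and>
     (\<forall>n. n \<in>\<^sub>M om \<longrightarrow> \<not> n \<in>\<^sub>M m \<longrightarrow> rowrep a f y q \<cdot> pair q n = y \<cdot> pair q n))"

text \<open>A configuration, so that it can be appended to the list; numbers become reals through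
  the injective \<open>weight\<close>.\<close>

definition deviations :: "'a \<Rightarrow> 'a \<Rightarrow> 'a \<Rightarrow> 'a" where
  "deviations a f y = lam (om \<times>\<^sub>M om) (\<lambda>u. weight (deviation a f y (Fst u)))"

definition col_agree :: "'a \<Rightarrow> 'a \<Rightarrow> bool" where
  "col_agree x y \<longleftrightarrow> (\<exists>m. m \<in>\<^sub>M om \<and> (\<forall>q. q \<in>\<^sub>M om \<longrightarrow> \<not> q \<in>\<^sub>M m \<longrightarrow> x \<cdot> pair q emp = y \<cdot> pair q emp))"

definition hascol :: "'a \<Rightarrow> 'a \<Rightarrow> 'a \<Rightarrow> bool" where
  "hascol a f y \<longleftrightarrow> (\<exists>b. b \<in>\<^sub>M a \<and> col_agree (f \<cdot> b) (deviations a f y))"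

definition colrep :: "'a \<Rightarrow> 'a \<Rightarrow> 'a \<Rightarrow> 'a" where
  "colrep a f y = f \<cdot> least (\<lambda>b. b \<in>\<^sub>M a \<and> col_agree (f \<cdot> b) (deviations a f y))"

definition covered :: "'a \<Rightarrow> 'a \<Rightarrow> 'a \<Rightarrow> bool" where
  "covered a f y \<longleftrightarrow> (\<forall>q. q \<in>\<^sub>M om \<longrightarrow> hasrow a f y q) \<and> hascol a f y"

text \<open>Deviations are meaningful only once every row has a representative. Until then
  \<open>y\<close> itself contributes a missing class of rows.\<close>

definition fresh :: "'a \<Rightarrow> 'a \<Rightarrow> 'a \<Rightarrow> 'a" where
  "fresh a f y = (if \<forall>q. q \<in>\<^sub>M om \<longrightarrow> hasrow a f y q then deviations a f y else y)"

text \<open>The prediction for row \<open>p\<close> need not be the weight of a number; in that case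
  the first clause is vacuous. The second clause never consults row \<open>p\<close> itself.\<close>

definition guess_pos :: "'a \<Rightarrow> 'a \<Rightarrow> 'a \<Rightarrow> 'a \<Rightarrow> 'a" where
  "guess_pos a f y p = least (\<lambda>m. m \<in>\<^sub>M om \<and>
     (\<forall>d. d \<in>\<^sub>M om \<longrightarrow> weight d = colrep a f y \<cdot> pair p emp \<longrightarrow> d \<in>\<^sub>M suc m) \<and>
     (\<forall>q. q \<in>\<^sub>M om \<longrightarrow> q \<noteq> p \<longrightarrow> colrep a f y \<cdot> pair q emp \<noteq> weight (deviation a f y q) \<longrightarrow> deviation a f y q \<in>\<^sub>M suc m))"

definition guess_val :: "'a \<Rightarrow> 'a \<Rightarrow> 'a \<Rightarrow> 'a \<Rightarrow> 'a" where
  "guess_val a f y p = rowrep a f y p \<cdot> pair p (guess_pos a f y p)"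

lemma dfn_agree [dfn]: "dtm s \<Longrightarrow> dtm t \<Longrightarrow> dtm u \<Longrightarrow> dfn (\<lambda>e. agree (s e) (t e) (u e))"
  by (rule dfn_subst3) (unfold agree_def, intro dfn)
lemma dfn_hasrow [dfn]: "dtm s \<Longrightarrow> dtm t \<Longrightarrow> dtm u \<Longrightarrow> dtm v \<Longrightarrow> dfn (\<lambda>e. hasrow (s e) (t e) (u e) (v e))"
  by (rule dfn_subst4) (unfold hasrow_def, intro dfn)
lemma dtm_rowrep [dfn]: "dtm s \<Longrightarrow> dtm t \<Longrightarrow> dtm u \<Longrightarrow> dtm v \<Longrightarrow> dtm (\<lambda>e. rowrep (s e) (t e) (u e) (v e))"
  by (rule dtm_subst4) (unfold rowrep_def, intro dfn)
lemma dtm_deviation [dfn]: "dtm s \<Longrightarrow> dtm t \<Longrightarrow> dtm u \<Longrightarrow> dtm v \<Longrightarrow> dtm (\<lambda>e. deviation (s e) (t e) (u e) (v e))"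
  by (rule dtm_subst4) (unfold deviation_def, intro dfn)
lemma dtm_deviations [dfn]: "dtm s \<Longrightarrow> dtm t \<Longrightarrow> dtm u \<Longrightarrow> dtm (\<lambda>e. deviations (s e) (t e) (u e))"
  by (rule dtm_subst3) (unfold deviations_def, intro dfn)
lemma dfn_col_agree [dfn]: "dtm s \<Longrightarrow> dtm t \<Longrightarrow> dfn (\<lambda>e. col_agree (s e) (t e))"
  by (rule dfn_subst2) (unfold col_agree_def, intro dfn)
lemma dfn_hascol [dfn]: "dtm s \<Longrightarrow> dtm t \<Longrightarrow> dtm u \<Longrightarrow> dfn (\<lambda>e. hascol (s e) (t e) (u e))"
  by (rule dfn_subst3) (unfold hascol_def, intro dfn)
lemma dtm_colrep [dfn]: "dtm s \<Longrightarrow> dtm t \<Longrightarrow> dtm u \<Longrightarrow> dtm (\<lambda>e. colrep (s e) (t e) (u e))"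
  by (rule dtm_subst3) (unfold colrep_def, intro dfn)
lemma dfn_covered [dfn]: "dtm s \<Longrightarrow> dtm t \<Longrightarrow> dtm u \<Longrightarrow> dfn (\<lambda>e. covered (s e) (t e) (u e))"
  by (rule dfn_subst3) (unfold covered_def, intro dfn)
lemma dtm_fresh [dfn]: "dtm s \<Longrightarrow> dtm t \<Longrightarrow> dtm u \<Longrightarrow> dtm (\<lambda>e. fresh (s e) (t e) (u e))"
  by (rule dtm_subst3) (unfold fresh_def, intro dfn)
lemma dtm_guess_pos [dfn]: "dtm s \<Longrightarrow> dtm t \<Longrightarrow> dtm u \<Longrightarrow> dtm v \<Longrightarrow> dtm (\<lambda>e. guess_pos (s e) (t e) (u e) (v e))"
  by (rule dtm_subst4) (unfold guess_pos_def, intro dfn)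
lemma dtm_guess_val [dfn]: "dtm s \<Longrightarrow> dtm t \<Longrightarrow> dtm u \<Longrightarrow> dtm v \<Longrightarrow> dtm (\<lambda>e. guess_val (s e) (t e) (u e) (v e))"
  by (rule dtm_subst4) (unfold guess_val_def, intro dfn)

section \<open>Agreement up to finitely many places\<close>

lemma agree_refl: "agree x x q"
  unfolding agree_def using emp_om by blast

lemma agree_trans:
  assumes "agree x y q" "agree y z q"
  shows "agree x z q"
proof -
  obtain m where m: "m \<in>\<^sub>M om" "\<And>n. n \<in>\<^sub>M om \<Longrightarrow> \<not> n \<in>\<^sub>M m \<Longrightarrow> x \<cdot> pair q n = y \<cdot> pair q n"
    using assms(1) unfolding agree_def by blast
  obtain l where l: "l \<in>\<^sub>M om" "\<And>n. n \<in>\<^sub>M om \<Longrightarrow> \<not> n \<in>\<^sub>M l \<Longrightarrow> y \<cdot> pair q n = z \<cdot> pair q n"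
    using assms(2) unfolding agree_def by blast
  obtain k where k: "k \<in>\<^sub>M om" "\<And>j. j \<in>\<^sub>M m \<or> j \<in>\<^sub>M l \<Longrightarrow> j \<in>\<^sub>M k"
    using om_max[OF m(1) l(1)] by blast
  have "x \<cdot> pair q n = z \<cdot> pair q n" if "n \<in>\<^sub>M om" "\<not> n \<in>\<^sub>M k" for n
    using m(2)[of n] l(2)[of n] k(2)[of n] that by metis
  then show ?thesis unfolding agree_def using k(1) by blast
qed

lemma agree_sym: "agree x y q \<Longrightarrow> agree y x q"
  unfolding agree_def by metis

lemma col_agree_refl: "col_agree x x"
  unfolding col_agree_def using emp_om by blast

lemma col_agree_trans:
  assumes "col_agree x y" "col_agree y z"
  shows "col_agree x z"
proof -
  obtain m where m: "m \<in>\<^sub>M om" "\<And>n. n \<in>\<^sub>M om \<Longrightarrow> \<not> n \<in>\<^sub>M m \<Longrightarrow> x \<cdot> pair n emp = y \<cdot> pair n emp"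
    using assms(1) unfolding col_agree_def by blast
  obtain l where l: "l \<in>\<^sub>M om" "\<And>n. n \<in>\<^sub>M om \<Longrightarrow> \<not> n \<in>\<^sub>M l \<Longrightarrow> y \<cdot> pair n emp = z \<cdot> pair n emp"
    using assms(2) unfolding col_agree_def by blast
  obtain k where k: "k \<in>\<^sub>M om" "\<And>j. j \<in>\<^sub>M m \<or> j \<in>\<^sub>M l \<Longrightarrow> j \<in>\<^sub>M k"
    using om_max[OF m(1) l(1)] by blast
  have "x \<cdot> pair n emp = z \<cdot> pair n emp" if "n \<in>\<^sub>M om" "\<not> n \<in>\<^sub>M k" for n
    using m(2)[of n] l(2)[of n] k(2)[of n] that by metis
  then show ?thesis unfolding col_agree_def using k(1) by blast
qed

lemma col_agree_sym: "col_agree x y \<Longrightarrow> col_agree y x"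
  unfolding col_agree_def by metis

lemma deviations_configs: "deviations a f y \<in>\<^sub>M configs" if "\<And>q. q \<in>\<^sub>M om \<Longrightarrow> deviation a f y q \<in>\<^sub>M om"
  unfolding configs_def deviations_def
proof (rule lam_fun)
  show "dtm (\<lambda>e. weight (deviation a f y (Fst (e 0))))" by (intro dfn)
  show "weight (deviation a f y (Fst u)) \<in>\<^sub>M R" if "u \<in>\<^sub>M om \<times>\<^sub>M om" for u
    using that weight \<open>\<And>q. q \<in>\<^sub>M om \<Longrightarrow> deviation a f y q \<in>\<^sub>M om\<close> by (auto simp: prod_iff)
qed

lemma deviations_app: "q \<in>\<^sub>M om \<Longrightarrow> n \<in>\<^sub>M om \<Longrightarrow> deviations a f y \<cdot> pair q n = weight (deviation a f y q)"
proof -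
  assume "q \<in>\<^sub>M om" "n \<in>\<^sub>M om"
  then have "deviations a f y \<cdot> pair q n = weight (deviation a f y (Fst (pair q n)))"
    unfolding deviations_def by (intro app_lam dfn) simp
  then show ?thesis by simp
qed

context
  fixes a f :: 'a
  assumes a: "is_ordinal a"
begin

lemma rowrep_agree:
  assumes "hasrow a f y q"
  shows "agree (rowrep a f y q) y q"
proof -
  obtain b where b: "b \<in>\<^sub>M a" "agree (f \<cdot> b) y q" using assms unfolding hasrow_def by blast
  have "least (\<lambda>b. b \<in>\<^sub>M a \<and> agree (f \<cdot> b) y q) \<in>\<^sub>M a \<and>
      agree (f \<cdot> least (\<lambda>b. b \<in>\<^sub>M a \<and> agree (f \<cdot> b) y q)) y q"
    by (rule least(2)[OF _ Ord_mem[OF a b(1)]]) (intro dfn, use b in blast)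
  then show ?thesis unfolding rowrep_def by blast
qed

lemma colrep_col_agree:
  assumes "hascol a f y"
  shows "col_agree (colrep a f y) (deviations a f y)"
proof -
  obtain b where b: "b \<in>\<^sub>M a" "col_agree (f \<cdot> b) (deviations a f y)" using assms unfolding hascol_def by blast
  have "least (\<lambda>b. b \<in>\<^sub>M a \<and> col_agree (f \<cdot> b) (deviations a f y)) \<in>\<^sub>M a \<and>
      col_agree (f \<cdot> least (\<lambda>b. b \<in>\<^sub>M a \<and> col_agree (f \<cdot> b) (deviations a f y))) (deviations a f y)"
    by (rule least(2)[OF _ Ord_mem[OF a b(1)]]) (intro dfn, use b in blast)
  then show ?thesis unfolding colrep_def by blast
qed

lemma deviation:
  assumes "hasrow a f y q"
  shows "deviation a f y q \<in>\<^sub>M om"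
    "n \<in>\<^sub>M om \<Longrightarrow> \<not> n \<in>\<^sub>M deviation a f y q \<Longrightarrow> rowrep a f y q \<cdot> pair q n = y \<cdot> pair q n"
proof -
  let ?P = "\<lambda>m. m \<in>\<^sub>M om \<and> (\<forall>n. n \<in>\<^sub>M om \<longrightarrow> \<not> n \<in>\<^sub>M m \<longrightarrow> rowrep a f y q \<cdot> pair q n = y \<cdot> pair q n)"
  obtain m where m: "m \<in>\<^sub>M om" "?P m"
    using rowrep_agree[OF assms] unfolding agree_def by blast
  have "?P (least ?P)"
    by (rule least(2)[where P = ?P, OF _ om_Ord[OF m(1)] m(2)]) (intro dfn)
  then show "deviation a f y q \<in>\<^sub>M om"
    "n \<in>\<^sub>M om \<Longrightarrow> \<not> n \<in>\<^sub>M deviation a f y q \<Longrightarrow> rowrep a f y q \<cdot> pair q n = y \<cdot> pair q n"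
    unfolding deviation_def by blast+
qed

lemma fresh_configs:
  assumes "y \<in>\<^sub>M configs"
  shows "fresh a f y \<in>\<^sub>M configs"
proof (cases "\<forall>q. q \<in>\<^sub>M om \<longrightarrow> hasrow a f y q")
  case True
  then have "deviations a f y \<in>\<^sub>M configs" using deviation(1) by (intro deviations_configs) blast
  with True show ?thesis by (simp add: fresh_def)
next
  case False
  then have "fresh a f y = y" unfolding fresh_def by (rule if_not_P)
  with assms show ?thesis by simp
qed

text \<open>An entry equal to the appended configuration would trivially agree with it: it would
  represent either the deviations or all rows of \<open>y\<close>, and the case at hand denies just
  that.\<close>

lemma fresh_new:
  assumes "\<not> covered a f y" "b \<in>\<^sub>M a"
  shows "fresh a f y \<noteq> f \<cdot> b"
proof
  assume eq: "fresh a f y = f \<cdot> b"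
  show False
  proof (cases "\<forall>q. q \<in>\<^sub>M om \<longrightarrow> hasrow a f y q")
    case True
    then have "f \<cdot> b = deviations a f y" using eq by (simp add: fresh_def)
    then have "hascol a f y" unfolding hascol_def using assms(2) col_agree_refl by metis
    with True assms(1) show False unfolding covered_def by blast
  next
    case False
    then have "fresh a f y = y" unfolding fresh_def by (rule if_not_P)
    then have "hasrow a f y q" for q unfolding hasrow_def using eq assms(2) agree_refl by metis
    with False show False by blast
  qed
qed

lemma hasrow_cong: "agree y z q \<Longrightarrow> hasrow a f y q = hasrow a f z q"
  unfolding hasrow_def using agree_trans agree_sym by blast

lemma rowrep_cong:
  assumes "agree y z q"
  shows "rowrep a f y q = rowrep a f z q"
proof -
  have "(\<lambda>b. b \<in>\<^sub>M a \<and> agree (f \<cdot> b) y q) = (\<lambda>b. b \<in>\<^sub>M a \<and> agree (f \<cdot> b) z q)"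
    using assms agree_trans agree_sym by (intro HOL.ext) blast
  then show ?thesis unfolding rowrep_def by (rule arg_cong)
qed

text \<open>Unlike the representative, the deviation depends on every entry of the row, so equality
  throughout the row is assumed.\<close>

lemma deviation_cong:
  assumes "\<And>n. n \<in>\<^sub>M om \<Longrightarrow> y \<cdot> pair q n = z \<cdot> pair q n"
  shows "deviation a f y q = deviation a f z q"
proof -
  have "agree y z q" unfolding agree_def using assms emp_om by blast
  then have r: "rowrep a f y q = rowrep a f z q" by (rule rowrep_cong)
  show ?thesis unfolding deviation_def r by (rule least_cong) (use assms in auto)
qed

text \<open>What happens in row \<open>p\<close> only changes the deviations at \<open>p\<close>.\<close>

context
  fixes y z p :: 'a
  assumes p: "p \<in>\<^sub>M om"
    and off: "\<And>q n. q \<in>\<^sub>M om \<Longrightarrow> n \<in>\<^sub>M om \<Longrightarrow> q \<noteq> p \<Longrightarrow> y \<cdot> pair q n = z \<cdot> pair q n"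
begin

lemma deviation_off: "q \<in>\<^sub>M om \<Longrightarrow> q \<noteq> p \<Longrightarrow> deviation a f y q = deviation a f z q"
  by (rule deviation_cong) (rule off)

lemma deviations_off: "col_agree (deviations a f y) (deviations a f z)"
  unfolding col_agree_def
\<comment> \<open>The two columns can differ only at \<open>p\<close>, hence not from
  \<open>suc p\<close> on.\<close>
proof (intro exI[of _ "suc p"] conjI allI impI)
  fix q assume "q \<in>\<^sub>M om" "\<not> q \<in>\<^sub>M suc p"
  then show "deviations a f y \<cdot> pair q emp = deviations a f z \<cdot> pair q emp"
    using deviation_off[of q] by (simp add: deviations_app)
qed (use p in simp)

lemma hascol_off: "hascol a f y = hascol a f z"
  unfolding hascol_def using deviations_off col_agree_trans col_agree_sym by blast

lemma colrep_off: "colrep a f y = colrep a f z"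
proof -
  have "(\<lambda>b. b \<in>\<^sub>M a \<and> col_agree (f \<cdot> b) (deviations a f y)) = (\<lambda>b. b \<in>\<^sub>M a \<and> col_agree (f \<cdot> b) (deviations a f z))"
    using deviations_off col_agree_trans col_agree_sym by (intro HOL.ext) blast
  then show ?thesis unfolding colrep_def by (rule arg_cong)
qed

text \<open>The place depends on the other rows alone, so it is known to the player before any box
  of row \<open>p\<close> is opened.\<close>

lemma guess_pos_off: "guess_pos a f y p = guess_pos a f z p"
  unfolding guess_pos_def colrep_off by (rule least_cong) (simp add: deviation_off cong: imp_cong)

text \<open>Whether row \<open>p\<close> has a representative depends only on its tail, so a single
  closed box in this row leaves it known whether the stage is covered.\<close>

lemma covered_off:
  assumes "agree y z p"
  shows "covered a f y = covered a f z"
proof -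
  have "agree y z q" if "q \<in>\<^sub>M om" for q
    using assms off[OF that] emp_om by (cases "q = p") (auto simp: agree_def)
  then have "hasrow a f y q = hasrow a f z q" if "q \<in>\<^sub>M om" for q using that hasrow_cong by blast
  then show ?thesis unfolding covered_def hascol_off by blast
qed

lemma guess_val_off: "agree y z p \<Longrightarrow> guess_val a f y p = guess_val a f z p"
  unfolding guess_val_def guess_pos_off using rowrep_cong by simp

end

text \<open>Predictions fail at finitely many rows only, so the deviations there have a maximum, and
  with the predicted number for row \<open>p\<close> it gives a bound.\<close>

lemma guess_pos:
  assumes "covered a f y" and p: "p \<in>\<^sub>M om"
  shows "guess_pos a f y p \<in>\<^sub>M om"
    "d \<in>\<^sub>M om \<Longrightarrow> weight d = colrep a f y \<cdot> pair p emp \<Longrightarrow> d \<in>\<^sub>M suc (guess_pos a f y p)"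
    "q \<in>\<^sub>M om \<Longrightarrow> q \<noteq> p \<Longrightarrow> colrep a f y \<cdot> pair q emp \<noteq> weight (deviation a f y q) \<Longrightarrow>
      deviation a f y q \<in>\<^sub>M suc (guess_pos a f y p)"
proof -
  let ?c = "colrep a f y" and ?d = "deviation a f y"
  let ?P = "\<lambda>m. m \<in>\<^sub>M om \<and>
     (\<forall>d. d \<in>\<^sub>M om \<longrightarrow> weight d = ?c \<cdot> pair p emp \<longrightarrow> d \<in>\<^sub>M suc m) \<and>
     (\<forall>q. q \<in>\<^sub>M om \<longrightarrow> q \<noteq> p \<longrightarrow> ?c \<cdot> pair q emp \<noteq> weight (?d q) \<longrightarrow> ?d q \<in>\<^sub>M suc m)"
  have d_om: "?d q \<in>\<^sub>M om" if "q \<in>\<^sub>M om" for q using deviation(1) assms(1) that unfolding covered_def by blast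
  obtain Q where Q: "Q \<in>\<^sub>M om" "\<And>q. q \<in>\<^sub>M om \<Longrightarrow> \<not> q \<in>\<^sub>M Q \<Longrightarrow> ?c \<cdot> pair q emp = weight (?d q)"
  proof -
    obtain m where m: "m \<in>\<^sub>M om" "\<And>q. q \<in>\<^sub>M om \<Longrightarrow> \<not> q \<in>\<^sub>M m \<Longrightarrow> ?c \<cdot> pair q emp = deviations a f y \<cdot> pair q emp"
      using colrep_col_agree[of y] assms(1) unfolding covered_def col_agree_def by blast
    show thesis by (rule that[OF m(1)]) (use m(2) deviations_app emp_om in simp)
  qed
  have suc_le: "j \<in>\<^sub>M suc k" if "j \<in>\<^sub>M suc m" "m \<in>\<^sub>M suc k" "k \<in>\<^sub>M om" for j m k
    using that Ord_trans[OF om_Ord[OF that(3)], of m j] by auto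
  \<comment> \<open>The maximum of finitely many deviations is built by induction inside the
    structure, whose natural numbers may be non-standard.\<close>
  have "\<exists>m. m \<in>\<^sub>M om \<and> (\<forall>q. q \<in>\<^sub>M Q \<longrightarrow> ?d q \<in>\<^sub>M suc m)"
  proof (rule om_induct[OF _ Q(1)], intro dfn)
    show "\<exists>m. m \<in>\<^sub>M om \<and> (\<forall>q. q \<in>\<^sub>M emp \<longrightarrow> ?d q \<in>\<^sub>M suc m)" using emp_om by auto
    fix n assume n: "n \<in>\<^sub>M om" "\<exists>m. m \<in>\<^sub>M om \<and> (\<forall>q. q \<in>\<^sub>M n \<longrightarrow> ?d q \<in>\<^sub>M suc m)"
    then obtain m where m: "m \<in>\<^sub>M om" "\<And>q. q \<in>\<^sub>M n \<Longrightarrow> ?d q \<in>\<^sub>M suc m" by blast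
    obtain k where k: "k \<in>\<^sub>M om" "m \<in>\<^sub>M suc k" "?d n \<in>\<^sub>M suc k"
      using om_max[OF m(1) d_om[OF n(1)]] by blast
    have "?d q \<in>\<^sub>M suc k" if "q \<in>\<^sub>M suc n" for q
      using that suc_le[OF m(2) k(2,1)] k(3) unfolding suc_iff[of q] by blast
    with k(1) show "\<exists>m. m \<in>\<^sub>M om \<and> (\<forall>q. q \<in>\<^sub>M suc n \<longrightarrow> ?d q \<in>\<^sub>M suc m)" by blast
  qed
  then obtain m where m: "m \<in>\<^sub>M om" "\<And>q. q \<in>\<^sub>M Q \<Longrightarrow> ?d q \<in>\<^sub>M suc m" by blast
  \<comment> \<open>The number predicted for row \<open>p\<close>, or any number at all if the
    prediction is not a weight.\<close>
  obtain l where l: "l \<in>\<^sub>M om" "\<And>d. d \<in>\<^sub>M om \<Longrightarrow> weight d = ?c \<cdot> pair p emp \<Longrightarrow> d = l"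
    using weight_inj emp_om by metis
  obtain k where k: "k \<in>\<^sub>M om" "m \<in>\<^sub>M suc k" "l \<in>\<^sub>M suc k" using om_max[OF m(1) l(1)] by blast
  have "?P k"
  proof (intro conjI allI impI)
    fix d assume "d \<in>\<^sub>M om" "weight d = ?c \<cdot> pair p emp"
    then show "d \<in>\<^sub>M suc k" using l(2) k(3) by blast
  next
    fix q assume q: "q \<in>\<^sub>M om" "?c \<cdot> pair q emp \<noteq> weight (?d q)"
    then have "q \<in>\<^sub>M Q" using Q(2) by blast
    then show "?d q \<in>\<^sub>M suc k" using suc_le[OF m(2) k(2,1)] by blast
  qed (rule k(1))
  then have "?P (least ?P)"
    by (intro least(2)[where P = ?P, OF _ om_Ord[OF k(1)]] dfn)
  then show "guess_pos a f y p \<in>\<^sub>M om"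
    "d \<in>\<^sub>M om \<Longrightarrow> weight d = colrep a f y \<cdot> pair p emp \<Longrightarrow> d \<in>\<^sub>M suc (guess_pos a f y p)"
    "q \<in>\<^sub>M om \<Longrightarrow> q \<noteq> p \<Longrightarrow> colrep a f y \<cdot> pair q emp \<noteq> weight (deviation a f y q) \<Longrightarrow>
      deviation a f y q \<in>\<^sub>M suc (guess_pos a f y p)"
    unfolding guess_pos_def by blast+
qed

text \<open>From its deviation on, the row equals its representative, so a wrong guess sits below
  the deviation. A correct prediction would have put the place at or above it.\<close>

lemma guess_val_wrong:
  assumes t: "covered a f y" and p: "p \<in>\<^sub>M om" and w: "y \<cdot> pair p (guess_pos a f y p) \<noteq> guess_val a f y p"
  shows "guess_pos a f y p \<in>\<^sub>M deviation a f y p" "colrep a f y \<cdot> pair p emp \<noteq> weight (deviation a f y p)"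
proof -
  have h: "hasrow a f y p" using t p unfolding covered_def by blast
  show 1: "guess_pos a f y p \<in>\<^sub>M deviation a f y p"
    using deviation(2)[OF h guess_pos(1)[OF t p]] w unfolding guess_val_def by metis
  show "colrep a f y \<cdot> pair p emp \<noteq> weight (deviation a f y p)"
  proof
    assume "colrep a f y \<cdot> pair p emp = weight (deviation a f y p)"
    then have "deviation a f y p \<in>\<^sub>M suc (guess_pos a f y p)"
      by (intro guess_pos(2)[OF t p deviation(1)[OF h]]) simp
    with 1 show False using mem_asym mem_irrefl by auto
  qed
qed

lemma guess_val_wrong_unique:
  assumes t: "covered a f y" and p: "p \<in>\<^sub>M om" "y \<cdot> pair p (guess_pos a f y p) \<noteq> guess_val a f y p"
    and q: "q \<in>\<^sub>M om" "y \<cdot> pair q (guess_pos a f y q) \<noteq> guess_val a f y q"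
  shows "p = q"
proof (rule ccontr)
  assume neq: "p \<noteq> q"
  note P = guess_val_wrong[OF t p] and Q = guess_val_wrong[OF t q]
  have 1: "deviation a f y q \<in>\<^sub>M suc (guess_pos a f y p)" using guess_pos(3)[OF t p(1) q(1)] neq Q(2) by blast
  have 2: "deviation a f y p \<in>\<^sub>M suc (guess_pos a f y q)" using guess_pos(3)[OF t q(1) p(1)] neq P(2) by blast
  have o: "is_ordinal (guess_pos a f y p)" "is_ordinal (guess_pos a f y q)" using guess_pos(1)[OF t] p(1) q(1) by auto
  have "guess_pos a f y q \<in>\<^sub>M guess_pos a f y p" by (rule Ord_mem_trans[OF o(1) Q(1) 1])
  moreover have "guess_pos a f y p \<in>\<^sub>M guess_pos a f y q" by (rule Ord_mem_trans[OF o(2) P(1) 2])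
  ultimately show False using mem_asym by blast
qed

end

lemma rowrep_mem:
  assumes "is_ordinal a" "hasrow a f y q"
  shows "\<exists>b. b \<in>\<^sub>M a \<and> rowrep a f y q = f \<cdot> b"
proof -
  obtain b where b: "b \<in>\<^sub>M a" "agree (f \<cdot> b) y q" using assms unfolding hasrow_def by blast
  let ?P = "\<lambda>b. b \<in>\<^sub>M a \<and> agree (f \<cdot> b) y q"
  have "?P (least ?P)"
    by (rule least(2)[where P = ?P, OF _ Ord_mem[OF assms(1) b(1)]]) (intro dfn, use b in blast)
  then show ?thesis unfolding rowrep_def by blast
qed

section \<open>The process\<close>

definition B :: 'a where "B = Pow R"

definition conf :: "'a \<Rightarrow> 'a \<Rightarrow> 'a" where
  "conf v W = lam (om \<times>\<^sub>M om) (\<lambda>u. v \<cdot> box W (Fst u) (Snd u))"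

text \<open>Junk values of \<open>f\<close> outside \<open>b\<close> must not matter at stage \<open>b\<close>, hence the restriction.\<close>

definition restr :: "'a \<Rightarrow> 'a \<Rightarrow> 'a" where "restr f b = lam b (\<lambda>x. f \<cdot> x)"

definition stage :: "'a \<Rightarrow> 'a \<Rightarrow> 'a \<Rightarrow> 'a" where "stage v f b = conf v (im f b)"

definition stop :: "'a \<Rightarrow> 'a \<Rightarrow> 'a \<Rightarrow> bool" where "stop v f b \<longleftrightarrow> covered b (restr f b) (stage v f b)"

text \<open>The length may be anything up to the first covered stage, that stage itself not being an
  index of the list.\<close>

definition vseq :: "'a \<Rightarrow> 'a \<Rightarrow> 'a \<Rightarrow> bool" where
  "vseq v a f \<longleftrightarrow> is_ordinal a \<and>
    (\<forall>b. b \<in>\<^sub>M a \<longrightarrow> \<not> stop v f b \<and> f \<cdot> b = fresh b (restr f b) (stage v f b))"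

text \<open>The equation \<open>f = restr f a\<close> fixes the list as a set and not just its
  values on \<open>a\<close>, so that \<open>desc\<close> can name it.\<close>

definition tseq :: "'a \<Rightarrow> 'a \<Rightarrow> 'a \<Rightarrow> bool" where
  "tseq v a f \<longleftrightarrow> vseq v a f \<and> f = restr f a \<and> stop v f a"

lemma dtm_conf [dfn]: "dtm s \<Longrightarrow> dtm t \<Longrightarrow> dtm (\<lambda>e. conf (s e) (t e))"
  by (rule dtm_subst2) (unfold conf_def, intro dfn)
lemma dtm_restr [dfn]: "dtm s \<Longrightarrow> dtm t \<Longrightarrow> dtm (\<lambda>e. restr (s e) (t e))"
  by (rule dtm_subst2) (unfold restr_def, intro dfn)
lemma dtm_stage [dfn]: "dtm s \<Longrightarrow> dtm t \<Longrightarrow> dtm u \<Longrightarrow> dtm (\<lambda>e. stage (s e) (t e) (u e))"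
  by (rule dtm_subst3) (unfold stage_def, intro dfn)
lemma dfn_stop [dfn]: "dtm s \<Longrightarrow> dtm t \<Longrightarrow> dtm u \<Longrightarrow> dfn (\<lambda>e. stop (s e) (t e) (u e))"
  by (rule dfn_subst3) (unfold stop_def, intro dfn)
lemma dfn_vseq [dfn]: "dtm s \<Longrightarrow> dtm t \<Longrightarrow> dtm u \<Longrightarrow> dfn (\<lambda>e. vseq (s e) (t e) (u e))"
  by (rule dfn_subst3) (unfold vseq_def, intro dfn)
lemma dfn_tseq [dfn]: "dtm s \<Longrightarrow> dtm t \<Longrightarrow> dtm u \<Longrightarrow> dfn (\<lambda>e. tseq (s e) (t e) (u e))"
  by (rule dfn_subst3) (unfold tseq_def, intro dfn)

lemma box_B: "box W p n \<in>\<^sub>M B"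
  unfolding B_def using box_Pow by simp

lemma conf_app: "q \<in>\<^sub>M om \<Longrightarrow> n \<in>\<^sub>M om \<Longrightarrow> conf v W \<cdot> pair q n = v \<cdot> box W q n"
proof -
  assume "q \<in>\<^sub>M om" "n \<in>\<^sub>M om"
  then have "conf v W \<cdot> pair q n = v \<cdot> box W (Fst (pair q n)) (Snd (pair q n))"
    unfolding conf_def by (intro app_lam dfn) simp
  then show ?thesis by simp
qed

lemma conf_configs: "v \<in>\<^sub>M funs B R \<Longrightarrow> conf v W \<in>\<^sub>M configs"
  unfolding configs_def conf_def by (rule lam_fun) (intro dfn, erule funD(1), rule box_B)

lemma stage_configs: "v \<in>\<^sub>M funs B R \<Longrightarrow> stage v f b \<in>\<^sub>M configs"
  unfolding stage_def by (rule conf_configs)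

lemma stage_app: "q \<in>\<^sub>M om \<Longrightarrow> n \<in>\<^sub>M om \<Longrightarrow> stage v f b \<cdot> pair q n = v \<cdot> box (im f b) q n"
  unfolding stage_def by (rule conf_app)

lemma restr_app: "x \<in>\<^sub>M b \<Longrightarrow> restr f b \<cdot> x = f \<cdot> x"
  unfolding restr_def by (rule app_lam) (intro dfn)

lemma restr_cong: "(\<And>x. x \<in>\<^sub>M b \<Longrightarrow> f \<cdot> x = g \<cdot> x) \<Longrightarrow> restr f b = restr g b"
  unfolding restr_def by (rule lam_cong)

lemma stage_cong: "(\<And>x. x \<in>\<^sub>M b \<Longrightarrow> f \<cdot> x = g \<cdot> x) \<Longrightarrow> stage v f b = stage v g b"
  unfolding stage_def using im_cong[of b f g] by simp

lemma stop_cong: "(\<And>x. x \<in>\<^sub>M b \<Longrightarrow> f \<cdot> x = g \<cdot> x) \<Longrightarrow> stop v f b = stop v g b"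
  unfolding stop_def using stage_cong[of b f g v] restr_cong[of b f g] by simp

section \<open>Uniqueness and termination of the process\<close>

lemma vseq_cong:
  assumes "\<And>x. x \<in>\<^sub>M a \<Longrightarrow> f \<cdot> x = g \<cdot> x"
  shows "vseq v a f = vseq v a g"
proof -
  have *: "vseq v a g" if "vseq v a f" and eq: "\<And>x. x \<in>\<^sub>M a \<Longrightarrow> f \<cdot> x = g \<cdot> x" for f g
    unfolding vseq_def
  proof (intro conjI allI impI)
    show a: "is_ordinal a" using that(1) unfolding vseq_def by blast
    fix b assume b: "b \<in>\<^sub>M a"
    have e: "f \<cdot> x = g \<cdot> x" if "x \<in>\<^sub>M b" for x using eq Ord_trans[OF a b that] by blast
    have s: "\<not> stop v f b" "f \<cdot> b = fresh b (restr f b) (stage v f b)"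
      using that(1) b unfolding vseq_def by blast+
    show "\<not> stop v g b" using s(1) stop_cong[OF e] by simp
    show "g \<cdot> b = fresh b (restr g b) (stage v g b)"
      using s(2) eq[OF b] restr_cong[OF e] stage_cong[OF e] by simp
  qed
  show ?thesis using *[of f g] *[of g f] assms by metis
qed

lemma vseq_mem:
  assumes "vseq v a f" "b \<in>\<^sub>M a"
  shows "vseq v b f"
  using assms Ord_mem[of a b] Ord_trans[of a b] unfolding vseq_def by blast

lemma vseq_unique:
  assumes f: "vseq v a f" and g: "vseq v c g" and x: "x \<in>\<^sub>M a" "x \<in>\<^sub>M c"
  shows "f \<cdot> x = g \<cdot> x"
proof -
  have o: "is_ordinal a" "is_ordinal c" using f g unfolding vseq_def by blast+
  have "x \<in>\<^sub>M a \<longrightarrow> x \<in>\<^sub>M c \<longrightarrow> f \<cdot> x = g \<cdot> x"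
  proof (rule Ord_induct[OF _ Ord_mem[OF o(1) x(1)]], intro dfn, intro impI)
    fix x assume IH: "\<And>y. y \<in>\<^sub>M x \<Longrightarrow> y \<in>\<^sub>M a \<longrightarrow> y \<in>\<^sub>M c \<longrightarrow> f \<cdot> y = g \<cdot> y"
      and x: "x \<in>\<^sub>M a" "x \<in>\<^sub>M c"
    have e: "f \<cdot> y = g \<cdot> y" if "y \<in>\<^sub>M x" for y
      using IH that Ord_trans[OF o(1) x(1)] Ord_trans[OF o(2) x(2)] by blast
    have "f \<cdot> x = fresh x (restr f x) (stage v f x)" using f x(1) unfolding vseq_def by blast
    also have "\<dots> = fresh x (restr g x) (stage v g x)" using restr_cong[OF e] stage_cong[OF e] by simp
    also have "\<dots> = g \<cdot> x" using g x(2) unfolding vseq_def by metis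
    finally show "f \<cdot> x = g \<cdot> x" .
  qed
  then show ?thesis using x by blast
qed

lemma tseq_unique:
  assumes f: "tseq v a f" and g: "tseq v c g"
  shows "a = c" "f = g"
proof -
  have o: "is_ordinal a" "is_ordinal c" using f g unfolding tseq_def vseq_def by blast+
  have no: False if h: "tseq v a f" "tseq v c g" "a \<in>\<^sub>M c" for a c f g
  proof -
    have vs: "vseq v a f" "vseq v c g" "stop v f a" using h unfolding tseq_def by blast+
    have oc: "is_ordinal c" using vs(2) unfolding vseq_def by blast
    have e: "f \<cdot> x = g \<cdot> x" if "x \<in>\<^sub>M a" for x
      by (rule vseq_unique[OF vs(1,2) that Ord_trans[OF oc h(3) that]])
    have "stop v g a" using stop_cong[OF e] vs(3) by simp
    with vs(2) h(3) show False unfolding vseq_def by blast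
  qed
  show ac: "a = c" using Ord_linear[OF o] no[OF f g] no[OF g f] by blast
  have vs: "vseq v a f" "vseq v a g" using f g unfolding tseq_def ac by blast+
  have "restr f a = restr g a" by (rule restr_cong) (rule vseq_unique[OF vs])
  then show "f = g" using f g unfolding tseq_def ac by metis
qed

lemma vseq_configs:
  assumes v: "v \<in>\<^sub>M funs B R" and f: "vseq v a f" and b: "b \<in>\<^sub>M a"
  shows "f \<cdot> b \<in>\<^sub>M configs"
proof -
  have "is_ordinal b" "f \<cdot> b = fresh b (restr f b) (stage v f b)"
    using f b Ord_mem unfolding vseq_def by blast+
  then show ?thesis using fresh_configs[OF _ stage_configs[OF v]] by simp
qed

lemma vseq_im_configs: "v \<in>\<^sub>M funs B R \<Longrightarrow> vseq v a f \<Longrightarrow> im f a \<subseteq>\<^sub>M configs"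
  unfolding subset_def im_iff using vseq_configs by blast

lemma vseq_new:
  assumes f: "vseq v a f" and b: "b \<in>\<^sub>M a" "c \<in>\<^sub>M b"
  shows "f \<cdot> b \<noteq> f \<cdot> c"
proof -
  have "is_ordinal b" "f \<cdot> b = fresh b (restr f b) (stage v f b)" "\<not> covered b (restr f b) (stage v f b)"
    using f b Ord_mem unfolding vseq_def stop_def by blast+
  then show ?thesis using fresh_new[of b "restr f b" "stage v f b" c] b restr_app[of c b f] by simp
qed

lemma tseq_ex:
  assumes v: "v \<in>\<^sub>M funs B R"
  shows "\<exists>a f. tseq v a f"
proof (rule ccontr)
  assume no: "\<not> ?thesis"
  \<comment> \<open>A list that arrives at a covered stage becomes a \<open>tseq\<close> once it is
    cut down to its length.\<close>
  have nostop: "\<not> stop v f a" if f: "vseq v a f" for a f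
  proof
    assume "stop v f a"
    have e: "f \<cdot> x = restr f a \<cdot> x" if "x \<in>\<^sub>M a" for x using restr_app[OF that] by simp
    have "restr f a = restr (restr f a) a" by (rule restr_cong) (rule e)
    then have "tseq v a (restr f a)"
      unfolding tseq_def using vseq_cong[OF e] f stop_cong[OF e] \<open>stop v f a\<close> by blast
    with no show False by blast
  qed
  have all: "\<exists>f. vseq v a f" if "is_ordinal a" for a
  proof (rule Ord_induct[OF _ that], intro dfn)
    fix a assume a: "is_ordinal a" and IH: "\<And>b. b \<in>\<^sub>M a \<Longrightarrow> \<exists>f. vseq v b f"
    \<comment> \<open>The next entry is described through any list of length \<open>b\<close>. By
      uniqueness all such lists give the same entry, so none is chosen and Replacement can assemble
      the longer list.\<close>
    define F where "F b = desc (\<lambda>x. \<exists>f. vseq v b f \<and> x = fresh b (restr f b) (stage v f b))" for b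
    have F: "F b = fresh b (restr f b) (stage v f b)" if f: "vseq v b f" for b f
      unfolding F_def
    proof (rule desc_eq)
      show "\<exists>f'. vseq v b f' \<and> fresh b (restr f b) (stage v f b) = fresh b (restr f' b) (stage v f' b)"
        using f by blast
      fix x assume "\<exists>f. vseq v b f \<and> x = fresh b (restr f b) (stage v f b)"
      then obtain g where g: "vseq v b g" "x = fresh b (restr g b) (stage v g b)" by blast
      have e: "g \<cdot> y = f \<cdot> y" if "y \<in>\<^sub>M b" for y by (rule vseq_unique[OF g(1) f that that])
      show "x = fresh b (restr f b) (stage v f b)" using g(2) restr_cong[OF e] stage_cong[OF e] by simp
    qed
    define f where "f = lam a F"
    have f_app: "f \<cdot> b = F b" if "b \<in>\<^sub>M a" for b
      unfolding f_def F_def by (rule app_lam[OF _ that]) (intro dfn)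
    have "\<not> stop v f b \<and> f \<cdot> b = fresh b (restr f b) (stage v f b)" if b: "b \<in>\<^sub>M a" for b
    proof -
      obtain g where g: "vseq v b g" using IH[OF b] by blast
      have e: "g \<cdot> y = f \<cdot> y" if y: "y \<in>\<^sub>M b" for y
      proof -
        have "g \<cdot> y = fresh y (restr g y) (stage v g y)" using g y unfolding vseq_def by blast
        also have "\<dots> = F y" using F[OF vseq_mem[OF g y]] by simp
        also have "\<dots> = f \<cdot> y" using f_app[OF Ord_trans[OF a b y]] by simp
        finally show ?thesis .
      qed
      have "\<not> stop v f b" using nostop[OF g] stop_cong[OF e] by simp
      moreover have "f \<cdot> b = fresh b (restr f b) (stage v f b)"
        using f_app[OF b] F[OF g] restr_cong[OF e] stage_cong[OF e] by simp
      ultimately show ?thesis by blast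
    qed
    then have "vseq v a f" unfolding vseq_def using a by blast
    then show "\<exists>f. vseq v a f" by blast
  qed
  obtain t where t: "is_ordinal t" "\<And>f. \<not> inj_into f t configs" using Hartogs by blast
  obtain f where f: "vseq v t f" using all[OF t(1)] by blast
  have "inj_into f t configs" unfolding inj_into_def using vseq_configs[OF v f] vseq_new[OF f] by blast
  with t(2) show False by blast
qed

section \<open>The guesses drawn from the final list\<close>

definition final_len :: "'a \<Rightarrow> 'a" where "final_len v = desc (\<lambda>a. \<exists>f. tseq v a f)"
definition final_seq :: "'a \<Rightarrow> 'a" where "final_seq v = desc (\<lambda>f. \<exists>a. tseq v a f)"
definition guess_box :: "'a \<Rightarrow> 'a \<Rightarrow> 'a" where
  "guess_box v p = box (im (final_seq v) (final_len v)) p (guess_pos (final_len v) (final_seq v) (stage v (final_seq v) (final_len v)) p)"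
definition guess_content :: "'a \<Rightarrow> 'a \<Rightarrow> 'a" where
  "guess_content v p = guess_val (final_len v) (final_seq v) (stage v (final_seq v) (final_len v)) p"

lemma dtm_final_len [dfn]: "dtm s \<Longrightarrow> dtm (\<lambda>e. final_len (s e))"
  by (rule dtm_subst1) (unfold final_len_def, intro dfn)
lemma dtm_final_seq [dfn]: "dtm s \<Longrightarrow> dtm (\<lambda>e. final_seq (s e))"
  by (rule dtm_subst1) (unfold final_seq_def, intro dfn)
lemma dtm_guess_box [dfn]: "dtm s \<Longrightarrow> dtm t \<Longrightarrow> dtm (\<lambda>e. guess_box (s e) (t e))"
  by (rule dtm_subst2) (unfold guess_box_def, intro dfn)
lemma dtm_guess_content [dfn]: "dtm s \<Longrightarrow> dtm t \<Longrightarrow> dtm (\<lambda>e. guess_content (s e) (t e))"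
  by (rule dtm_subst2) (unfold guess_content_def, intro dfn)

lemma final_len_final_seq:
  assumes "tseq v a f"
  shows "final_len v = a" "final_seq v = f"
proof -
  show "final_len v = a" unfolding final_len_def by (rule desc_eq) (use assms tseq_unique in blast)+
  show "final_seq v = f" unfolding final_seq_def by (rule desc_eq) (use assms tseq_unique in blast)+
qed

lemma tseq_final_len:
  assumes "v \<in>\<^sub>M funs B R"
  shows "tseq v (final_len v) (final_seq v)"
proof -
  obtain a f where "tseq v a f" using tseq_ex[OF assms] by blast
  with final_len_final_seq[OF this] show ?thesis by simp
qed

lemma tseqD:
  assumes "tseq v a f"
  shows "is_ordinal a" "vseq v a f" "stop v f a" "covered a f (stage v f a)" "restr f a = f"
proof -
  have *: "vseq v a f" "stop v f a" "f = restr f a" using assms unfolding tseq_def by blast+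
  then show "is_ordinal a" "vseq v a f" "stop v f a" "restr f a = f" unfolding vseq_def by simp_all
  with *(2) show "covered a f (stage v f a)" unfolding stop_def by simp
qed

lemma guess_box_B: "guess_box v p \<in>\<^sub>M B"
  unfolding guess_box_def by (rule box_B)

lemma guess_content_R:
  assumes v: "v \<in>\<^sub>M funs B R" and p: "p \<in>\<^sub>M om"
  shows "guess_content v p \<in>\<^sub>M R"
proof -
  note t = tseqD[OF tseq_final_len[OF v]]
  have "hasrow (final_len v) (final_seq v) (stage v (final_seq v) (final_len v)) p" using t(4) p unfolding covered_def by blast
  then obtain b where b: "b \<in>\<^sub>M final_len v" "rowrep (final_len v) (final_seq v) (stage v (final_seq v) (final_len v)) p = final_seq v \<cdot> b"
    using rowrep_mem[OF t(1)] by blast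
  show ?thesis
    unfolding guess_content_def guess_val_def b(2) by (rule configs_app[OF vseq_configs[OF v t(2) b(1)] p guess_pos(1)[OF t(1) t(4) p]])
qed

lemma wrong_unique:
  assumes v: "v \<in>\<^sub>M funs B R"
    and p: "p \<in>\<^sub>M om" "v \<cdot> guess_box v p \<noteq> guess_content v p" and q: "q \<in>\<^sub>M om" "v \<cdot> guess_box v q \<noteq> guess_content v q"
  shows "p = q"
proof -
  note t = tseqD[OF tseq_final_len[OF v]]
  have *: "v \<cdot> guess_box v p = stage v (final_seq v) (final_len v) \<cdot> pair p (guess_pos (final_len v) (final_seq v) (stage v (final_seq v) (final_len v)) p)"
    if "p \<in>\<^sub>M om" for p
    using stage_app[OF that guess_pos(1)[OF t(1) t(4) that]] unfolding guess_box_def by simp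
  show ?thesis
    by (rule guess_val_wrong_unique[OF t(1) t(4)]) (use p q in \<open>simp_all add: * guess_content_def\<close>)
qed

section \<open>Determining the guess\<close>

text \<open>With \<open>D\<close> the boxes a player has seen, these are the configurations that the
  player cannot tell from \<open>v\<close>.\<close>

definition agrees_on :: "'a \<Rightarrow> 'a \<Rightarrow> 'a \<Rightarrow> bool" where
  "agrees_on v D v' \<longleftrightarrow> v' \<in>\<^sub>M funs B R \<and> (\<forall>b. b \<in>\<^sub>M D \<longrightarrow> v' \<cdot> b = v \<cdot> b)"

lemma dfn_agrees_on [dfn]: "dtm s \<Longrightarrow> dtm t \<Longrightarrow> dtm u \<Longrightarrow> dfn (\<lambda>e. agrees_on (s e) (t e) (u e))"
  by (rule dfn_subst3) (unfold agrees_on_def, intro dfn)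

context
  fixes v D p :: 'a
  assumes v: "v \<in>\<^sub>M funs B R" and p: "p \<in>\<^sub>M om"
    and stuck: "\<And>c. c \<in>\<^sub>M B \<Longrightarrow> \<not> c \<in>\<^sub>M D \<Longrightarrow> \<exists>v'. agrees_on v D v' \<and> guess_box v' p = c"
begin

text \<open>Boxes that are still closed but possible guesses of \<open>p\<close> lie in row \<open>p\<close> of a stage that would be the
  last one, and there only one place is possible because it depends on the other rows alone.\<close>

lemma unopened_box:
  assumes vs: "\<And>v'. agrees_on v D v' \<Longrightarrow> vseq v' b f" and q: "q \<in>\<^sub>M om" "n \<in>\<^sub>M om"
    and D: "\<not> box (im f b) q n \<in>\<^sub>M D"
  shows "q = p" "\<exists>v'. agrees_on v D v' \<and> stop v' f b \<and> n = guess_pos b (restr f b) (stage v' f b) p"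
proof -
  obtain v' where v': "agrees_on v D v'" "guess_box v' p = box (im f b) q n" using stuck[OF box_B D] by blast
  have fv: "v' \<in>\<^sub>M funs B R" using v'(1) unfolding agrees_on_def by blast
  let ?a = "final_len v'" and ?g = "final_seq v'"
  have ts: "tseq v' ?a ?g" by (rule tseq_final_len[OF fv])
  note t = tseqD[OF ts]
  have f: "vseq v' b f" by (rule vs[OF v'(1)])
  have ob: "is_ordinal b" using f unfolding vseq_def by blast
  have eq: "box (im f b) q n = box (im ?g ?a) p (guess_pos ?a ?g (stage v' ?g ?a) p)"
    using v'(2) unfolding guess_box_def by simp
  note inj = box_inj[OF vseq_im_configs[OF fv f] vseq_im_configs[OF fv t(2)] q eq]
  show "q = p" by (rule inj(2))
  \<comment> \<open>A list and a proper prolongation never have the same members, as the first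
    further entry is new. So the set in the name of a box determines the stage.\<close>
  have no: False if h: "vseq v' a f" "vseq v' c g" "a \<in>\<^sub>M c" "im f a = im g c" for a c f g
  proof -
    have oc: "is_ordinal c" using h(2) unfolding vseq_def by blast
    have "g \<cdot> a \<in>\<^sub>M im f a" unfolding h(4) im_iff using h(3) by blast
    then obtain x where x: "x \<in>\<^sub>M a" "g \<cdot> a = f \<cdot> x" unfolding im_iff by blast
    have "f \<cdot> x = g \<cdot> x" by (rule vseq_unique[OF h(1,2) x(1) Ord_trans[OF oc h(3) x(1)]])
    with x(2) vseq_new[OF h(2,3) x(1)] show False by simp
  qed
  have ab: "?a = b"
    using Ord_linear[OF t(1) ob] no[OF f t(2) _ inj(1)] no[OF t(2) f _ inj(1)[symmetric]] by blast
  have e: "f \<cdot> x = ?g \<cdot> x" if "x \<in>\<^sub>M b" for x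
    by (rule vseq_unique[OF f t(2)]) (use that ab in simp_all)
  have c: "stop v' f b = stop v' ?g b" "restr f b = restr ?g b" "stage v' f b = stage v' ?g b"
    by (rule stop_cong restr_cong stage_cong; erule e)+
  have "stop v' f b" using c(1) t(3) ab by simp
  moreover have "n = guess_pos b (restr f b) (stage v' f b) p"
    using inj(3) t(5) c(2,3) ab by simp
  ultimately show "\<exists>v'. agrees_on v D v' \<and> stop v' f b \<and> n = guess_pos b (restr f b) (stage v' f b) p"
    using v'(1) by blast
qed

text \<open>All compatible configurations share the list below \<open>b\<close>. A closed box of
  this stage is the guess for one of them, so it lies in row \<open>p\<close>, at a place determined
  by the other rows, which are open. Hence at most one box of the stage is closed, and it cannot
  affect the representative of its row.\<close>

lemma stage_agree:
  assumes vs: "\<And>v'. agrees_on v D v' \<Longrightarrow> vseq v' b f" and v': "agrees_on v D v'"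
  shows "stop v' f b = stop v f b" (is ?stop)
    and "\<not> stop v f b \<Longrightarrow> stage v' f b = stage v f b"
    and "guess_pos b (restr f b) (stage v' f b) p = guess_pos b (restr f b) (stage v f b) p" (is ?guess_pos)
    and "guess_val b (restr f b) (stage v' f b) p = guess_val b (restr f b) (stage v f b) p" (is ?guess_val)
proof -
  have ob: "is_ordinal b" using vs[OF v'] unfolding vseq_def by blast
  have opened: "stage v1 f b \<cdot> pair q n = stage v f b \<cdot> pair q n"
    if "agrees_on v D v1" "q \<in>\<^sub>M om" "n \<in>\<^sub>M om" "box (im f b) q n \<in>\<^sub>M D" for v1 q n
    using that unfolding agrees_on_def by (simp add: stage_app)
  have off: "stage v1 f b \<cdot> pair q n = stage v f b \<cdot> pair q n"
    if "agrees_on v D v1" "q \<in>\<^sub>M om" "n \<in>\<^sub>M om" "q \<noteq> p" for v1 q n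
    using opened[OF that(1-3)] unopened_box(1)[OF vs that(2,3)] that(4) by blast
  have guess_pos: "guess_pos b (restr f b) (stage v1 f b) p = guess_pos b (restr f b) (stage v f b) p" if "agrees_on v D v1" for v1
    by (rule guess_pos_off[OF ob p off[OF that]])
  have ag: "agree (stage v1 f b) (stage v f b) p" if v1: "agrees_on v D v1" for v1
  proof (cases "\<forall>n. n \<in>\<^sub>M om \<longrightarrow> box (im f b) p n \<in>\<^sub>M D")
    case True
    then show ?thesis unfolding agree_def using opened[OF v1 p] emp_om by blast
  next
    case False
    then obtain m where m: "m \<in>\<^sub>M om" "\<not> box (im f b) p m \<in>\<^sub>M D" by blast
    \<comment> \<open>Both boxes are guesses for compatible configurations, and these all have the
      same place of the guess.\<close>
    have one: "n = m" if n: "n \<in>\<^sub>M om" "\<not> box (im f b) p n \<in>\<^sub>M D" for n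
      using unopened_box(2)[OF vs p n] unopened_box(2)[OF vs p m] guess_pos by metis
    have "stage v1 f b \<cdot> pair p n = stage v f b \<cdot> pair p n" if "n \<in>\<^sub>M om" "\<not> n \<in>\<^sub>M suc m" for n
      using opened[OF v1 p that(1)] one[OF that(1)] that(2) by auto
    then show ?thesis unfolding agree_def using m(1) suc_om by blast
  qed
  have stop: "stop v1 f b = stop v f b" if "agrees_on v D v1" for v1
    unfolding stop_def by (rule covered_off[OF ob p off[OF that] ag[OF that]])
  show ?stop ?guess_pos by (rule stop[OF v'], rule guess_pos[OF v'])
  show ?guess_val by (rule guess_val_off[OF ob p off[OF v'] ag[OF v']])
  assume ns: "\<not> stop v f b"
  have fv: "v' \<in>\<^sub>M funs B R" using v' unfolding agrees_on_def by blast
  show "stage v' f b = stage v f b"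
  proof (rule configs_ext[OF stage_configs[OF fv] stage_configs[OF v]])
    fix q n assume q: "q \<in>\<^sub>M om" "n \<in>\<^sub>M om"
    \<comment> \<open>A closed box would be the guess for a configuration that stops at this stage,
      but stopping does not vary among the compatible ones.\<close>
    have "box (im f b) q n \<in>\<^sub>M D"
      using unopened_box(2)[OF vs q] stop ns by blast
    then show "stage v' f b \<cdot> pair q n = stage v f b \<cdot> pair q n" by (rule opened[OF v' q])
  qed
qed

text \<open>By induction along the list of \<open>v\<close>, every compatible configuration yields
  the same entries, because all boxes of an uncovered stage are open. At the covered stage the one
  possibly closed box changes neither the place nor the value of the guess.\<close>

lemma stuck_determined:
  assumes v': "agrees_on v D v'"
  shows "guess_box v' p = guess_box v p" "guess_content v' p = guess_content v p"
proof -
  let ?a = "final_len v" and ?f = "final_seq v"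
  note t = tseqD[OF tseq_final_len[OF v]]
  have "b \<in>\<^sub>M ?a \<longrightarrow> (\<forall>v'. agrees_on v D v' \<longrightarrow> \<not> stop v' ?f b \<and> ?f \<cdot> b = fresh b (restr ?f b) (stage v' ?f b))"
    if "is_ordinal b" for b
  proof (rule Ord_induct[OF _ that], intro dfn, intro impI allI)
    fix b v' assume ob: "is_ordinal b" and b: "b \<in>\<^sub>M ?a" and v': "agrees_on v D v'"
      and IH: "\<And>c. c \<in>\<^sub>M b \<Longrightarrow> c \<in>\<^sub>M ?a \<longrightarrow>
        (\<forall>v'. agrees_on v D v' \<longrightarrow> \<not> stop v' ?f c \<and> ?f \<cdot> c = fresh c (restr ?f c) (stage v' ?f c))"
    have vs: "vseq v1 b ?f" if "agrees_on v D v1" for v1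
      unfolding vseq_def using ob IH that Ord_trans[OF t(1) b] by blast
    have ns: "\<not> stop v ?f b" "?f \<cdot> b = fresh b (restr ?f b) (stage v ?f b)"
      using t(2) b unfolding vseq_def by blast+
    show "\<not> stop v' ?f b \<and> ?f \<cdot> b = fresh b (restr ?f b) (stage v' ?f b)"
      using stage_agree(1,2)[OF vs v'] ns by simp
  qed
  then have vs: "vseq v1 ?a ?f" if "agrees_on v D v1" for v1
    unfolding vseq_def using t(1) Ord_mem[OF t(1)] that by blast
  note s = stage_agree[OF vs v', unfolded t(5)]
  have "tseq v' ?a ?f" unfolding tseq_def using vs[OF v'] t(3,5) s(1) by simp
  note final_len_final_seq[OF this]
  then show "guess_box v' p = guess_box v p" "guess_content v' p = guess_content v p"
    unfolding guess_box_def guess_content_def using s(3,4) by simp_all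
qed

end

section \<open>The strategies\<close>

definition extends :: "'a \<Rightarrow> 'a \<Rightarrow> bool" where
  "extends w v \<longleftrightarrow> v \<in>\<^sub>M funs B R \<and> w \<subseteq>\<^sub>M v"

text \<open>The condition on \<open>seen w\<close> keeps the guess legal also in histories that no
  play reaches. The existence of an extension makes \<open>c\<close> and \<open>x\<close>
  unique.\<close>

definition determined :: "'a \<Rightarrow> 'a \<Rightarrow> 'a \<Rightarrow> 'a \<Rightarrow> bool" where
  "determined p w c x \<longleftrightarrow> \<not> c \<in>\<^sub>M seen w \<and> (\<exists>v. extends w v) \<and> (\<forall>v. extends w v \<longrightarrow> guess_box v p = c \<and> guess_content v p = x)"

definition never_guessed :: "'a \<Rightarrow> 'a \<Rightarrow> 'a" where
  "never_guessed p w = Sep B (\<lambda>c. \<forall>v. extends w v \<longrightarrow> guess_box v p \<noteq> c)"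

text \<open>The last branch provides a legal move in every remaining history. While the guess box of
  the actual configuration is closed it is not taken, by the argument in
  \<open>open_move_avoids\<close>.\<close>

definition move :: "'a \<Rightarrow> 'a \<Rightarrow> 'a" where
  "move p w = (if \<exists>c x. determined p w c x then desc (\<lambda>m. \<exists>c x. determined p w c x \<and> m = pair (suc emp) (pair c x))
    else if \<exists>c. c \<in>\<^sub>M never_guessed p w \<and> \<not> c \<in>\<^sub>M seen w then pair emp (never_guessed p w) else pair emp B)"

text \<open>The product is a set bounding all histories: the moves by
  \<open>opening_sequence_bounded\<close>, the seen values as pairs of a box and a real.\<close>

definition open_histories :: 'a where
  "open_histories = Sep (Pow (Hartogs_number (Pow B) \<times>\<^sub>M Pow B) \<times>\<^sub>M Pow (B \<times>\<^sub>M R))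
     (\<lambda>h. \<exists>s w. is_history B R s w h \<and> \<not> all_opened B s)"

definition strat :: "'a \<Rightarrow> 'a" where "strat p = lam open_histories (\<lambda>h. move p (Snd h))"

definition team :: 'a where "team = lam om strat"

lemma dfn_extends [dfn]: "dtm s \<Longrightarrow> dtm t \<Longrightarrow> dfn (\<lambda>e. extends (s e) (t e))"
  by (rule dfn_subst2) (unfold extends_def, intro dfn)
lemma dfn_determined [dfn]: "dtm s \<Longrightarrow> dtm t \<Longrightarrow> dtm u \<Longrightarrow> dtm v \<Longrightarrow> dfn (\<lambda>e. determined (s e) (t e) (u e) (v e))"
  by (rule dfn_subst4) (unfold determined_def, intro dfn)
lemma dtm_never_guessed [dfn]: "dtm s \<Longrightarrow> dtm t \<Longrightarrow> dtm (\<lambda>e. never_guessed (s e) (t e))"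
  by (rule dtm_subst2) (unfold never_guessed_def, intro dfn)
lemma dtm_move [dfn]: "dtm s \<Longrightarrow> dtm t \<Longrightarrow> dtm (\<lambda>e. move (s e) (t e))"
  by (rule dtm_subst2) (unfold move_def, intro dfn)
lemma dtm_strat [dfn]: "dtm s \<Longrightarrow> dtm (\<lambda>e. strat (s e))"
  by (rule dtm_subst1) (unfold strat_def, intro dfn)

lemma never_guessed_iff: "c \<in>\<^sub>M never_guessed p w \<longleftrightarrow> c \<in>\<^sub>M B \<and> (\<forall>v. extends w v \<longrightarrow> guess_box v p \<noteq> c)"
  unfolding never_guessed_def by (rule Sep_iff) (intro dfn)

lemma move_determined:
  assumes "determined p w c x"
  shows "move p w = pair (suc emp) (pair c x)"
proof -
  have "c' = c \<and> x' = x" if "determined p w c' x'" for c' x'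
    using that assms unfolding determined_def by metis
  then have "desc (\<lambda>m. \<exists>c x. determined p w c x \<and> m = pair (suc emp) (pair c x)) = pair (suc emp) (pair c x)"
    using assms by (intro desc_eq) blast+
  then show ?thesis unfolding move_def using assms by auto
qed

lemma move_cases:
  obtains (guess) c x where "determined p w c x" "move p w = pair (suc emp) (pair c x)"
  | (never_guessed) "move p w = pair emp (never_guessed p w)" "\<exists>c. c \<in>\<^sub>M never_guessed p w \<and> \<not> c \<in>\<^sub>M seen w"
  | (all) "move p w = pair emp B" "\<not> (\<exists>c x. determined p w c x)" "\<not> (\<exists>c. c \<in>\<^sub>M never_guessed p w \<and> \<not> c \<in>\<^sub>M seen w)"
proof (cases "\<exists>c x. determined p w c x")
  case True
  then show ?thesis using move_determined guess by blast
next
  case False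
  then have eq: "move p w = (if \<exists>c. c \<in>\<^sub>M never_guessed p w \<and> \<not> c \<in>\<^sub>M seen w then pair emp (never_guessed p w) else pair emp B)"
    unfolding move_def by (rule if_not_P)
  show ?thesis
    using never_guessed all eq False by (cases "\<exists>c. c \<in>\<^sub>M never_guessed p w \<and> \<not> c \<in>\<^sub>M seen w") simp_all
qed

lemma move_legal:
  assumes h: "is_history B R s w h" "\<not> all_opened B s" and p: "p \<in>\<^sub>M om"
  shows "legal_move B R s (move p w)"
proof (rule move_cases[of p w])
  fix c x assume c: "determined p w c x" "move p w = pair (suc emp) (pair c x)"
  then obtain v where v: "extends w v" "guess_box v p = c" "guess_content v p = x" unfolding determined_def by blast
  then have "c \<in>\<^sub>M B" "x \<in>\<^sub>M R" using guess_box_B guess_content_R p unfolding extends_def by blast+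
  moreover have "\<not> opened s c" using c(1) history_seen(1)[OF h(1)] unfolding determined_def by blast
  ultimately show ?thesis
    unfolding legal_move_def is_guess_move_iff using c(2) by blast
next
  assume r: "move p w = pair emp (never_guessed p w)" "\<exists>c. c \<in>\<^sub>M never_guessed p w \<and> \<not> c \<in>\<^sub>M seen w"
  have "never_guessed p w \<subseteq>\<^sub>M B" unfolding subset_def never_guessed_iff by blast
  moreover have "\<exists>c. c \<in>\<^sub>M never_guessed p w \<and> \<not> opened s c" using r(2) history_seen(1)[OF h(1)] by blast
  ultimately show ?thesis
    unfolding legal_move_def is_open_move_iff using r(1) by blast
next
  assume r: "move p w = pair emp B"
  have "\<exists>c. c \<in>\<^sub>M B \<and> \<not> opened s c" using h(2) unfolding all_opened_def by blast
  moreover have "B \<subseteq>\<^sub>M B" by (simp add: subset_def)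
  ultimately show ?thesis
    unfolding legal_move_def is_open_move_iff using r by blast
qed

lemma open_histories_iff: "h \<in>\<^sub>M open_histories \<longleftrightarrow> (\<exists>s w. is_history B R s w h \<and> \<not> all_opened B s)"
proof -
  have "h \<in>\<^sub>M open_histories \<longleftrightarrow> h \<in>\<^sub>M Pow (Hartogs_number (Pow B) \<times>\<^sub>M Pow B) \<times>\<^sub>M Pow (B \<times>\<^sub>M R) \<and>
      (\<exists>s w. is_history B R s w h \<and> \<not> all_opened B s)"
    unfolding open_histories_def by (rule Sep_iff) (intro dfn)
  moreover have "h \<in>\<^sub>M Pow (Hartogs_number (Pow B) \<times>\<^sub>M Pow B) \<times>\<^sub>M Pow (B \<times>\<^sub>M R)" if "is_history B R s w h" for s w
  proof -
    note hd = history_seen(2-4)[OF that]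
    show ?thesis unfolding hd(2) pair_prod_iff using hd(1) opening_sequence_bounded[OF hd(3)] by blast
  qed
  ultimately show ?thesis by blast
qed

lemma maps_strat: "maps (strat p) h m \<longleftrightarrow> h \<in>\<^sub>M open_histories \<and> m = move p (Snd h)"
proof -
  have "u \<in>\<^sub>M strat p \<longleftrightarrow> (\<exists>h. h \<in>\<^sub>M open_histories \<and> u = pair h (move p (Snd h)))" for u
    unfolding strat_def by (rule lam_iff) (intro dfn)
  then show ?thesis unfolding maps_iff by auto
qed

lemma strat_strategy:
  assumes p: "p \<in>\<^sub>M om"
  shows "is_strategy B R (strat p)"
  unfolding is_strategy_def
proof (intro conjI allI impI)
  fix u assume "u \<in>\<^sub>M strat p"
  moreover have "u \<in>\<^sub>M strat p \<longleftrightarrow> (\<exists>h. h \<in>\<^sub>M open_histories \<and> u = pair h (move p (Snd h)))"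
    unfolding strat_def by (rule lam_iff) (intro dfn)
  ultimately obtain h s w where h: "u = pair h (move p (Snd h))" "is_history B R s w h" "\<not> all_opened B s"
    unfolding open_histories_iff by blast
  have "Snd h = w" using history_seen(3)[OF h(2)] by simp
  then show "\<exists>s w h m. is_history B R s w h \<and> \<not> all_opened B s \<and> legal_move B R s m \<and> is_pair h m u"
    unfolding is_pair_iff using h move_legal[OF h(2,3) p] by blast
next
  fix s w h assume "is_history B R s w h" "\<not> all_opened B s"
  then show "\<exists>!m. maps (strat p) h m" unfolding maps_strat open_histories_iff by blast
qed

lemma maps_team: "maps team p \<tau> \<longleftrightarrow> p \<in>\<^sub>M om \<and> \<tau> = strat p"
proof -
  have "u \<in>\<^sub>M team \<longleftrightarrow> (\<exists>p. p \<in>\<^sub>M om \<and> u = pair p (strat p))" for u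
    unfolding team_def by (rule lam_iff) (intro dfn)
  then show ?thesis unfolding maps_iff by auto
qed

lemma team_strategy: "is_team_strategy om B R team"
  unfolding is_team_strategy_def
proof (intro conjI allI impI)
  fix u assume "u \<in>\<^sub>M team"
  moreover have "u \<in>\<^sub>M team \<longleftrightarrow> (\<exists>p. p \<in>\<^sub>M om \<and> u = pair p (strat p))"
    unfolding team_def by (rule lam_iff) (intro dfn)
  ultimately show "\<exists>p \<tau>. p \<in>\<^sub>M om \<and> is_strategy B R \<tau> \<and> is_pair p \<tau> u"
    unfolding is_pair_iff using strat_strategy by blast
next
  fix p assume "p \<in>\<^sub>M om"
  then show "\<exists>!\<tau>. maps team p \<tau>" unfolding maps_team by blast
qed

section \<open>Plays of a strategy against a fixed configuration\<close>

context
  fixes v p :: 'a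
  assumes v: "v \<in>\<^sub>M funs B R" and p: "p \<in>\<^sub>M om"
begin

lemma sees_extends:
  assumes "sees v s w"
  shows "extends w v'\<longleftrightarrow> agrees_on v (seen w) v'" "extends w v" "c \<in>\<^sub>M seen w \<longleftrightarrow> c \<in>\<^sub>M B \<and> opened s c"
proof -
  have w: "u \<in>\<^sub>M w \<longleftrightarrow> (\<exists>b. opened s b \<and> b \<in>\<^sub>M B \<and> u = pair b (v \<cdot> b))" for u
    using assms funD(3)[OF v] unfolding sees_def is_pair_iff by metis
  show seen: "c \<in>\<^sub>M seen w \<longleftrightarrow> c \<in>\<^sub>M B \<and> opened s c" for c
    unfolding seen_iff w using Fst_pair by metis
  have *: "w \<subseteq>\<^sub>M v' \<longleftrightarrow> (\<forall>b. b \<in>\<^sub>M seen w \<longrightarrow> v' \<cdot> b = v \<cdot> b)" if v': "v' \<in>\<^sub>M funs B R" for v'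
  proof -
    have "w \<subseteq>\<^sub>M v' \<longleftrightarrow> (\<forall>b. b \<in>\<^sub>M B \<and> opened s b \<longrightarrow> pair b (v \<cdot> b) \<in>\<^sub>M v')"
      unfolding subset_def w by blast
    also have "\<dots> \<longleftrightarrow> (\<forall>b. b \<in>\<^sub>M seen w \<longrightarrow> v' \<cdot> b = v \<cdot> b)"
      unfolding seen funD(3)[OF v'] by auto
    finally show ?thesis .
  qed
  then show "extends w v'\<longleftrightarrow> agrees_on v (seen w) v'" unfolding extends_def agrees_on_def by blast
  show "extends w v" unfolding extends_def using * v by blast
qed

text \<open>The actual \<open>v\<close> is among the compatible configurations, so its guess box is
  never in \<open>never_guessed p w\<close>. What remains is to exclude the move that opens
  everything.\<close>

lemma open_move_avoids:
  assumes w: "sees v s w" and c: "\<not> guess_box v p \<in>\<^sub>M seen w" and m: "move p w = pair emp S"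
  shows "\<not> guess_box v p \<in>\<^sub>M S"
proof (rule move_cases[of p w])
  fix c x assume "move p w = pair (suc emp) (pair c x)"
  with m show ?thesis using emp_neq_suc(1)[of emp] by simp
next
  assume "move p w = pair emp (never_guessed p w)"
  then have "S = never_guessed p w" using m by simp
  then show ?thesis using sees_extends(2)[OF w] never_guessed_iff by blast
next
  assume r: "\<not> (\<exists>c x. determined p w c x)" "\<not> (\<exists>c. c \<in>\<^sub>M never_guessed p w \<and> \<not> c \<in>\<^sub>M seen w)"
  \<comment> \<open>No closed box can be ruled out, which is the situation of
    \<open>stuck_determined\<close>; the first branch of \<open>move\<close> should then have
    applied.\<close>
  have "\<exists>v'. agrees_on v (seen w) v' \<and> guess_box v' p = c" if "c \<in>\<^sub>M B" "\<not> c \<in>\<^sub>M seen w" for c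
    using r(2) that unfolding never_guessed_iff sees_extends(1)[OF w] by blast
  then have "determined p w (guess_box v p) (guess_content v p)"
    unfolding determined_def using c sees_extends(1,2)[OF w] stuck_determined[OF v p] by blast
  with r(1) show ?thesis by blast
qed

lemma reaches_avoids:
  assumes "reaches B v (strat p) s h"
  shows "\<not> opened s (guess_box v p)"
proof
  assume o: "opened s (guess_box v p)"
  have os: "is_opening_sequence B s" using assms unfolding reaches_def by blast
  obtain a where a: "is_ordinal a" "s \<in>\<^sub>M funs a (Pow B)" using opening_sequenceD[OF os] by blast
  \<comment> \<open>Moves are indexed by an ordinal, so there is a first one that opens the guess
    box; before it the box is closed.\<close>
  define P where "P b \<longleftrightarrow> (\<exists>S. pair b S \<in>\<^sub>M s \<and> guess_box v p \<in>\<^sub>M S)" for b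
  have dP: "dfn (\<lambda>e. P (e 0))" unfolding P_def by (intro dfn)
  obtain b where b: "P b" using o unfolding opened_iff P_def by blast
  then have "b \<in>\<^sub>M a" unfolding P_def funD(3)[OF a(2)] by blast
  note l = least[OF dP Ord_mem[OF a(1) this] b]
  obtain S where S: "pair (least P) S \<in>\<^sub>M s" "guess_box v p \<in>\<^sub>M S" using l(2) unfolding P_def by blast
  obtain w where w: "sees v (restriction s (least P)) w" "maps (strat p) (pair (restriction s (least P)) w) (pair emp S)"
    using assms S(1) unfolding reaches_def maps_iff[of s] is_restriction_iff is_pair_iff is_open_move_iff by blast
  have "\<not> opened (restriction s (least P)) (guess_box v p)" unfolding opened_restriction using l(3) unfolding P_def by blast
  then have "\<not> guess_box v p \<in>\<^sub>M seen w" using sees_extends(3)[OF w(1)] by blast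
  moreover have "move p w = pair emp S" using w(2) unfolding maps_strat by simp
  ultimately show False using open_move_avoids[OF w(1)] S(2) by blast
qed

text \<open>The guess box stays closed, so failure by opening everything is impossible. A guess is
  made only when all compatible configurations agree on it, and \<open>v\<close> is one of
  them.\<close>

lemma fails_wrong:
  assumes "fails B v (strat p)"
  shows "v \<cdot> guess_box v p \<noteq> guess_content v p"
proof -
  obtain s h where h: "reaches B v (strat p) s h"
      "(\<exists>b x m. maps (strat p) h m \<and> is_guess_move b x m \<and> \<not> maps v b x) \<or> all_opened B s"
    using assms unfolding fails_def by blast
  have "\<not> all_opened B s" using reaches_avoids[OF h(1)] guess_box_B unfolding all_opened_def by blast
  then obtain b x where m: "maps (strat p) h (pair (suc emp) (pair b x))" "\<not> maps v b x"
    using h(2) unfolding is_guess_move_iff by blast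
  obtain w where w: "sees v s w" "h = pair s w"
    using h(1) unfolding reaches_def is_pair_iff by blast
  have move: "move p w = pair (suc emp) (pair b x)" using m(1) w(2) unfolding maps_strat by simp
  have "b = guess_box v p \<and> x = guess_content v p"
  proof (rule move_cases[of p w])
    fix c y assume c: "determined p w c y" "move p w = pair (suc emp) (pair c y)"
    then have "guess_box v p = c" "guess_content v p = y" using sees_extends(2)[OF w(1)] unfolding determined_def by blast+
    with c(2) move show ?thesis by simp
  qed (use move emp_neq_suc in auto)
  then show ?thesis using m(2) guess_box_B[of v p] unfolding maps_iff funD(3)[OF v] by auto
qed

end

lemma winnable_reals: "winnable om B R"
  unfolding winnable_def
proof (intro exI[of _ team] conjI allI impI)
  show "is_team_strategy om B R team" by (rule team_strategy)
  fix v p q \<tau> \<rho>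
  assume "is_function v B R" and m: "maps team p \<tau>" "maps team q \<rho>" and f: "fails B v \<tau>" "fails B v \<rho>"
  then have v: "v \<in>\<^sub>M funs B R" using fun_iff_is by blast
  have p: "p \<in>\<^sub>M om" "\<tau> = strat p" and q: "q \<in>\<^sub>M om" "\<rho> = strat q" using m unfolding maps_team by blast+
  show "p = q"
    by (rule wrong_unique[OF v p(1) fails_wrong[OF v p(1)] q(1) fails_wrong[OF v q(1)]])
      (use f p(2) q(2) in simp_all)
qed

end

theorem theorem2:
  fixes mem :: "'m \<Rightarrow> 'm \<Rightarrow> bool"
    and N R B add mul lt :: 'm
  assumes "ZF mem"
    and "set_structure.is_omega mem N"
    and "set_structure.is_reals mem R add mul lt"
    and "set_structure.is_Pow mem R B"
  shows "set_structure.winnable mem N B R"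
proof -
  interpret ZF_reals mem R add mul lt
    using assms(1,3) by (intro ZF_reals.intro ZF_reals_axioms.intro)
  have "N = om" using assms(2) is_omega_iff by simp
  moreover have "B = ZF_reals.B mem R" using assms(4) is_Pow_iff B_def by simp
  ultimately show ?thesis using winnable_reals by simp
qed

end
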